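(* Let $G$ be a Lie group and let $P_n$, $n=0,1,2,\dots$, be dissipative distributions on $G$. Denote by $\mu_n(t)$, $t>0$, the corresponding semigroups of (subprobability) measures, i.e. $P_n$ is the generating functional of $(\mu_n(t))_{t>0}$. If $$\langle \mu_n(t), f\rangle \longrightarrow \langle \mu_0(t), f\rangle \quad (n\to\infty)\qquad\text{for all } f\in C_b(G),\ t>0,$$ then, for every $f\in C_b^2(G)$, $$\langle P_n, f\rangle \longrightarrow \langle P_0, f\rangle\quad (n\to\infty).$$ Moreover, if $P_0=0$, then $\|P_n\|\to 0$ as $n\to\infty$, where $\|P_n\|$ is the norm of $P_n$ as a linear functional on $C_b^2(G)$.
   Context: $G$ is a Lie group with identity $e$, and $X_1,\dots,X_d$ is a fixed basis of the left-invariant vector fields on $G$. $C_b(G)$ is the Banach space of bounded continuous functions with the sup norm $\|\cdot\|_\infty$. For a multi-index $\alpha$, $X^\alpha=X_1^{\alpha_1}\cdots X_d^{\alpha_d}$, and $$C_b^2(G)=\{f\in C^2(G): \|f\|_{C^2}<\infty\},\qquad \|f\|_{C^2}=\max_{|\alpha|\le 2}\|X^\alpha f\|_\infty .$$ A Schwartz distribution $P$ on $G$ is called dissipative if $\langle P,f\rangle\le 0$ for every real $f\in C_c^\infty(G)$ which attains its maximal value at $e$. Such a $P$ coincides on $G\setminus\{e\}$ with a positive Radon measure, denoted $P(dx)$, which is bounded (finite) outside any open neighbourhood of $e$. $P$ extends to a continuous linear functional on $C_b^2(G)$, still denoted $P$, such that $\langle P,f\rangle=\int_G f(x)\,P(dx)$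 whenever $f\in C_b^2(G)$ and $f(e)=X_jf(e)=X_jX_kf(e)=0$ for all $1\le j,k\le d$. $\langle P,f\rangle$ for $f\in C_b^2(G)$ refers to this extension (concretely, $\langle P,f\rangle=\langle P,\varphi f\rangle+\int_G (1-\varphi(x))f(x)\,P(dx)$ for any $\varphi\in C_c^\infty(G)$ equal to $1$ near $e$). $\|P\|$ is the norm of $P$ as a linear functional on $C_b^2(G)$. By Hunt theory, every dissipative distribution $P$ is the generating functional of a unique weakly continuous convolution semigroup $(\mu(t))_{t>0}$ of subprobability measures on $G$: $\mu(s)\star\mu(t)=\mu(s+t)$, $\mu(t)\to\delta_e$ weakly as $t\to0^+$, and $\langle P,f\rangle=\lim_{t\to 0^+}\frac1t\langle\mu(t)-\delta_e,f\rangle$ for $f\in C_c^\infty(G)$. This is the semigroup corresponding to $P$. Here $\langle\mu,f\rangle=\int_G f\,d\mu$. *)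

theory Defs
  imports "HOL-Probability.Probability"
begin

section \<open>Lie groups\<close>

text \<open>
  On an open set and in finite dimension this is the usual \<open>C\<^sup>k\<close> condition: every iterated directional
  derivative of order at most \<open>k\<close> exists and is continuous.
\<close>

primrec Ck_on :: "nat \<Rightarrow> 'a::real_normed_vector set \<Rightarrow> ('a \<Rightarrow> 'b::real_normed_vector) \<Rightarrow> bool" where
  "Ck_on 0 S f \<longleftrightarrow> continuous_on S f"
| "Ck_on (Suc k) S f \<longleftrightarrow> (\<forall>x\<in>S. f differentiable (at x)) \<and>
     (\<forall>v. Ck_on k S (\<lambda>x. frechet_derivative f (at x) v))"

definition smooth_map_on :: "'a::real_normed_vector set \<Rightarrow> ('a \<Rightarrow> 'b::real_normed_vector) \<Rightarrow> bool" where
  "smooth_map_on S f \<longleftrightarrow> (\<forall>k. Ck_on k S f)"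

text \<open>
  A chart is a pair of its domain and its coordinate map; the map is irrelevant outside the domain.
  The model space is a finite-dimensional inner product space rather than a type of class
  \<^class>\<open>euclidean_space\<close>, so that dimension \<open>0\<close> is not excluded.

  The group law is written additively, since \<^class>\<open>topological_group_add\<close> is the library's class
  of topological groups. It is not assumed to be commutative, and the identity \<open>e\<close> is \<open>0\<close>.
\<close>

type_synonym ('g, 'e) chart = "'g set \<times> ('g \<Rightarrow> 'e)"

definition smooth_atlas :: "('g::{t2_space, second_countable_topology}, 'e::real_inner) chart set \<Rightarrow> bool" where
  "smooth_atlas A \<longleftrightarrow>
     (\<exists>B :: 'e set. finite B \<and> span B = UNIV) \<and>
     (\<Union>(U, \<phi>)\<in>A. U) = UNIV \<and>
     (\<forall>(U, \<phi>)\<in>A. open U \<and> open (\<phi> ` U) \<and> homeomorphism U (\<phi> ` U) \<phi> (inv_into U \<phi>)) \<and>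
     (\<forall>(U, \<phi>)\<in>A. \<forall>(V, \<psi>)\<in>A. smooth_map_on (\<phi> ` (U \<inter> V)) (\<psi> \<circ> inv_into U \<phi>))"

definition lie_group ::
  "('g::{topological_group_add, t2_space, second_countable_topology}, 'e::real_inner) chart set \<Rightarrow> bool" where
  "lie_group A \<longleftrightarrow> smooth_atlas A \<and>
     (\<forall>(U, \<phi>)\<in>A. \<forall>(V, \<psi>)\<in>A. \<forall>(W, \<theta>)\<in>A.
        smooth_map_on {(p, q). p \<in> \<phi> ` U \<and> q \<in> \<psi> ` V \<and> inv_into U \<phi> p + inv_into V \<psi> q \<in> W}
          (\<lambda>(p, q). \<theta> (inv_into U \<phi> p + inv_into V \<psi> q))) \<and>
     (\<forall>(U, \<phi>)\<in>A. \<forall>(V, \<psi>)\<in>A.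
        smooth_map_on {p \<in> \<phi> ` U. - inv_into U \<phi> p \<in> V} (\<lambda>p. \<psi> (- inv_into U \<phi> p)))"

definition Ck :: "('g, 'e::real_inner) chart set \<Rightarrow> nat \<Rightarrow> ('g \<Rightarrow> complex) set" where
  "Ck A k = {f. \<forall>(U, \<phi>)\<in>A. Ck_on k (\<phi> ` U) (f \<circ> inv_into U \<phi>)}"

definition fsupport :: "('g::topological_space \<Rightarrow> complex) \<Rightarrow> 'g set" where
  "fsupport f = closure {x. f x \<noteq> 0}"

definition Cc_smooth :: "('g::topological_space, 'e::real_inner) chart set \<Rightarrow> ('g \<Rightarrow> complex) set" where
  "Cc_smooth A = (\<Inter>k. Ck A k) \<inter> {f. compact (fsupport f)}"


section \<open>Left-invariant vector fields\<close>

text \<open>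
  A chart \<open>(U, \<phi>)\<close> at the identity identifies the tangent space there with the model space: \<open>v\<close> is
  the velocity at \<open>t = 0\<close> of the curve \<open>\<phi>\<^sup>-\<^sup>1 (\<phi> e + t v)\<close>. The left-invariant vector field with value \<open>v\<close> at \<open>e\<close>
  differentiates at \<open>g\<close> along the left translate of that curve by \<open>g\<close>. Vector fields are represented by
  their action on functions, which is meaningful on \<open>C\<^sup>1\<close> functions.
\<close>

definition left_inv_field :: "('g::group_add, 'e::real_inner) chart \<Rightarrow> 'e \<Rightarrow> ('g \<Rightarrow> complex) \<Rightarrow> 'g \<Rightarrow> complex" where
  "left_inv_field c v f g = (case c of (U, \<phi>) \<Rightarrow>
     vector_derivative (\<lambda>t. f (g + inv_into U \<phi> (\<phi> 0 + t *\<^sub>R v))) (at 0))"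

text \<open>The basis \<open>X\<^sub>1, \<dots>, X\<^sub>d\<close> is indexed from \<open>0\<close>, that is by \<open>j < d\<close>.\<close>

definition left_inv_basis ::
  "('g::group_add, 'e::real_inner) chart set \<Rightarrow> nat \<Rightarrow> (nat \<Rightarrow> ('g \<Rightarrow> complex) \<Rightarrow> 'g \<Rightarrow> complex) \<Rightarrow> bool" where
  "left_inv_basis A d X \<longleftrightarrow> (\<exists>(U, \<phi>)\<in>A. 0 \<in> U \<and>
     (\<exists>b. inj_on b {..<d} \<and> independent (b ` {..<d}) \<and> span (b ` {..<d}) = UNIV \<and>
          (\<forall>j<d. X j = left_inv_field (U, \<phi>) (b j))))"

definition multi_indices :: "nat \<Rightarrow> nat \<Rightarrow> (nat \<Rightarrow> nat) set" where
  "multi_indices d m = {\<alpha>. (\<forall>j\<ge>d. \<alpha> j = 0) \<and> (\<Sum>j<d. \<alpha> j) \<le> m}"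

definition field_power ::
  "nat \<Rightarrow> (nat \<Rightarrow> ('g \<Rightarrow> complex) \<Rightarrow> 'g \<Rightarrow> complex) \<Rightarrow> (nat \<Rightarrow> nat) \<Rightarrow> ('g \<Rightarrow> complex) \<Rightarrow> 'g \<Rightarrow> complex" where
  "field_power d X \<alpha> = foldr (\<lambda>j F. (X j ^^ \<alpha> j) \<circ> F) [0..<d] id"

definition Cnorm ::
  "nat \<Rightarrow> (nat \<Rightarrow> ('g \<Rightarrow> complex) \<Rightarrow> 'g \<Rightarrow> complex) \<Rightarrow> nat \<Rightarrow> ('g \<Rightarrow> complex) \<Rightarrow> ennreal" where
  "Cnorm d X m f = (SUP \<alpha>\<in>multi_indices d m. SUP x. ennreal (norm (field_power d X \<alpha> f x)))"

definition Cb2 ::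
  "('g, 'e::real_inner) chart set \<Rightarrow> nat \<Rightarrow> (nat \<Rightarrow> ('g \<Rightarrow> complex) \<Rightarrow> 'g \<Rightarrow> complex) \<Rightarrow> ('g \<Rightarrow> complex) set" where
  "Cb2 A d X = {f \<in> Ck A 2. Cnorm d X 2 f < \<infinity>}"


section \<open>Dissipative distributions\<close>

definition linear_functional_on :: "('g \<Rightarrow> complex) set \<Rightarrow> (('g \<Rightarrow> complex) \<Rightarrow> complex) \<Rightarrow> bool" where
  "linear_functional_on F P \<longleftrightarrow>
     (\<forall>f\<in>F. \<forall>g\<in>F. \<forall>a b. P (\<lambda>x. a * f x + b * g x) = a * P f + b * P g)"

text \<open>
  The seminorms \<^term>\<open>Cnorm d X m\<close> generate the usual topology on the smooth functions supported in
  a fixed compact set, because the fields \<open>X\<^sub>j\<close> form a smooth global frame.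
\<close>

definition distribution ::
  "('g::topological_space, 'e::real_inner) chart set \<Rightarrow> nat \<Rightarrow> (nat \<Rightarrow> ('g \<Rightarrow> complex) \<Rightarrow> 'g \<Rightarrow> complex) \<Rightarrow>
     (('g \<Rightarrow> complex) \<Rightarrow> complex) \<Rightarrow> bool" where
  "distribution A d X P \<longleftrightarrow> linear_functional_on (Cc_smooth A) P \<and>
     (\<forall>K. compact K \<longrightarrow> (\<exists>m C. \<forall>f\<in>Cc_smooth A. fsupport f \<subseteq> K \<longrightarrow>
        ennreal (norm (P f)) \<le> ennreal C * Cnorm d X m f))"

definition dissipative_distribution ::
  "('g::{group_add, topological_space}, 'e::real_inner) chart set \<Rightarrow> nat \<Rightarrow>
     (nat \<Rightarrow> ('g \<Rightarrow> complex) \<Rightarrow> 'g \<Rightarrow> complex) \<Rightarrow> (('g \<Rightarrow> complex) \<Rightarrow> complex) \<Rightarrow> bool" where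
  "dissipative_distribution A d X P \<longleftrightarrow> distribution A d X P \<and>
     (\<forall>f\<in>Cc_smooth A. (\<forall>x. f x \<in> \<real>) \<and> (\<forall>x. Re (f x) \<le> Re (f 0)) \<longrightarrow> P f \<in> \<real> \<and> Re (P f) \<le> 0)"

text \<open>
  The measure \<open>P(dx)\<close> lives on the complement of the identity; it is extended by \<open>0\<close> to a measure on
  the whole group. Since the group is second countable, finiteness outside the neighbourhoods of \<open>0\<close>
  already makes it a Radon measure on the complement.
\<close>

definition represents_off_identity ::
  "('g::{group_add, topological_space}, 'e::real_inner) chart set \<Rightarrow> (('g \<Rightarrow> complex) \<Rightarrow> complex) \<Rightarrow> 'g measure \<Rightarrow> bool" where
  "represents_off_identity A P \<nu> \<longleftrightarrow>
     sets \<nu> = sets borel \<and> emeasure \<nu> {0} = 0 \<and>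
     (\<forall>U. open U \<and> 0 \<in> U \<longrightarrow> emeasure \<nu> (- U) < \<infinity>) \<and>
     (\<forall>f\<in>Cc_smooth A. 0 \<notin> fsupport f \<longrightarrow> P f = (\<integral>x. f x \<partial>\<nu>))"

text \<open>
  A single symbol \<open>P\<close> denotes both the distribution (the values on \<^term>\<open>Cc_smooth A\<close>) and its extension
  to \<^term>\<open>Cb2 A d X\<close>. The next predicate says that the values of \<open>P\<close> on the larger space are those of
  the extension. They are determined by the distribution: every \<open>f\<close> in \<^term>\<open>Cb2 A d X\<close> agrees to second
  order at \<open>0\<close> with some \<open>g\<close> in \<^term>\<open>Cc_smooth A\<close>, so that \<open>P f = P g + \<integral> (f - g) d\<nu>\<close>.
\<close>

definition extended_to_Cb2 ::
  "('g::{group_add, topological_space}, 'e::real_inner) chart set \<Rightarrow> nat \<Rightarrow>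
     (nat \<Rightarrow> ('g \<Rightarrow> complex) \<Rightarrow> 'g \<Rightarrow> complex) \<Rightarrow> (('g \<Rightarrow> complex) \<Rightarrow> complex) \<Rightarrow> bool" where
  "extended_to_Cb2 A d X P \<longleftrightarrow>
     linear_functional_on (Cb2 A d X) P \<and>
     (\<exists>C. \<forall>f\<in>Cb2 A d X. ennreal (norm (P f)) \<le> ennreal C * Cnorm d X 2 f) \<and>
     (\<exists>\<nu>. represents_off_identity A P \<nu> \<and>
        (\<forall>f\<in>Cb2 A d X. f 0 = 0 \<and> (\<forall>j<d. X j f 0 = 0) \<and> (\<forall>j<d. \<forall>k<d. X j (X k f) 0 = 0) \<longrightarrow>
           integrable \<nu> f \<and> P f = (\<integral>x. f x \<partial>\<nu>)))"

definition functional_norm ::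
  "('g, 'e::real_inner) chart set \<Rightarrow> nat \<Rightarrow> (nat \<Rightarrow> ('g \<Rightarrow> complex) \<Rightarrow> 'g \<Rightarrow> complex) \<Rightarrow>
     (('g \<Rightarrow> complex) \<Rightarrow> complex) \<Rightarrow> ennreal" where
  "functional_norm A d X P = (SUP f\<in>{f \<in> Cb2 A d X. Cnorm d X 2 f \<le> 1}. ennreal (norm (P f)))"


section \<open>Convolution semigroups\<close>

text \<open>The library's convolution of measures is restricted to \<^class>\<open>ordered_euclidean_space\<close>.\<close>

definition group_convolution :: "'g::{group_add, topological_space} measure \<Rightarrow> 'g measure \<Rightarrow> 'g measure" where
  "group_convolution M N = distr (M \<Otimes>\<^sub>M N) borel (\<lambda>(x, y). x + y)"

definition convolution_semigroup :: "(real \<Rightarrow> 'g::{group_add, topological_space} measure) \<Rightarrow> bool" where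
  "convolution_semigroup \<mu> \<longleftrightarrow>
     (\<forall>t>0. sets (\<mu> t) = sets borel \<and> subprob_space (\<mu> t)) \<and>
     (\<forall>s>0. \<forall>t>0. group_convolution (\<mu> s) (\<mu> t) = \<mu> (s + t)) \<and>
     (\<forall>f::'g \<Rightarrow> complex. f \<in> bcontfun \<longrightarrow> ((\<lambda>t. \<integral>x. f x \<partial>\<mu> t) \<longlongrightarrow> f 0) (at_right 0))"

definition generating_functional ::
  "('g::{group_add, topological_space}, 'e::real_inner) chart set \<Rightarrow> (('g \<Rightarrow> complex) \<Rightarrow> complex) \<Rightarrow>
     (real \<Rightarrow> 'g measure) \<Rightarrow> bool" where
  "generating_functional A P \<mu> \<longleftrightarrow> (\<forall>f\<in>Cc_smooth A.
     ((\<lambda>t. ((\<integral>x. f x \<partial>\<mu> t) - f 0) / of_real t) \<longlongrightarrow> P f) (at_right 0))"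

end

theory Submission
  imports Defs
begin

text \<open>
  Only difference quotients \<open>\<langle>D\<^sub>n(t), f\<rangle> = (\<langle>\<mu>\<^sub>n(t), f\<rangle> - f(e)) / t\<close> are used. By Taylor's formula at \<open>e\<close>,
  \<open>|\<langle>D\<^sub>n(t), f\<rangle>| \<le> C \<parallel>f\<parallel> N\<^sub>n(t)\<close> with the \<open>C\<^sup>2\<close> norm of \<open>f\<close>, where \<open>N\<^sub>n(t)\<close> is the sum of the moduli of \<open>D\<^sub>n(t)\<close> on
  finitely many test functions: the constant \<open>1\<close>, local coordinates, and one bump function. By the semigroup
  law \<open>D\<^sub>n(mt)\<close> is the mean over \<open>k < m\<close> of the averages of left translates of \<open>D\<^sub>n(t)\<close> with respect to
  \<open>\<mu>\<^sub>n(kt)\<close>. The measures \<open>\<mu>\<^sub>n(s)\<close> concentrate at \<open>e\<close> as \<open>s \<rightarrow> 0\<close>, uniformly in \<open>n\<close>, so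
  \<open>|\<langle>D\<^sub>n(mt), f\<rangle> - \<langle>D\<^sub>n(t), f\<rangle>| \<le> \<epsilon> N\<^sub>n(t)\<close> whenever \<open>mt\<close> is small and translation is continuous in the
  \<open>C\<^sup>2\<close> norm at \<open>f\<close>. Applied to the test functions this bounds \<open>N\<^sub>n(t)\<close> uniformly, and letting \<open>t \<rightarrow> 0\<close> it gives
  \<open>\<langle>D\<^sub>n(s), f\<rangle> \<rightarrow> \<langle>P\<^sub>n, f\<rangle>\<close> uniformly in \<open>n\<close>, so that the limits in \<open>s\<close> and \<open>n\<close> may be exchanged. An estimate for
  large jumps shows that \<open>\<mu>\<^sub>n(t)/t\<close> is uniformly small off large compact sets; it reduces \<open>f\<close> in \<open>C\<^sub>b\<^sup>2\<close> to the
  case of compact support. Finally \<open>\<parallel>P\<^sub>n\<parallel>\<close> is at most \<open>C\<close> times the limit of \<open>N\<^sub>n(t)\<close> as \<open>t \<rightarrow> 0\<close>, the sum of the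
  moduli of \<open>P\<^sub>n\<close> on the test functions.
\<close>

section \<open>Calculus of \<open>C\<^sup>k\<close> maps\<close>

text \<open>The obstacle is that nothing is known beforehand about the size of the
  \<open>P n\<close>: the convergence of the measures concerns each fixed time, and the trivial
  bound for a quotient is of order 1/t. The way out is that the error in comparing the times t and
  mt is measured by N_n(t) itself, uniformly in m. For the test functions this gives N_n(t) \<le> 2
  N_n(mt), and m can be so large that mt has order one. Left translates fit because left-invariant
  fields commute with them, so translation preserves C^2 bounds. On all of C_b^2, however,
  translation need not be continuous in the C^2 norm, as derivatives of f need not be left uniformly
  continuous; hence the separate estimate for large jumps. Moreover, \<open>P n\<close> is given as
  a limit of quotients only on smooth functions of compact support. A function in C_b^2 is therefore
  split into such a function with the same second-order jet at the identity and a flat remainder,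
  whose quotients converge to its integral against the jump measure. In the norm statement the
  constant 1 is reached through cutoffs, since it may lack compact support.\<close>

lemma Ck_on_subset: "Ck_on k S f \<Longrightarrow> T \<subseteq> S \<Longrightarrow> Ck_on k T f"
proof (induction k arbitrary: f)
  case 0 then show ?case by (auto intro: continuous_on_subset)
next
  case (Suc k) then show ?case by (auto simp: subset_iff)
qed

text \<open>\<open>Ck_on\<close> refers to the derivative picked by
  \<open>frechet_derivative\<close>. Derivatives are unique and depend only on the germ, so on an
  open set any pointwise derivative may be supplied instead; the inner fact \<open>cong\<close>
  carries this through all lower orders.\<close>

lemma Ck_on_SucI:
  assumes "\<And>x. x \<in> S \<Longrightarrow> (f has_derivative f' x) (at x)" "\<And>v. Ck_on k S (\<lambda>x. f' x v)"
    and "open S"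
  shows "Ck_on (Suc k) S f"
proof -
  have cong: "Ck_on k S g \<Longrightarrow> (\<And>x. x \<in> S \<Longrightarrow> g x = h x) \<Longrightarrow> Ck_on k S h"
    for k and g h :: "'a \<Rightarrow> 'b"
  proof (induction k arbitrary: g h)
    case 0 then show ?case by (auto cong: continuous_on_cong_simp)
  next
    case (Suc k)
    have "frechet_derivative g (at x) = frechet_derivative h (at x)" if "x \<in> S" for x
      using frechet_derivative_transform_within_open[where f=g and g=h and X=S and x=x] Suc.prems that \<open>open S\<close> by auto
    moreover have "h differentiable (at x)" if "x \<in> S" for x
    proof -
      have "(g has_derivative frechet_derivative g (at x)) (at x)"
        using Suc.prems that by (auto simp: frechet_derivative_works)
      then have "(h has_derivative frechet_derivative g (at x)) (at x)"
        using has_derivative_transform_within_open[OF _ \<open>open S\<close> that] Suc.prems(2) by blast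
      then show ?thesis by (auto simp: differentiable_def)
    qed
    moreover have "Ck_on k S (\<lambda>x. frechet_derivative h (at x) v)" for v
      by (rule Suc.IH[where g="\<lambda>x. frechet_derivative g (at x) v"]) (use Suc.prems(1) calculation(1) in auto)
    ultimately show ?case by auto
  qed
  have "f' x = frechet_derivative f (at x)" if "x \<in> S" for x
    using assms(1) that frechet_derivative_at by blast
  moreover have "f differentiable (at x)" if "x \<in> S" for x
    using assms(1) that differentiable_def by blast
  ultimately show ?thesis
    using assms(2) cong by fastforce
qed

lemma Ck_on_cong:
  assumes "Ck_on k S f" "open S" "\<And>x. x \<in> S \<Longrightarrow> f x = g x"
  shows "Ck_on k S g"
  using assms(1,3)
proof (cases k)
  case 0 then show ?thesis using assms by (auto cong: continuous_on_cong_simp)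
next
  case (Suc j)
  have "(g has_derivative frechet_derivative f (at x)) (at x)" if "x \<in> S" for x
    using assms Suc that has_derivative_transform_within_open[OF _ \<open>open S\<close> that, where f=f and g=g]
    by (auto simp: frechet_derivative_works)
  then show ?thesis unfolding Suc using assms Suc by (intro Ck_on_SucI) auto
qed

lemma Ck_on_Suc_has_derivative:
  "Ck_on (Suc k) S f \<Longrightarrow> x \<in> S \<Longrightarrow> (f has_derivative frechet_derivative f (at x)) (at x)"
  by (auto simp: frechet_derivative_works)

lemma Ck_on_Suc_imp: "Ck_on (Suc k) S f \<Longrightarrow> Ck_on k S f"
proof (induction k arbitrary: f)
  case 0 then show ?case
    by (auto intro!: continuous_at_imp_continuous_on differentiable_imp_continuous_within)
next
  case (Suc k) then show ?case by simp
qed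

lemma Ck_on_le: "Ck_on k S f \<Longrightarrow> j \<le> k \<Longrightarrow> Ck_on j S f"
  by (induction k rule: nat.induct) (auto simp: le_Suc_eq dest: Ck_on_Suc_imp simp del: Ck_on.simps)

lemma Ck_on_imp_continuous_on: "Ck_on k S f \<Longrightarrow> continuous_on S f"
  using Ck_on_le[of k S f 0] by simp

lemma Ck_on_local:
  assumes "\<And>x. x \<in> S \<Longrightarrow> \<exists>T. open T \<and> x \<in> T \<and> Ck_on k T f"
  shows "Ck_on k S f"
  using assms
proof (induction k arbitrary: f)
  case 0
  then have "isCont f x" if "x \<in> S" for x
    using that by (metis Ck_on.simps(1) continuous_on_eq_continuous_at)
  then show ?case by (simp add: continuous_at_imp_continuous_on)
next
  case (Suc k)
  have "f differentiable (at x)" if "x \<in> S" for x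
    using Suc.prems[OF that] by auto
  moreover have "Ck_on k S (\<lambda>x. frechet_derivative f (at x) v)" for v
    by (rule Suc.IH) (use Suc.prems in fastforce)
  ultimately show ?case by simp
qed

lemma Ck_on_const: "Ck_on k S (\<lambda>x. c)"
  by (induction k arbitrary: c) auto

lemma Ck_on_add:
  assumes "open S" "Ck_on k S f" "Ck_on k S g"
  shows "Ck_on k S (\<lambda>x. f x + g x)"
  using assms(2,3)
proof (induction k arbitrary: f g)
  case 0 then show ?case by (auto intro: continuous_intros)
next
  case (Suc k)
  show ?case
    by (rule Ck_on_SucI[OF _ _ \<open>open S\<close>], rule has_derivative_add)
       (use Suc in \<open>auto simp: frechet_derivative_works\<close>)
qed

lemma Ck_on_sum:
  assumes "open S" "\<And>i. i \<in> I \<Longrightarrow> Ck_on k S (f i)"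
  shows "Ck_on k S (\<lambda>x. \<Sum>i\<in>I. f i x)"
  using assms(2)
  by (induction I rule: infinite_finite_induct) (auto intro: Ck_on_const Ck_on_add[OF assms(1)])

lemma Ck_on_linear:
  assumes "bounded_linear L" "open S" "Ck_on k S f"
  shows "Ck_on k S (\<lambda>x. L (f x))"
  using assms(3)
proof (induction k arbitrary: f)
  case 0 then show ?case
    using linear_continuous_on[OF assms(1), of UNIV]
    by (auto intro: continuous_on_compose2)
next
  case (Suc k)
  show ?case
    by (rule Ck_on_SucI[OF _ _ \<open>open S\<close>], rule bounded_linear.has_derivative[OF assms(1)])
       (use Suc in \<open>auto simp: frechet_derivative_works\<close>)
qed

lemma Ck_on_bilinear:
  assumes "bounded_bilinear B" "open S" "Ck_on k S f" "Ck_on k S g"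
  shows "Ck_on k S (\<lambda>x. B (f x) (g x))"
  using assms(3,4)
proof (induction k arbitrary: f g)
  case 0 then show ?case using bounded_bilinear.continuous_on[OF assms(1)] by auto
next
  case (Suc k)
  note imp = Suc.prems[THEN Ck_on_Suc_imp]
  show ?case
    by (rule Ck_on_SucI[OF _ _ \<open>open S\<close>], rule bounded_bilinear.FDERIV[OF assms(1)])
       (use Suc imp in \<open>auto simp: frechet_derivative_works intro!: Ck_on_add[OF \<open>open S\<close>]\<close>)
qed

lemma Ck_on_ident: "Ck_on k S (\<lambda>x. x)"
  by (cases k) (auto intro: Ck_on_const)

text \<open>A finite basis with its dual functionals. It stands in for the class \<^class>\<open>euclidean_space\<close>, which
  would exclude dimension \<open>0\<close>.\<close>

definition finite_frame :: "'i set \<Rightarrow> ('i \<Rightarrow> 'a::real_normed_vector \<Rightarrow> real) \<Rightarrow> ('i \<Rightarrow> 'a) \<Rightarrow> bool" where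
  "finite_frame I l e \<longleftrightarrow> finite I \<and> (\<forall>i\<in>I. bounded_linear (l i)) \<and> (\<forall>w. (\<Sum>i\<in>I. l i w *\<^sub>R e i) = w)"

text \<open>The chain rule produces the derivative of \<open>g\<close> in the direction
  \<open>?Df x v\<close>, which moves with \<open>x\<close>, whereas \<open>Ck_on\<close> speaks of
  fixed directions only. Expanding that direction in the frame leaves scalar coefficients times
  derivatives of \<open>g\<close> along the fixed vectors \<open>e i\<close>, and the induction
  applies to these.\<close>

lemma Ck_on_compose:
  fixes f :: "'a::real_normed_vector \<Rightarrow> 'b::real_normed_vector"
    and g :: "'b \<Rightarrow> 'c::real_normed_vector" and l :: "'i \<Rightarrow> 'b \<Rightarrow> real"
  assumes fr: "finite_frame I l e" and "open S" "open T" "f ` S \<subseteq> T" "Ck_on k S f" "Ck_on k T g"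
  shows "Ck_on k S (\<lambda>x. g (f x))"
  using assms(5,6)
proof (induction k arbitrary: g)
  case 0 then show ?case using \<open>f ` S \<subseteq> T\<close> by (auto intro: continuous_on_compose2)
next
  case (Suc k)
  let ?Df = "\<lambda>x. frechet_derivative f (at x)" and ?Dg = "\<lambda>x. frechet_derivative g (at x)"
  have "((\<lambda>x. g (f x)) has_derivative (\<lambda>v. \<Sum>i\<in>I. l i (?Df x v) *\<^sub>R ?Dg (f x) (e i))) (at x)" if "x \<in> S" for x
  proof -
    have g: "(g has_derivative ?Dg (f x)) (at (f x))"
      using Suc.prems that \<open>f ` S \<subseteq> T\<close> by (auto simp: frechet_derivative_works)
    have "((\<lambda>x. g (f x)) has_derivative (\<lambda>v. ?Dg (f x) (?Df x v))) (at x)"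
      using has_derivative_compose[OF Ck_on_Suc_has_derivative[OF Suc.prems(1) that] g] .
    have lin: "?Dg (f x) w = (\<Sum>i\<in>I. l i w *\<^sub>R ?Dg (f x) (e i))" for w
    proof -
      have "linear (?Dg (f x))" using g has_derivative_linear by blast
      then have "?Dg (f x) (\<Sum>i\<in>I. l i w *\<^sub>R e i) = (\<Sum>i\<in>I. l i w *\<^sub>R ?Dg (f x) (e i))"
        by (simp add: linear_sum linear_scale)
      then show ?thesis using fr by (simp add: finite_frame_def)
    qed
    have "(\<lambda>v. ?Dg (f x) (?Df x v)) = (\<lambda>v. \<Sum>i\<in>I. l i (?Df x v) *\<^sub>R ?Dg (f x) (e i))"
      by (rule ext) (rule lin)
    with \<open>((\<lambda>x. g (f x)) has_derivative (\<lambda>v. ?Dg (f x) (?Df x v))) (at x)\<close> show ?thesis by simp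
  qed
  moreover have "Ck_on k S (\<lambda>x. \<Sum>i\<in>I. l i (?Df x v) *\<^sub>R ?Dg (f x) (e i))" for v
  proof (rule Ck_on_sum[OF \<open>open S\<close>], rule Ck_on_bilinear[OF bounded_bilinear_scaleR \<open>open S\<close>])
    fix i assume "i \<in> I"
    then have "bounded_linear (l i)" using fr by (auto simp: finite_frame_def)
    then show "Ck_on k S (\<lambda>x. l i (?Df x v))"
      by (rule Ck_on_linear[OF _ \<open>open S\<close>]) (use Suc.prems in auto)
    show "Ck_on k S (\<lambda>x. ?Dg (f x) (e i))"
      using Suc.IH[where g="\<lambda>y. ?Dg y (e i)"] Ck_on_Suc_imp[OF Suc.prems(1)] Suc.prems(2) by simp
  qed
  ultimately show ?case by (intro Ck_on_SucI \<open>open S\<close>)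
qed

lemma finite_frame_real: "finite_frame {()} (\<lambda>_ x. x) (\<lambda>_. 1::real)"
  by (auto simp: finite_frame_def)

text \<open>Group multiplication in charts is a map on a product of two model spaces, so composing
  with it needs a frame there.\<close>

lemma finite_frame_prod:
  fixes l :: "'i \<Rightarrow> 'a::real_normed_vector \<Rightarrow> real" and l' :: "'j \<Rightarrow> 'b::real_normed_vector \<Rightarrow> real"
  assumes "finite_frame I l e" "finite_frame J l' e'"
  shows "finite_frame (I <+> J) (case_sum (\<lambda>i p. l i (fst p)) (\<lambda>j p. l' j (snd p)))
           (case_sum (\<lambda>i. (e i, 0)) (\<lambda>j. (0, e' j)))"
proof -
  have bl: "bounded_linear (\<lambda>p::'a\<times>'b. f (fst p))" if "bounded_linear f" for f :: "'a \<Rightarrow> real"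
    using bounded_linear_compose[OF that bounded_linear_fst] .
  have bl': "bounded_linear (\<lambda>p::'a\<times>'b. f (snd p))" if "bounded_linear f" for f :: "'b \<Rightarrow> real"
    using bounded_linear_compose[OF that bounded_linear_snd] .
  have "(\<Sum>i\<in>I <+> J. case_sum (\<lambda>i p. l i (fst p)) (\<lambda>j p. l' j (snd p)) i w *\<^sub>R
           case_sum (\<lambda>i. (e i, 0)) (\<lambda>j. (0, e' j)) i) = w" for w
    using assms
    by (subst sum.Plus) (auto simp: finite_frame_def prod_eq_iff fst_sum snd_sum o_def)
  then show ?thesis
    using assms bl bl' by (auto simp: finite_frame_def)
qed

text \<open>With \<open>y = 1 / (1 - u)\<close> these are the functions \<open>y\<^sup>k exp (1 - y)\<close>, which are closed under differentiation
  up to linear combinations.\<close>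

definition bump_power :: "nat \<Rightarrow> real \<Rightarrow> real" where
  "bump_power k u = (if u < 1 then (1 / (1 - u)) ^ k * exp (1 - 1 / (1 - u)) else 0)"

lemma bump_power_has_derivative:
  "(bump_power k has_real_derivative (real k * bump_power (Suc k) u - bump_power (Suc (Suc k)) u)) (at u)"
proof -
  consider "u < 1" | "u > 1" | "u = 1" by linarith
  then show ?thesis
  proof cases
    case 1
    have "((\<lambda>u. (1 / (1 - u)) ^ k * exp (1 - 1 / (1 - u))) has_real_derivative
       (real k * bump_power (Suc k) u - bump_power (Suc (Suc k)) u)) (at u)"
    proof -
      have y: "((\<lambda>u. 1 / (1 - u)) has_real_derivative (1 / (1 - u))\<^sup>2) (at u)"
        using 1 by (auto intro!: derivative_eq_intros simp: power2_eq_square)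
      have k: "real k * y ^ (k - Suc 0) * y\<^sup>2 = real k * y ^ Suc k" for y :: real
        by (cases k) (auto simp: power2_eq_square)
      have "((\<lambda>u. (1 / (1 - u)) ^ k * exp (1 - 1 / (1 - u))) has_real_derivative
          (1 / (1 - u)) ^ k * (exp (1 - 1 / (1 - u)) * (0 - (1 / (1 - u))\<^sup>2)) +
          (real k * (1 / (1 - u)) ^ (k - Suc 0) * (1 / (1 - u))\<^sup>2) * exp (1 - 1 / (1 - u))) (at u)"
        by (rule derivative_eq_intros y refl | simp add: mult_ac)+
      then show ?thesis using 1 unfolding k
        by (simp add: bump_power_def power2_eq_square mult_ac)
    qed
    then show ?thesis
      by (rule has_field_derivative_transform_within_open[where S="{..<1}"])
         (use 1 in \<open>auto simp: bump_power_def\<close>)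
  next
    case 2
    have "((\<lambda>u. 0) has_real_derivative (real k * bump_power (Suc k) u - bump_power (Suc (Suc k)) u)) (at u)"
      using 2 by (auto simp: bump_power_def)
    then show ?thesis
      by (rule has_field_derivative_transform_within_open[where S="{1<..}"])
         (use 2 in \<open>auto simp: bump_power_def\<close>)
  next
    case 3
    \<comment> \<open>The function vanishes at 1, so this is its difference quotient. From the left,
      with y = 1 / (1 - u) tending to infinity, it equals - y^(k+1) exp(1 - y); from the right it is
      0.\<close>
    have lim: "((\<lambda>u. bump_power k u / (u - 1)) \<longlongrightarrow> 0) (at (1::real))"
    proof (rule filterlim_split_at)
      have "((\<lambda>y::real. - (y ^ Suc k * exp (1 - y))) \<longlongrightarrow> 0) at_top"
      proof -
        have "((\<lambda>y::real. - exp 1 * (y ^ Suc k / exp y)) \<longlongrightarrow> - exp 1 * 0) at_top"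
          by (intro tendsto_intros tendsto_power_div_exp_0)
        then show ?thesis by (simp add: exp_diff algebra_simps)
      qed
      moreover have "filterlim (\<lambda>u::real. 1 / (1 - u)) at_top (at_left 1)"
      proof -
        have "((\<lambda>u::real. 1 - u) \<longlongrightarrow> 1 - 1) (at_left 1)" by (intro tendsto_intros)
        then have "filterlim (\<lambda>u::real. inverse (1 - u)) at_top (at_left 1)"
          by (intro filterlim_inverse_at_top) (auto simp: eventually_at_filter)
        then show ?thesis by (simp add: inverse_eq_divide)
      qed
      ultimately have "((\<lambda>u::real. - ((1 / (1 - u)) ^ Suc k * exp (1 - 1 / (1 - u)))) \<longlongrightarrow> 0) (at_left 1)"
        by (rule filterlim_compose)
      then show "((\<lambda>u. bump_power k u / (u - 1)) \<longlongrightarrow> 0) (at_left 1)"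
        by (rule Lim_transform_eventually)
           (auto simp: eventually_at_filter bump_power_def divide_simps algebra_simps intro!: always_eventually)
      show "((\<lambda>u. bump_power k u / (u - 1)) \<longlongrightarrow> 0) (at_right 1)"
        by (rule tendsto_eventually) (auto simp: eventually_at_filter bump_power_def)
    qed
    then show ?thesis
      unfolding 3 has_field_derivative_iff by (simp add: bump_power_def)
  qed
qed

lemma Ck_on_bump_power: "Ck_on m UNIV (bump_power k)"
proof (induction m arbitrary: k)
  case 0 show ?case
    using bump_power_has_derivative DERIV_isCont by (fastforce intro!: continuous_at_imp_continuous_on)
next
  case (Suc m)
  have "Ck_on m UNIV (\<lambda>u. (real k * bump_power (Suc k) u - bump_power (Suc (Suc k)) u) * v)" for v
  proof -
    have "Ck_on m UNIV (\<lambda>u. real k * bump_power (Suc k) u + (-1) * bump_power (Suc (Suc k)) u)"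
      by (intro Ck_on_add Suc Ck_on_linear[OF bounded_linear_mult_right]) auto
    then have "Ck_on m UNIV (\<lambda>u. v * (real k * bump_power (Suc k) u + (-1) * bump_power (Suc (Suc k)) u))"
      by (intro Ck_on_linear[OF bounded_linear_mult_right]) auto
    then show ?thesis by (simp add: mult.commute)
  qed
  then show ?case
    using bump_power_has_derivative
    by (intro Ck_on_SucI[where f'="\<lambda>u v. (real k * bump_power (Suc k) u - bump_power (Suc (Suc k)) u) * v"])
       (auto simp: has_field_derivative_def)
qed

abbreviation bump :: "real \<Rightarrow> real" where "bump \<equiv> bump_power 0"

lemma bump_props:
  "bump 0 = 1" "0 \<le> bump u" "u \<ge> 1 \<Longrightarrow> bump u = 0" "u < 1 \<Longrightarrow> bump u > 0"
  "0 \<le> u \<Longrightarrow> bump u \<le> 1"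
  by (auto simp: bump_power_def divide_simps)

text \<open>It bounds 1 - \<open>bump\<close> u below by u / 2, which later makes the test function
  \<open>\<psi>\<close> comparable to the squared distance. On [0, 1] the inequality exp(-u) \<le> 1
  - u / 2 follows from (1 - u / 2)(1 + u) \<ge> 1.\<close>

lemma bump_le:
  assumes "0 \<le> u" "u \<le> 1"
  shows "bump u \<le> 1 - u / 2"
proof (cases "u < 1")
  case True
  have "u \<le> 1 / (1 - u) - 1" using assms True by (simp add: field_simps)
  then have "exp (1 - 1 / (1 - u)) \<le> exp (- u)" by simp
  moreover have "exp (- u) \<le> 1 - u / 2"
  proof -
    have "u * u \<le> u * 1" using assms by (intro mult_left_mono) auto
    then have "1 \<le> (1 - u / 2) * (1 + u)" by (simp add: field_simps)
    also have "\<dots> \<le> (1 - u / 2) * exp u"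
      using assms by (intro mult_left_mono) auto
    finally show ?thesis by (simp add: exp_minus field_simps)
  qed
  ultimately have "exp (1 - 1 / (1 - u)) \<le> 1 - u / 2" by linarith
  moreover have "bump u = exp (1 - 1 / (1 - u))"
    using True by (simp only: bump_power_def if_True power_0 mult_1)
  ultimately show ?thesis by simp
qed (use assms in \<open>auto simp: bump_power_def\<close>)

section \<open>Symmetry of second derivatives and Taylor's formula\<close>

abbreviation dird :: "'a::real_normed_vector \<Rightarrow> ('a \<Rightarrow> 'b::real_normed_vector) \<Rightarrow> 'a \<Rightarrow> 'b" where
  "dird v f x \<equiv> frechet_derivative f (at x) v"

lemma line_has_vector_derivative:
  assumes "f differentiable (at (a + s *\<^sub>R v))"
  shows "((\<lambda>s. f (a + s *\<^sub>R v)) has_vector_derivative dird v f (a + s *\<^sub>R v)) (at s)"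
proof -
  have "((\<lambda>s. a + s *\<^sub>R v) has_derivative (\<lambda>h. h *\<^sub>R v)) (at s)"
    by (auto intro!: derivative_eq_intros)
  moreover have f: "(f has_derivative frechet_derivative f (at (a + s *\<^sub>R v))) (at (a + s *\<^sub>R v))"
    using assms by (simp add: frechet_derivative_works)
  ultimately have "((\<lambda>s. f (a + s *\<^sub>R v)) has_derivative (\<lambda>h. dird (h *\<^sub>R v) f (a + s *\<^sub>R v))) (at s)"
    by (rule has_derivative_compose)
  then show ?thesis
    using linear_scale[OF has_derivative_linear[OF f]] by (simp add: has_vector_derivative_def)
qed

lemma dird_inner:
  assumes "f differentiable (at x)"
  shows "dird v (\<lambda>x. f x \<bullet> c) x = dird v f x \<bullet> c"
proof -
  have "(f has_derivative frechet_derivative f (at x)) (at x)"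
    using assms by (simp add: frechet_derivative_works)
  then have "((\<lambda>x. f x \<bullet> c) has_derivative (\<lambda>v. dird v f x \<bullet> c)) (at x)"
    by (auto intro!: derivative_eq_intros)
  then show ?thesis by (metis frechet_derivative_at)
qed

text \<open>The mean value theorem is applied first along \<open>u\<close> to the increment of
  \<open>F\<close> in the direction \<open>w\<close>, then along \<open>w\<close> to the derivative
  \<open>dird u F\<close>.\<close>

lemma second_difference_mvt:
  fixes F :: "'a::real_normed_vector \<Rightarrow> real"
  assumes F: "Ck_on 2 (ball q r) F" and h: "0 < h" "h * (norm u + norm w) < r"
  shows "\<exists>p. dist p q \<le> h * (norm u + norm w) \<and>
    F (q + h *\<^sub>R u + h *\<^sub>R w) - F (q + h *\<^sub>R u) - F (q + h *\<^sub>R w) + F q = h\<^sup>2 * dird w (dird u F) p"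
proof -
  have near: "dist (q + s *\<^sub>R u + t *\<^sub>R w) q \<le> h * (norm u + norm w)" if "0 \<le> s" "s \<le> h" "0 \<le> t" "t \<le> h" for s t
  proof -
    have "norm (s *\<^sub>R u + t *\<^sub>R w) \<le> s * norm u + t * norm w"
      using that norm_triangle_ineq[of "s *\<^sub>R u" "t *\<^sub>R w"] by simp
    also have "\<dots> \<le> h * norm u + h * norm w" using that by (intro add_mono mult_right_mono) auto
    finally show ?thesis by (simp add: dist_norm algebra_simps)
  qed
  then have in_ball: "q + s *\<^sub>R u + t *\<^sub>R w \<in> ball q r" if "0 \<le> s" "s \<le> h" "0 \<le> t" "t \<le> h" for s t
    using that h by (force simp: dist_commute)
  have F1: "F differentiable (at x)" if "x \<in> ball q r" for x
    using F that by (auto simp: numeral_2_eq_2)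
  have F2: "dird v F differentiable (at x)" if "x \<in> ball q r" for x v
    using F that by (auto simp: numeral_2_eq_2)
  have d1: "((\<lambda>s. F (q + s *\<^sub>R u + h *\<^sub>R w) - F (q + s *\<^sub>R u)) has_real_derivative
      (dird u F (q + s *\<^sub>R u + h *\<^sub>R w) - dird u F (q + s *\<^sub>R u))) (at s)" if "0 \<le> s" "s \<le> h" for s
  proof -
    have "((\<lambda>s. F (q + h *\<^sub>R w + s *\<^sub>R u)) has_real_derivative dird u F (q + h *\<^sub>R w + s *\<^sub>R u)) (at s)"
      unfolding has_real_derivative_iff_has_vector_derivative
      by (rule line_has_vector_derivative, rule F1) (use in_ball[of s h] that h in \<open>simp add: add_ac\<close>)
    moreover have "((\<lambda>s. F (q + s *\<^sub>R u)) has_real_derivative dird u F (q + s *\<^sub>R u)) (at s)"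
      unfolding has_real_derivative_iff_has_vector_derivative
      by (rule line_has_vector_derivative, rule F1) (use in_ball[of s 0] that h in simp)
    ultimately show ?thesis by (auto intro!: derivative_eq_intros simp: add_ac)
  qed
  obtain s where s: "0 < s" "s < h"
    "F (q + h *\<^sub>R u + h *\<^sub>R w) - F (q + h *\<^sub>R u) - (F (q + h *\<^sub>R w) - F q) =
      h * (dird u F (q + s *\<^sub>R u + h *\<^sub>R w) - dird u F (q + s *\<^sub>R u))"
    using MVT2[OF h(1) d1] by auto
  have d2: "((\<lambda>t. dird u F (q + s *\<^sub>R u + t *\<^sub>R w)) has_real_derivative
      dird w (dird u F) (q + s *\<^sub>R u + t *\<^sub>R w)) (at t)" if "0 \<le> t" "t \<le> h" for t
    unfolding has_real_derivative_iff_has_vector_derivative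
    by (rule line_has_vector_derivative, rule F2) (use in_ball that s in simp)
  obtain t where t: "0 < t" "t < h"
    "dird u F (q + s *\<^sub>R u + h *\<^sub>R w) - dird u F (q + s *\<^sub>R u) = h * dird w (dird u F) (q + s *\<^sub>R u + t *\<^sub>R w)"
    using MVT2[OF h(1) d2] by auto
  show ?thesis
    by (rule exI[of _ "q + s *\<^sub>R u + t *\<^sub>R w"])
       (use near[of s t] s t in \<open>simp add: power2_eq_square algebra_simps\<close>)
qed

text \<open>The second difference does not change when \<open>u\<close> and \<open>w\<close> are
  exchanged, so the two mixed derivatives agree at nearby points \<open>p n\<close> and
  \<open>p' n\<close>. Both sequences tend to \<open>q\<close>, and the second derivatives are
  continuous.\<close>

lemma second_derivative_symmetric_real:
  fixes F :: "'a::real_normed_vector \<Rightarrow> real"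
  assumes F: "Ck_on 2 S F" and "open S" "q \<in> S"
  shows "dird w (dird u F) q = dird u (dird w F) q"
proof -
  obtain r where r: "r > 0" "ball q r \<subseteq> S" using assms openE by blast
  \<comment> \<open>The summand 1 keeps the divisor positive when both directions vanish.\<close>
  define c where "c = norm u + norm w + 1"
  have c: "c > 0" "norm u + norm w < c" by (auto simp: c_def add_nonneg_pos)
  define h where "h n = r / (c * real (Suc n))" for n
  have h0: "h n > 0" for n using r c by (auto simp: h_def)
  have "h n * (norm u + norm w) < r" for n
  proof -
    have "h n * (norm u + norm w) < h n * c" using h0 c by (intro mult_strict_left_mono) auto
    also have "\<dots> = r / real (Suc n)" using c by (auto simp: h_def)
    also have "\<dots> \<le> r" using r by (simp add: divide_le_eq)
    finally show ?thesis .
  qed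
  note mvt = second_difference_mvt[OF Ck_on_subset[OF F r(2)] h0 this]
    second_difference_mvt[OF Ck_on_subset[OF F r(2)] h0 this[unfolded add.commute[of "norm u"]]]
  obtain p where p: "dist (p n) q \<le> h n * (norm u + norm w)"
    "F (q + h n *\<^sub>R u + h n *\<^sub>R w) - F (q + h n *\<^sub>R u) - F (q + h n *\<^sub>R w) + F q = (h n)\<^sup>2 * dird w (dird u F) (p n)" for n
    using mvt(1) by metis
  obtain p' where p': "dist (p' n) q \<le> h n * (norm w + norm u)"
    "F (q + h n *\<^sub>R w + h n *\<^sub>R u) - F (q + h n *\<^sub>R w) - F (q + h n *\<^sub>R u) + F q = (h n)\<^sup>2 * dird u (dird w F) (p' n)" for n
    using mvt(2) by metis
  have "h \<longlonglongrightarrow> 0"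
  proof -
    have "(\<lambda>n. (r / c) * inverse (real (Suc n))) \<longlonglongrightarrow> (r / c) * 0"
      by (intro tendsto_intros LIMSEQ_inverse_real_of_nat)
    then show ?thesis by (simp add: h_def[abs_def] divide_simps)
  qed
  then have lim0: "(\<lambda>n. h n * K) \<longlonglongrightarrow> 0" for K using tendsto_mult_left_zero by blast
  have lim: "f \<longlonglongrightarrow> q" if "\<And>n. dist (f n) q \<le> h n * K" for f K
    by (rule iffD2[OF tendsto_dist_iff], rule Lim_null_comparison[OF _ lim0[of K]]) (use that in auto)
  have cont: "isCont (dird v (dird v' F)) q" for v v'
    using F assms(2,3) by (auto simp: numeral_2_eq_2 continuous_on_eq_continuous_at)
  have "(\<lambda>n. dird w (dird u F) (p n)) \<longlonglongrightarrow> dird w (dird u F) q"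
    using isCont_tendsto_compose[OF cont lim[OF p(1)]] .
  moreover have "dird w (dird u F) (p n) = dird u (dird w F) (p' n)" for n
  proof -
    have "(h n)\<^sup>2 * dird w (dird u F) (p n) = (h n)\<^sup>2 * dird u (dird w F) (p' n)"
      unfolding p(2)[symmetric] p'(2)[symmetric] by (simp add: algebra_simps)
    then show ?thesis using h0[of n] by simp
  qed
  moreover have "(\<lambda>n. dird u (dird w F) (p' n)) \<longlonglongrightarrow> dird u (dird w F) q"
    using isCont_tendsto_compose[OF cont lim[OF p'(1)]] .
  ultimately show ?thesis using LIMSEQ_unique by simp
qed

text \<open>The mean value theorem used before is confined to real values; inner products with fixed
  vectors reduce vector values, in particular complex ones, to that case.\<close>

lemma second_derivative_symmetric:
  fixes F :: "'a::real_normed_vector \<Rightarrow> 'b::real_inner" and u w :: 'a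
  assumes F: "Ck_on 2 S F" and S: "open S" "q \<in> S"
  shows "dird w (dird u F) q = dird u (dird w F) q"
proof -
  have D: "dird v (dird v' (\<lambda>x. F x \<bullet> c)) q = dird v (dird v' F) q \<bullet> c" for v v' c
  proof -
    have F2: "dird v' F differentiable (at q)" using F S by (auto simp: numeral_2_eq_2)
    have "dird v (dird v' (\<lambda>x. F x \<bullet> c)) q = dird v (\<lambda>x. dird v' F x \<bullet> c) q"
      using frechet_derivative_transform_within_open[where f="\<lambda>x. dird v' F x \<bullet> c" and
          g="dird v' (\<lambda>x. F x \<bullet> c)" and X=S and x=q] S F F2
      by (auto simp: dird_inner numeral_2_eq_2)
    then show ?thesis using F2 by (simp add: dird_inner)
  qed
  have "(dird w (dird u F) q - dird u (dird w F) q) \<bullet> c = 0" for c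
  proof -
    have "dird w (dird u (\<lambda>x. F x \<bullet> c)) q = dird u (dird w (\<lambda>x. F x \<bullet> c)) q"
      by (rule second_derivative_symmetric_real[OF Ck_on_linear[OF bounded_linear_inner_left S(1) F] S])
    then show ?thesis by (simp add: D inner_diff_left)
  qed
  then show ?thesis using inner_eq_zero_iff[of "dird w (dird u F) q - dird u (dird w F) q"] by simp
qed

text \<open>The mean value inequality, which also holds for vector values, is used first for the
  derivative along the segment and then for the function minus its linear part. This loses the
  factor 1/2 of the sharp remainder.\<close>

lemma taylor_bound:
  assumes F: "Ck_on 2 S F" and seg: "\<And>t. 0 \<le> t \<Longrightarrow> t \<le> 1 \<Longrightarrow> p + t *\<^sub>R w \<in> S"
    and M: "\<And>t. 0 \<le> t \<Longrightarrow> t \<le> 1 \<Longrightarrow> norm (dird w (dird w F) (p + t *\<^sub>R w)) \<le> M"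
  shows "norm (F (p + w) - F p - dird w F p) \<le> M"
proof -
  have d1: "((\<lambda>s. F (p + s *\<^sub>R w)) has_vector_derivative dird w F (p + s *\<^sub>R w)) (at s)"
    if "0 \<le> s" "s \<le> 1" for s
    by (rule line_has_vector_derivative) (use F seg that in \<open>auto simp: numeral_2_eq_2\<close>)
  have d2: "((\<lambda>s. dird w F (p + s *\<^sub>R w)) has_vector_derivative dird w (dird w F) (p + s *\<^sub>R w)) (at s)"
    if "0 \<le> s" "s \<le> 1" for s
    by (rule line_has_vector_derivative) (use F seg that in \<open>auto simp: numeral_2_eq_2\<close>)
  have M0: "0 \<le> M" using M[of 0] norm_ge_zero order_trans by blast
  have 1: "norm (dird w F (p + s *\<^sub>R w) - dird w F p) \<le> M" if s: "0 < s" "s < 1" for s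
  proof -
    have "norm (dird w F (p + s *\<^sub>R w) - dird w F (p + 0 *\<^sub>R w)) \<le> M * s - M * 0"
    proof (rule differentiable_bound_general[OF s(1)])
      show "continuous_on {0..s} (\<lambda>s. dird w F (p + s *\<^sub>R w))"
        by (intro continuous_at_imp_continuous_on ballI has_vector_derivative_continuous[OF d2])
           (use s in auto)
      show "((*) M has_vector_derivative M) (at x)" for x by (auto intro!: derivative_eq_intros)
      show "((\<lambda>s. dird w F (p + s *\<^sub>R w)) has_vector_derivative dird w (dird w F) (p + x *\<^sub>R w)) (at x)"
        if "0 < x" "x < s" for x using d2[of x] that s by simp
      show "norm (dird w (dird w F) (p + x *\<^sub>R w)) \<le> M" if "0 < x" "x < s" for x
        using M[of x] that s by simp
    qed (intro continuous_intros)
    also have "\<dots> \<le> M * 1 - M * 0" using s M0 by (intro diff_mono mult_left_mono) auto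
    finally show ?thesis by simp
  qed
  let ?g = "\<lambda>s. F (p + s *\<^sub>R w) - s *\<^sub>R dird w F p"
  have d3: "(?g has_vector_derivative (dird w F (p + s *\<^sub>R w) - dird w F p)) (at s)" if "0 \<le> s" "s \<le> 1" for s
    using d1[OF that] by (auto intro!: derivative_eq_intros)
  have "norm (?g 1 - ?g 0) \<le> M * 1 - M * 0"
  proof (rule differentiable_bound_general[OF zero_less_one])
    show "continuous_on {0..1} ?g"
      by (intro continuous_at_imp_continuous_on ballI has_vector_derivative_continuous[OF d3]) auto
    show "((*) M has_vector_derivative M) (at x)" for x by (auto intro!: derivative_eq_intros)
    show "(?g has_vector_derivative (dird w F (p + x *\<^sub>R w) - dird w F p)) (at x)"
      if "0 < x" "x < 1" for x using d3[of x] that by simp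
    show "norm (dird w F (p + x *\<^sub>R w) - dird w F p) \<le> M" if "0 < x" "x < 1" for x
      using 1[OF that] .
  qed (intro continuous_intros)
  then show ?thesis by (simp add: algebra_simps)
qed

section \<open>Finite-dimensional inner product spaces\<close>

text \<open>An orthogonal spanning set makes the coefficients of a vector inner products, hence
  bounded functionals, and a linear map is a finite combination of these.\<close>

lemma bounded_linear_finite_span:
  fixes f :: "'a::real_inner \<Rightarrow> 'b::real_normed_vector" and B :: "'a set"
  assumes "finite B" "span B = UNIV" "linear f"
  shows "bounded_linear f"
proof -
  obtain C :: "'a set" where C: "finite C" "span C = UNIV" "pairwise orthogonal C"
    using basis_orthogonal[OF assms(1)] assms(2) by auto
  \<comment> \<open>\<open>C\<close> may contain 0; division by zero then makes the corresponding
    coefficient 0, so the expansion stays correct.\<close>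
  have rep: "(\<Sum>c\<in>C. ((w \<bullet> c) / (c \<bullet> c)) *\<^sub>R c) = w" for w
  proof -
    let ?v = "w - (\<Sum>c\<in>C. ((w \<bullet> c) / (c \<bullet> c)) *\<^sub>R c)"
    have "?v \<bullet> x = 0" if "x \<in> C" for x
    proof -
      have "(\<Sum>c\<in>C. ((w \<bullet> c) / (c \<bullet> c)) *\<^sub>R c) \<bullet> x = (\<Sum>c\<in>C. if c = x then w \<bullet> x else 0)"
        unfolding inner_sum_left
        by (intro sum.cong) (use C(3) that in \<open>auto simp: pairwise_def orthogonal_def\<close>)
      then show ?thesis using C(1) that by (simp add: inner_diff_left)
    qed
    then have "orthogonal ?v y" if "y \<in> span C" for y
      using orthogonal_to_span[OF that, of ?v] by (auto simp: orthogonal_def)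
    then have "?v \<bullet> ?v = 0" using C(2) by (auto simp: orthogonal_def)
    then show ?thesis by simp
  qed
  have "f = (\<lambda>w. \<Sum>c\<in>C. (w \<bullet> c / (c \<bullet> c)) *\<^sub>R f c)"
  proof
    fix w
    have "f w = f (\<Sum>c\<in>C. ((w \<bullet> c) / (c \<bullet> c)) *\<^sub>R c)" by (simp add: rep)
    also have "\<dots> = (\<Sum>c\<in>C. (w \<bullet> c / (c \<bullet> c)) *\<^sub>R f c)"
      using assms(3) by (simp add: linear_sum linear_scale)
    finally show "f w = (\<Sum>c\<in>C. (w \<bullet> c / (c \<bullet> c)) *\<^sub>R f c)" .
  qed
  moreover have "bounded_linear (\<lambda>w. \<Sum>c\<in>C. (w \<bullet> c / (c \<bullet> c)) *\<^sub>R f c)"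
    by (intro bounded_linear_sum bounded_linear_compose[OF bounded_linear_scaleR_left]
        bounded_linear_compose[OF bounded_linear_divide] bounded_linear_inner_left)
  ultimately show ?thesis by simp
qed

lemma finite_frame_of_basis:
  fixes b :: "'i \<Rightarrow> 'a::real_inner"
  assumes "finite I" "inj_on b I" "independent (b ` I)" "span (b ` I) = UNIV"
  obtains l where "finite_frame I l b" "\<And>i j. i \<in> I \<Longrightarrow> j \<in> I \<Longrightarrow> l i (b j) = (if i = j then 1 else 0)"
proof
  let ?l = "\<lambda>i w. representation (b ` I) w (b i)"
  have "bounded_linear (?l i)" for i
    by (rule bounded_linear_finite_span[OF _ assms(4)])
       (use assms in \<open>auto intro!: linearI simp: representation_add representation_scale\<close>)
  moreover have "(\<Sum>i\<in>I. ?l i w *\<^sub>R b i) = w" for w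
    using sum_representation_eq[OF assms(3), of w "b ` I"] assms by (simp add: sum.reindex)
  ultimately show "finite_frame I ?l b" using assms(1) by (auto simp: finite_frame_def)
  show "?l i (b j) = (if i = j then 1 else 0)" if "i \<in> I" "j \<in> I" for i j
    using that assms(2) by (auto simp: representation_basis[OF assms(3)] inj_on_eq_iff)
qed

text \<open>In the coordinates of the frame the ball lies in a box. The vectors with coordinates in
  the box form a finite sum of compact segments, built up by induction on the index set, and the
  ball is a closed subset of it.\<close>

lemma compact_cball_finite_frame:
  fixes e :: "'i \<Rightarrow> 'a::real_normed_vector"
  assumes fr: "finite_frame I l e"
  shows "compact (cball (x::'a) r)"
proof -
  define R where "R = (\<Sum>i\<in>I. onorm (l i) * (norm x + \<bar>r\<bar>))"
  have "compact {\<Sum>i\<in>J. t i *\<^sub>R e i | t. \<forall>i\<in>J. \<bar>t i\<bar> \<le> R}" if "finite J" for J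
    using that
  proof (induction J)
    case (insert j J)
    have "{\<Sum>i\<in>insert j J. t i *\<^sub>R e i | t. \<forall>i\<in>insert j J. \<bar>t i\<bar> \<le> R} =
       {x + y | x y. x \<in> (\<lambda>s. s *\<^sub>R e j) ` {-R..R} \<and> y \<in> {\<Sum>i\<in>J. t i *\<^sub>R e i | t. \<forall>i\<in>J. \<bar>t i\<bar> \<le> R}}"
      (is "?A = ?B")
    proof
      show "?A \<subseteq> ?B"
      proof
        fix z assume "z \<in> ?A"
        then obtain t where t: "z = (\<Sum>i\<in>insert j J. t i *\<^sub>R e i)" "\<forall>i\<in>insert j J. \<bar>t i\<bar> \<le> R" by blast
        have "t j *\<^sub>R e j \<in> (\<lambda>s. s *\<^sub>R e j) ` {-R..R}" using t(2) by (auto simp: abs_le_iff)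
        moreover have "z = t j *\<^sub>R e j + (\<Sum>i\<in>J. t i *\<^sub>R e i)" using t(1) insert.hyps by simp
        ultimately show "z \<in> ?B" using t(2) by blast
      qed
      show "?B \<subseteq> ?A"
      proof
        fix z assume "z \<in> ?B"
        then obtain s t where st: "z = s *\<^sub>R e j + (\<Sum>i\<in>J. t i *\<^sub>R e i)" "\<bar>s\<bar> \<le> R" "\<forall>i\<in>J. \<bar>t i\<bar> \<le> R"
          by (auto simp: abs_le_iff)
        have "(\<Sum>i\<in>J. (t(j := s)) i *\<^sub>R e i) = (\<Sum>i\<in>J. t i *\<^sub>R e i)"
          using insert.hyps by (intro sum.cong) auto
        then have "z = (\<Sum>i\<in>insert j J. (t(j := s)) i *\<^sub>R e i)" using st insert.hyps by simp
        moreover have "\<forall>i\<in>insert j J. \<bar>(t(j := s)) i\<bar> \<le> R" using st by simp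
        ultimately show "z \<in> ?A" by blast
      qed
    qed
    moreover have "compact ((\<lambda>s. s *\<^sub>R e j) ` {-R..R})"
      by (intro compact_continuous_image continuous_intros compact_Icc)
    ultimately show ?case using compact_sums[OF _ insert.IH] by simp
  qed simp
  then have K: "compact {\<Sum>i\<in>I. t i *\<^sub>R e i | t. \<forall>i\<in>I. \<bar>t i\<bar> \<le> R}" using fr by (simp add: finite_frame_def)
  have "cball x r \<subseteq> {\<Sum>i\<in>I. t i *\<^sub>R e i | t. \<forall>i\<in>I. \<bar>t i\<bar> \<le> R}"
  proof
    fix w assume w: "w \<in> cball x r"
    have "norm w \<le> norm x + \<bar>r\<bar>" using w norm_triangle_sub[of w x] by (auto simp: dist_norm norm_minus_commute)
    have "\<bar>l i w\<bar> \<le> R" if "i \<in> I" for i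
    proof -
      have bl: "bounded_linear (l j)" if "j \<in> I" for j using fr that by (auto simp: finite_frame_def)
      have "\<bar>l i w\<bar> \<le> onorm (l i) * norm w" using onorm[OF bl[OF that], of w] by simp
      also have "\<dots> \<le> onorm (l i) * (norm x + \<bar>r\<bar>)"
        using \<open>norm w \<le> _\<close> onorm_pos_le[OF bl[OF that]] by (intro mult_left_mono) auto
      also have "\<dots> \<le> R" unfolding R_def
        using fr that bl by (intro member_le_sum) (auto simp: finite_frame_def intro!: mult_nonneg_nonneg onorm_pos_le)
      finally show ?thesis .
    qed
    moreover have "w = (\<Sum>i\<in>I. l i w *\<^sub>R e i)" using fr by (auto simp: finite_frame_def)
    ultimately show "w \<in> {\<Sum>i\<in>I. t i *\<^sub>R e i | t. \<forall>i\<in>I. \<bar>t i\<bar> \<le> R}"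
      by (intro CollectI exI[of _ "\<lambda>i. l i w"] conjI ballI)
  qed
  then show ?thesis using compact_Int_closed[OF K closed_cball, of x r] by (simp add: inf.absorb2)
qed

section \<open>Smooth functions on a Lie group\<close>

locale framed_lie_group =
  fixes A :: "('g::{topological_group_add, t2_space, second_countable_topology}, 'e::real_inner) chart set"
    and d :: nat
    and X :: "nat \<Rightarrow> ('g \<Rightarrow> complex) \<Rightarrow> 'g \<Rightarrow> complex"
    and U0 :: "'g set" and \<phi>0 :: "'g \<Rightarrow> 'e"
    and b :: "nat \<Rightarrow> 'e" and l :: "nat \<Rightarrow> 'e \<Rightarrow> real"
  assumes lie: "lie_group A" and chart0: "(U0, \<phi>0) \<in> A" "0 \<in> U0"
    and frame: "finite_frame {..<d} l b"
    and l_b: "\<And>i j. i < d \<Longrightarrow> j < d \<Longrightarrow> l i (b j) = (if i = j then 1 else 0)"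
    and X_eq: "\<And>j. j < d \<Longrightarrow> X j = left_inv_field (U0, \<phi>0) (b j)"

lemma left_inv_basis_frame:
  assumes "lie_group A" "left_inv_basis A d X"
  obtains U0 \<phi>0 b l where "framed_lie_group A d X U0 \<phi>0 b l"
proof -
  obtain U0 \<phi>0 b where "(U0, \<phi>0) \<in> A" "0 \<in> U0" and b: "inj_on b {..<d}" "independent (b ` {..<d})" "span (b ` {..<d}) = UNIV"
    and "\<forall>j<d. X j = left_inv_field (U0, \<phi>0) (b j)"
    using assms(2) by (auto simp: left_inv_basis_def)
  moreover obtain l where "finite_frame {..<d} l b" "\<And>i j. i \<in> {..<d} \<Longrightarrow> j \<in> {..<d} \<Longrightarrow> l i (b j) = (if i = j then 1 else 0)"
    using finite_frame_of_basis[OF finite_lessThan b] by blast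
  ultimately have "framed_lie_group A d X U0 \<phi>0 b l"
    using assms(1) by unfold_locales auto
  then show ?thesis using that by blast
qed

context framed_lie_group
begin

abbreviation chart_inv :: "'g set \<Rightarrow> ('g \<Rightarrow> 'e) \<Rightarrow> 'e \<Rightarrow> 'g" where
  "chart_inv U \<phi> \<equiv> inv_into U \<phi>"

lemma chart_props:
  assumes "(U, \<phi>) \<in> A"
  shows chart_open: "open U" and chart_image_open: "open (\<phi> ` U)"
    and chart_inv_f: "x \<in> U \<Longrightarrow> chart_inv U \<phi> (\<phi> x) = x"
    and f_chart_inv: "p \<in> \<phi> ` U \<Longrightarrow> \<phi> (chart_inv U \<phi> p) = p"
    and chart_inv_in: "p \<in> \<phi> ` U \<Longrightarrow> chart_inv U \<phi> p \<in> U"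
    and chart_cont: "continuous_on U \<phi>"
    and chart_inv_cont: "continuous_on (\<phi> ` U) (chart_inv U \<phi>)"
proof -
  have *: "open U" "open (\<phi> ` U)" and h: "homeomorphism U (\<phi> ` U) \<phi> (chart_inv U \<phi>)"
    using lie assms unfolding lie_group_def smooth_atlas_def by auto
  show "open U" "open (\<phi> ` U)" using * by auto
  show "x \<in> U \<Longrightarrow> chart_inv U \<phi> (\<phi> x) = x" "p \<in> \<phi> ` U \<Longrightarrow> \<phi> (chart_inv U \<phi> p) = p"
    "continuous_on U \<phi>" "continuous_on (\<phi> ` U) (chart_inv U \<phi>)" "p \<in> \<phi> ` U \<Longrightarrow> chart_inv U \<phi> p \<in> U"
    using h by (auto simp: homeomorphism_def)
qed

lemma ex_chart: obtains U \<phi> where "(U, \<phi>) \<in> A" "x \<in> U"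
proof -
  have "(\<Union>(U, \<phi>)\<in>A. U) = UNIV" using lie unfolding lie_group_def smooth_atlas_def by auto
  then have "x \<in> (\<Union>(U, \<phi>)\<in>A. U)" by simp
  then show ?thesis using that by auto
qed

lemma transition_Ck_on:
  assumes "(U, \<phi>) \<in> A" "(V, \<psi>) \<in> A"
  shows "Ck_on k (\<phi> ` (U \<inter> V)) (\<psi> \<circ> chart_inv U \<phi>)"
  using lie assms unfolding lie_group_def smooth_atlas_def smooth_map_on_def by fast

lemma chart_image:
  assumes "(U, \<phi>) \<in> A" "W \<subseteq> U"
  shows "\<phi> ` W = {p \<in> \<phi> ` U. chart_inv U \<phi> p \<in> W}"
  using assms(2) chart_inv_f[OF assms(1)] f_chart_inv[OF assms(1)] by force

lemma open_chart_image:
  assumes "(U, \<phi>) \<in> A" "open W" "W \<subseteq> U"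
  shows "open (\<phi> ` W)"
  using continuous_open_preimage[OF chart_inv_cont[OF assms(1)] chart_image_open[OF assms(1)] assms(2)]
  unfolding chart_image[OF assms(1,3)] by (simp add: vimage_def Int_def)

lemma open_chart_preimage:
  assumes "(U, \<phi>) \<in> A" "open Q"
  shows "open {x \<in> U. \<phi> x \<in> Q}"
  using continuous_open_preimage[OF chart_cont[OF assms(1)] chart_open[OF assms(1)] assms(2)]
  by (simp add: vimage_def Int_def)

definition mult_map :: "'g set \<Rightarrow> ('g \<Rightarrow> 'e) \<Rightarrow> 'g set \<Rightarrow> ('g \<Rightarrow> 'e) \<Rightarrow> ('g \<Rightarrow> 'e) \<Rightarrow> 'e \<times> 'e \<Rightarrow> 'e" where
  "mult_map U \<phi> V \<psi> \<theta> = (\<lambda>(p, q). \<theta> (chart_inv U \<phi> p + chart_inv V \<psi> q))"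

definition mult_dom :: "'g set \<Rightarrow> ('g \<Rightarrow> 'e) \<Rightarrow> 'g set \<Rightarrow> ('g \<Rightarrow> 'e) \<Rightarrow> 'g set \<Rightarrow> ('e \<times> 'e) set" where
  "mult_dom U \<phi> V \<psi> W = {(p, q). p \<in> \<phi> ` U \<and> q \<in> \<psi> ` V \<and> chart_inv U \<phi> p + chart_inv V \<psi> q \<in> W}"

lemma Ck_on_mult_map:
  assumes "(U, \<phi>) \<in> A" "(V, \<psi>) \<in> A" "(W, \<theta>) \<in> A"
  shows "Ck_on k (mult_dom U \<phi> V \<psi> W) (mult_map U \<phi> V \<psi> \<theta>)"
  using lie assms unfolding lie_group_def smooth_map_on_def mult_map_def mult_dom_def by fast

lemma open_mult_dom:
  assumes "(U, \<phi>) \<in> A" "(V, \<psi>) \<in> A" "open W"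
  shows "open (mult_dom U \<phi> V \<psi> W)"
proof -
  have "continuous_on (\<phi> ` U \<times> \<psi> ` V) (\<lambda>(p, q). chart_inv U \<phi> p + chart_inv V \<psi> q)"
    unfolding case_prod_beta
    by (intro continuous_on_add continuous_on_compose2[OF chart_inv_cont[OF assms(1)]]
        continuous_on_compose2[OF chart_inv_cont[OF assms(2)]] continuous_intros) auto
  then have "open ((\<phi> ` U \<times> \<psi> ` V) \<inter> (\<lambda>(p, q). chart_inv U \<phi> p + chart_inv V \<psi> q) -` W)"
    by (rule continuous_open_preimage) (intro open_Times chart_image_open assms, rule assms)
  also have "(\<phi> ` U \<times> \<psi> ` V) \<inter> (\<lambda>(p, q). chart_inv U \<phi> p + chart_inv V \<psi> q) -` W = mult_dom U \<phi> V \<psi> W"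
    by (auto simp: mult_dom_def)
  finally show ?thesis .
qed

section \<open>Functions of class C^k on the group\<close>

definition Ck_map :: "nat \<Rightarrow> ('g \<Rightarrow> 'b::real_normed_vector) \<Rightarrow> bool" where
  "Ck_map k f \<longleftrightarrow> (\<forall>(U, \<phi>)\<in>A. Ck_on k (\<phi> ` U) (f \<circ> chart_inv U \<phi>))"

definition smooth :: "('g \<Rightarrow> 'b::real_normed_vector) \<Rightarrow> bool" where
  "smooth f \<longleftrightarrow> (\<forall>k. Ck_map k f)"

lemma Ck_eq: "Ck A k = Collect (Ck_map k)"
  by (auto simp: Ck_def Ck_map_def)

lemma Ck_mapD: "Ck_map k f \<Longrightarrow> (U, \<phi>) \<in> A \<Longrightarrow> Ck_on k (\<phi> ` U) (f \<circ> chart_inv U \<phi>)"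
  by (auto simp: Ck_map_def)

text \<open>One chart around each point suffices, because on overlaps any other chart differs from
  it by a smooth transition map.\<close>

lemma Ck_mapI:
  assumes "\<And>x. \<exists>U \<phi> W. (U, \<phi>) \<in> A \<and> open W \<and> x \<in> W \<and> W \<subseteq> U \<and> Ck_on k (\<phi> ` W) (f \<circ> chart_inv U \<phi>)"
  shows "Ck_map k f"
  unfolding Ck_map_def
proof clarify
  fix V \<psi> assume V: "(V, \<psi>) \<in> A"
  show "Ck_on k (\<psi> ` V) (f \<circ> chart_inv V \<psi>)"
  proof (rule Ck_on_local)
    fix p assume p: "p \<in> \<psi> ` V"
    define x where "x = chart_inv V \<psi> p"
    obtain U \<phi> W where U: "(U, \<phi>) \<in> A" "open W" "x \<in> W" "W \<subseteq> U" "Ck_on k (\<phi> ` W) (f \<circ> chart_inv U \<phi>)"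
      using assms by blast
    let ?T = "\<psi> ` (V \<inter> W)"
    have T: "open ?T" using U V chart_open by (intro open_chart_image) auto
    have "p \<in> ?T" using p V U(3) unfolding x_def by (metis IntI chart_inv_in f_chart_inv imageI)
    moreover have "Ck_on k ?T (\<lambda>q. (f \<circ> chart_inv U \<phi>) ((\<phi> \<circ> chart_inv V \<psi>) q))"
    proof (rule Ck_on_compose[OF frame T])
      show "open (\<phi> ` W)" using U open_chart_image by blast
      show "(\<phi> \<circ> chart_inv V \<psi>) ` ?T \<subseteq> \<phi> ` W" using chart_inv_f[OF V] by auto
      show "Ck_on k ?T (\<phi> \<circ> chart_inv V \<psi>)"
        by (rule Ck_on_subset[OF transition_Ck_on[OF V U(1)]]) (use U in auto)
    qed fact
    then have "Ck_on k ?T (f \<circ> chart_inv V \<psi>)"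
      by (rule Ck_on_cong[OF _ T]) (use U V in \<open>auto simp: chart_inv_f\<close>)
    ultimately show "\<exists>T. open T \<and> p \<in> T \<and> Ck_on k T (f \<circ> chart_inv V \<psi>)" using T by blast
  qed
qed

lemma Ck_map_continuous: "Ck_map k f \<Longrightarrow> continuous_on UNIV f"
proof (intro continuous_at_imp_continuous_on ballI)
  fix x assume f: "Ck_map k f"
  obtain U \<phi> where U: "(U, \<phi>) \<in> A" "x \<in> U" by (rule ex_chart)
  have "continuous_on U (\<lambda>y. (f \<circ> chart_inv U \<phi>) (\<phi> y))"
    by (rule continuous_on_compose2[OF Ck_on_imp_continuous_on[OF Ck_mapD[OF f U(1)]] chart_cont[OF U(1)]]) auto
  then have "continuous_on U f" by (rule continuous_on_eq) (use U in \<open>auto simp: chart_inv_f\<close>)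
  then show "isCont f x" using U chart_open continuous_on_eq_continuous_at by blast
qed

lemma Ck_map_const: "Ck_map k (\<lambda>x. c)"
  by (auto simp: Ck_map_def o_def intro: Ck_on_const)

lemma Ck_map_bilinear:
  assumes "bounded_bilinear B" "Ck_map k f" "Ck_map k g"
  shows "Ck_map k (\<lambda>x. B (f x) (g x))"
  unfolding Ck_map_def
proof clarify
  fix U \<phi> assume U: "(U, \<phi>) \<in> A"
  then show "Ck_on k (\<phi> ` U) ((\<lambda>x. B (f x) (g x)) \<circ> chart_inv U \<phi>)"
    using Ck_on_bilinear[OF assms(1) chart_image_open[OF U] Ck_mapD[OF assms(2) U] Ck_mapD[OF assms(3) U]]
    by (simp add: o_def)
qed

lemma Ck_map_linear:
  assumes "bounded_linear L" "Ck_map k f"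
  shows "Ck_map k (\<lambda>x. L (f x))"
  unfolding Ck_map_def
proof clarify
  fix U \<phi> assume U: "(U, \<phi>) \<in> A"
  then show "Ck_on k (\<phi> ` U) ((\<lambda>x. L (f x)) \<circ> chart_inv U \<phi>)"
    using Ck_on_linear[OF assms(1) chart_image_open[OF U] Ck_mapD[OF assms(2) U]]
    by (simp add: o_def)
qed

lemma Ck_map_add:
  assumes "Ck_map k f" "Ck_map k g"
  shows "Ck_map k (\<lambda>x. f x + g x)"
  unfolding Ck_map_def
proof clarify
  fix U \<phi> assume U: "(U, \<phi>) \<in> A"
  then show "Ck_on k (\<phi> ` U) ((\<lambda>x. f x + g x) \<circ> chart_inv U \<phi>)"
    using Ck_on_add[OF chart_image_open[OF U] Ck_mapD[OF assms(1) U] Ck_mapD[OF assms(2) U]]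
    by (simp add: o_def)
qed

lemma Ck_map_sum:
  assumes "\<And>i. i \<in> I \<Longrightarrow> Ck_map k (f i)"
  shows "Ck_map k (\<lambda>x. \<Sum>i\<in>I. f i x)"
  using assms by (induction I rule: infinite_finite_induct) (auto intro: Ck_map_const Ck_map_add)

lemma Ck_map_minus: "Ck_map k f \<Longrightarrow> Ck_map k (\<lambda>x. - f x)"
  by (rule Ck_map_linear[OF bounded_linear_minus[OF bounded_linear_ident]])

lemma Ck_map_diff: "Ck_map k f \<Longrightarrow> Ck_map k g \<Longrightarrow> Ck_map k (\<lambda>x. f x - g x)"
  using Ck_map_add[OF _ Ck_map_minus, of k f g] by simp

lemma Ck_map_mult:
  fixes f g :: "'g \<Rightarrow> 'b::real_normed_algebra"
  shows "Ck_map k f \<Longrightarrow> Ck_map k g \<Longrightarrow> Ck_map k (\<lambda>x. f x * g x)"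
  by (rule Ck_map_bilinear[OF bounded_bilinear_mult])

lemma Ck_map_of_real: "Ck_map k f \<Longrightarrow> Ck_map k (\<lambda>x. of_real (f x) :: 'b::{real_normed_algebra_1})"
  by (rule Ck_map_linear[OF bounded_linear_of_real])

lemma Ck_map_compose_real:
  fixes f :: "'g \<Rightarrow> real"
  assumes "Ck_map k f" "Ck_on k UNIV h"
  shows "Ck_map k (\<lambda>x. h (f x))"
  unfolding Ck_map_def
proof clarify
  fix U \<phi> assume U: "(U, \<phi>) \<in> A"
  then show "Ck_on k (\<phi> ` U) ((\<lambda>x. h (f x)) \<circ> chart_inv U \<phi>)"
    using Ck_on_compose[OF finite_frame_real chart_image_open[OF U] open_UNIV _ Ck_mapD[OF assms(1) U] assms(2)]
    by (simp add: o_def)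
qed

text \<open>A point outside \<open>U\<close> has a neighbourhood that avoids the closed set
  \<open>K\<close>, and there the extended function is 0.\<close>

lemma Ck_map_extend_zero:
  assumes U: "(U, \<phi>) \<in> A" and F: "Ck_on k (\<phi> ` U) F" and K: "compact K" "K \<subseteq> U"
    and zero: "\<And>x. x \<in> U \<Longrightarrow> x \<notin> K \<Longrightarrow> F (\<phi> x) = 0"
  shows "Ck_map k (\<lambda>x. if x \<in> U then F (\<phi> x) else 0)" (is "Ck_map k ?f")
proof (rule Ck_mapI)
  fix x
  show "\<exists>V \<psi> W. (V, \<psi>) \<in> A \<and> open W \<and> x \<in> W \<and> W \<subseteq> V \<and> Ck_on k (\<psi> ` W) (?f \<circ> chart_inv V \<psi>)"
  proof (cases "x \<in> U")
    case True
    have "Ck_on k (\<phi> ` U) (?f \<circ> chart_inv U \<phi>)"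
      by (rule Ck_on_cong[OF F chart_image_open[OF U]]) (use U in \<open>auto simp: chart_inv_f\<close>)
    then show ?thesis using U True chart_open by blast
  next
    case False
    obtain V \<psi> where V: "(V, \<psi>) \<in> A" "x \<in> V" by (rule ex_chart)
    have op: "open (V \<inter> - K)"
      using chart_open[OF V(1)] K(1) by (intro open_Int) (auto simp: compact_imp_closed)
    have "Ck_on k (\<psi> ` (V \<inter> - K)) (?f \<circ> chart_inv V \<psi>)"
      by (rule Ck_on_cong[OF Ck_on_const[of _ _ 0] open_chart_image[OF V(1) op]])
         (use V zero in \<open>auto simp: chart_inv_f\<close>)
    then show ?thesis using V op False K by blast
  qed
qed

text \<open>In charts left translation by \<open>x\<close> is the multiplication map with its first
  argument frozen at the coordinates of \<open>x\<close>.\<close>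

lemma Ck_map_left_translate:
  assumes f: "Ck_map k f"
  shows "Ck_map k (\<lambda>y. f (x + y))"
proof (rule Ck_mapI)
  fix y
  obtain U \<phi> where U: "(U, \<phi>) \<in> A" "x \<in> U" by (rule ex_chart)
  obtain V \<psi> where V: "(V, \<psi>) \<in> A" "y \<in> V" by (rule ex_chart)
  obtain W \<theta> where W: "(W, \<theta>) \<in> A" "x + y \<in> W" by (rule ex_chart)
  let ?O = "{z \<in> V. x + z \<in> W}"
  have O: "open ?O"
  proof -
    have "continuous_on V (\<lambda>z. x + z)" by (intro continuous_intros)
    from continuous_open_preimage[OF this chart_open[OF V(1)] chart_open[OF W(1)]]
    show ?thesis by (simp add: vimage_def Int_def)
  qed
  have img: "open (\<psi> ` ?O)" by (rule open_chart_image[OF V(1) O]) auto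
  have dom: "(\<phi> x, \<psi> z) \<in> mult_dom U \<phi> V \<psi> W" if "z \<in> ?O" for z
    using that U V by (auto simp: mult_dom_def chart_inv_f)
  have "Ck_on k (\<psi> ` ?O) (\<lambda>q. (\<phi> x, q))"
  proof -
    have "bounded_linear (\<lambda>q::'e. (0::'e, q))"
      by (intro bounded_linear_Pair bounded_linear_zero bounded_linear_ident)
    from Ck_on_add[OF img Ck_on_const Ck_on_linear[OF this img Ck_on_ident]]
    have "Ck_on k (\<psi> ` ?O) (\<lambda>q. (\<phi> x, 0) + (0, q))" .
    then show ?thesis by simp
  qed
  from Ck_on_compose[OF finite_frame_prod[OF frame frame] img open_mult_dom[OF U(1) V(1) chart_open[OF W(1)]] _ this
      Ck_on_mult_map[OF U(1) V(1) W(1)]]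
  have "Ck_on k (\<psi> ` ?O) (\<lambda>q. mult_map U \<phi> V \<psi> \<theta> (\<phi> x, q))" using dom by blast
  from Ck_on_compose[OF frame img chart_image_open[OF W(1)] _ this Ck_mapD[OF f W(1)]]
  have "Ck_on k (\<psi> ` ?O) (\<lambda>q. (f \<circ> chart_inv W \<theta>) (mult_map U \<phi> V \<psi> \<theta> (\<phi> x, q)))"
    using U V W by (force simp: mult_map_def chart_inv_f)
  then have "Ck_on k (\<psi> ` ?O) ((\<lambda>y. f (x + y)) \<circ> chart_inv V \<psi>)"
    by (rule Ck_on_cong[OF _ img]) (use U V W in \<open>auto simp: mult_map_def chart_inv_f\<close>)
  moreover have "y \<in> ?O" "?O \<subseteq> V" using V W by auto
  ultimately show "\<exists>V \<psi> W. (V, \<psi>) \<in> A \<and> open W \<and> y \<in> W \<and> W \<subseteq> V \<and> Ck_on k (\<psi> ` W) ((\<lambda>y. f (x + y)) \<circ> chart_inv V \<psi>)"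
    using V(1) O by blast
qed

section \<open>Left-invariant vector fields in charts\<close>

definition frame_curve :: "nat \<Rightarrow> real \<Rightarrow> 'g" where
  "frame_curve j t = chart_inv U0 \<phi>0 (\<phi>0 0 + t *\<^sub>R b j)"

text \<open>The coordinate vector of the left-invariant field \<open>X j\<close> at the point with
  coordinates \<open>p\<close>: the derivative of multiplication in its second argument at the
  identity, along \<open>b j\<close>.\<close>

definition frame_field :: "'g set \<Rightarrow> ('g \<Rightarrow> 'e) \<Rightarrow> nat \<Rightarrow> 'e \<Rightarrow> 'e" where
  "frame_field V \<psi> j p = dird (0, b j) (mult_map V \<psi> U0 \<phi>0 \<psi>) (p, \<phi>0 0)"

lemma X_as_vector_derivative: "j < d \<Longrightarrow> X j f g = vector_derivative (\<lambda>t. f (g + frame_curve j t)) (at 0)"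
  by (simp add: X_eq left_inv_field_def frame_curve_def)

lemma X_left_translate: "j < d \<Longrightarrow> X j (\<lambda>y. f (x + y)) g = X j f (x + g)"
  by (simp add: X_as_vector_derivative add.assoc)

lemma chart_inv_origin: "chart_inv U0 \<phi>0 (\<phi>0 0) = 0"
  using chart_inv_f[OF chart0] .

lemma frame_curve_nhd:
  assumes "open N" "g \<in> N"
  obtains T where "open T" "0 \<in> T" "\<And>t. t \<in> T \<Longrightarrow> \<phi>0 0 + t *\<^sub>R b j \<in> \<phi>0 ` U0"
    "\<And>t. t \<in> T \<Longrightarrow> g + frame_curve j t \<in> N"
proof -
  let ?O = "{z \<in> U0. g + z \<in> N}"
  have "continuous_on U0 (\<lambda>z. g + z)" by (intro continuous_intros)
  from continuous_open_preimage[OF this chart_open[OF chart0(1)] assms(1)]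
  have "open ?O" by (simp add: vimage_def Int_def)
  then have "open (\<phi>0 ` ?O)" by (rule open_chart_image[OF chart0(1)]) auto
  moreover have "continuous_on UNIV (\<lambda>t. \<phi>0 0 + t *\<^sub>R b j)" by (intro continuous_intros)
  ultimately have "open ((\<lambda>t. \<phi>0 0 + t *\<^sub>R b j) -` (\<phi>0 ` ?O))"
    using continuous_on_open_vimage[OF open_UNIV, of "\<lambda>t. \<phi>0 0 + t *\<^sub>R b j"] by simp
  moreover have "0 \<in> (\<lambda>t. \<phi>0 0 + t *\<^sub>R b j) -` (\<phi>0 ` ?O)" using assms(2) chart0 by auto
  moreover have "\<phi>0 0 + t *\<^sub>R b j \<in> \<phi>0 ` U0 \<and> g + frame_curve j t \<in> N"
    if "t \<in> (\<lambda>t. \<phi>0 0 + t *\<^sub>R b j) -` (\<phi>0 ` ?O)" for t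
    using that chart_inv_f[OF chart0(1)] by (auto simp: frame_curve_def)
  ultimately show ?thesis using that by blast
qed

lemma mult_dom_origin: "(V, \<psi>) \<in> A \<Longrightarrow> p \<in> \<psi> ` V \<Longrightarrow> (p, \<phi>0 0) \<in> mult_dom V \<psi> U0 \<phi>0 V"
  using chart0 by (auto simp: mult_dom_def chart_inv_origin chart_inv_in)

lemma mult_map_origin: "(V, \<psi>) \<in> A \<Longrightarrow> p \<in> \<psi> ` V \<Longrightarrow> mult_map V \<psi> U0 \<phi>0 \<psi> (p, \<phi>0 0) = p"
  by (simp add: mult_map_def chart_inv_origin f_chart_inv)

lemma Ck_on_frame_field:
  assumes V: "(V, \<psi>) \<in> A"
  shows "Ck_on k (\<psi> ` V) (frame_field V \<psi> j)"
proof -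
  note op = chart_image_open[OF V]
  have "bounded_linear (\<lambda>q::'e. (q, 0::'e))"
    by (intro bounded_linear_Pair bounded_linear_zero bounded_linear_ident)
  from Ck_on_add[OF op Ck_on_linear[OF this op Ck_on_ident] Ck_on_const]
  have "Ck_on k (\<psi> ` V) (\<lambda>q. (q, 0) + (0, \<phi>0 0))" .
  then have 1: "Ck_on k (\<psi> ` V) (\<lambda>q. (q, \<phi>0 0))" by simp
  have 2: "Ck_on k (mult_dom V \<psi> U0 \<phi>0 V) (dird (0, b j) (mult_map V \<psi> U0 \<phi>0 \<psi>))"
    using Ck_on_mult_map[OF V chart0(1) V, of "Suc k"] by simp
  have "Ck_on k (\<psi> ` V) (\<lambda>q. dird (0, b j) (mult_map V \<psi> U0 \<phi>0 \<psi>) (q, \<phi>0 0))"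
    using Ck_on_compose[OF finite_frame_prod[OF frame frame] op open_mult_dom[OF V chart0(1) chart_open[OF V]] _ 1 2]
      mult_dom_origin[OF V] by blast
  then show ?thesis by (simp add: frame_field_def[abs_def])
qed

lemma has_vector_derivative_frame_curve:
  assumes V: "(V, \<psi>) \<in> A" and p: "p \<in> \<psi> ` V" and f: "Ck_map (Suc k) f"
  shows "((\<lambda>t. f (chart_inv V \<psi> p + frame_curve j t)) has_vector_derivative
     dird (frame_field V \<psi> j p) (f \<circ> chart_inv V \<psi>) p) (at 0)"
proof -
  let ?m = "mult_map V \<psi> U0 \<phi>0 \<psi>" and ?F = "f \<circ> chart_inv V \<psi>"
  have F: "(?F has_derivative frechet_derivative ?F (at p)) (at p)"
    using Ck_on_Suc_has_derivative[OF Ck_mapD[OF f V] p] .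
  have "?m differentiable (at (p, \<phi>0 0))"
    using Ck_on_mult_map[OF V chart0(1) V, of "Suc k"] mult_dom_origin[OF V p] by simp
  then have "((\<lambda>t. ?m ((p, \<phi>0 0) + t *\<^sub>R (0, b j))) has_vector_derivative frame_field V \<psi> j p) (at 0)"
    using line_has_vector_derivative[where f="?m" and a="(p, \<phi>0 0)" and s=0 and v="(0, b j)"]
    by (simp add: frame_field_def)
  moreover have "(?F has_derivative frechet_derivative ?F (at p)) (at (?m ((p, \<phi>0 0) + 0 *\<^sub>R (0, b j))))"
    using F by (simp add: mult_map_origin[OF V p])
  ultimately have "((\<lambda>t. ?F (?m ((p, \<phi>0 0) + t *\<^sub>R (0, b j)))) has_derivative
      (\<lambda>h. frechet_derivative ?F (at p) (h *\<^sub>R frame_field V \<psi> j p))) (at 0)"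
    unfolding has_vector_derivative_def by (rule has_derivative_compose)
  then have D: "((\<lambda>t. ?F (?m ((p, \<phi>0 0) + t *\<^sub>R (0, b j)))) has_vector_derivative
      dird (frame_field V \<psi> j p) ?F p) (at 0)"
    using linear_scale[OF has_derivative_linear[OF F]] by (simp add: has_vector_derivative_def)
  obtain T where T: "open T" "0 \<in> T" "\<And>t. t \<in> T \<Longrightarrow> chart_inv V \<psi> p + frame_curve j t \<in> V"
    using frame_curve_nhd[OF chart_open[OF V] chart_inv_in[OF V p]] by metis
  show ?thesis
    by (rule has_vector_derivative_transform_within_open[OF D T(1,2)])
       (use T(3) V in \<open>auto simp: mult_map_def frame_curve_def chart_inv_f\<close>)
qed

lemma X_chart:
  assumes "j < d" "(V, \<psi>) \<in> A" "p \<in> \<psi> ` V" "Ck_map (Suc k) f"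
  shows "X j f (chart_inv V \<psi> p) = dird (frame_field V \<psi> j p) (f \<circ> chart_inv V \<psi>) p"
  unfolding X_as_vector_derivative[OF assms(1)]
  by (rule vector_derivative_at) (rule has_vector_derivative_frame_curve[OF assms(2-4)])

text \<open>\<open>X j\<close> is defined through \<open>vector_derivative\<close>, which returns a
  value even where no derivative exists. For C^1 functions it does exist, and rules such as
  \<open>X_linear\<close> rest on this.\<close>

lemma has_vector_derivative_X:
  assumes j: "j < d" and f: "Ck_map (Suc k) f"
  shows "((\<lambda>t. f (g + frame_curve j t)) has_vector_derivative X j f g) (at 0)"
proof -
  obtain V \<psi> where V: "(V, \<psi>) \<in> A" "g \<in> V" by (rule ex_chart)
  then have "\<psi> g \<in> \<psi> ` V" by simp
  from has_vector_derivative_frame_curve[OF V(1) this f, of j] X_chart[OF j V(1) this f]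
  show ?thesis using V by (simp add: chart_inv_f)
qed

lemma X_eqI:
  assumes "j < d" "((\<lambda>t. f (g + frame_curve j t)) has_vector_derivative D) (at 0)"
  shows "X j f g = D"
  using assms by (simp add: X_as_vector_derivative vector_derivative_at)

lemma X_linear:
  assumes "j < d" "Ck_map (Suc k) f" "Ck_map (Suc k) g"
  shows "X j (\<lambda>x. a * f x + c * g x) = (\<lambda>x. a * X j f x + c * X j g x)"
proof
  fix x
  show "X j (\<lambda>x. a * f x + c * g x) x = a * X j f x + c * X j g x"
    by (rule X_eqI[OF assms(1)])
       (intro has_vector_derivative_add has_vector_derivative_mult_right
          has_vector_derivative_X[OF assms(1,2)] has_vector_derivative_X[OF assms(1,3)])
qed

lemma X_cong_open:
  assumes "j < d" "Ck_map (Suc k) f" "open N" "g \<in> N" "\<And>x. x \<in> N \<Longrightarrow> f x = h x"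
  shows "X j h g = X j f g"
proof -
  obtain T where T: "open T" "0 \<in> T" "\<And>t. t \<in> T \<Longrightarrow> g + frame_curve j t \<in> N"
    using frame_curve_nhd[OF assms(3,4)] by metis
  show ?thesis
    by (rule X_eqI[OF assms(1)], rule has_vector_derivative_transform_within_open[OF has_vector_derivative_X[OF assms(1,2)] T(1,2)])
       (use T assms in auto)
qed

lemma X_const: "j < d \<Longrightarrow> X j (\<lambda>x. c) = (\<lambda>x. 0)"
  by (rule ext, rule X_eqI) auto

text \<open>In a chart \<open>X j f\<close> is a derivative of \<open>f\<close> along the variable
  direction \<open>frame_field\<close>. Expanded in the frame it becomes a sum of smooth
  coefficients times derivatives along fixed vectors, so that only one order is lost.\<close>

lemma Ck_map_X:
  assumes j: "j < d" and f: "Ck_map (Suc k) f"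
  shows "Ck_map k (X j f)"
  unfolding Ck_map_def
proof clarify
  fix V \<psi> assume V: "(V, \<psi>) \<in> A"
  note op = chart_image_open[OF V]
  let ?F = "f \<circ> chart_inv V \<psi>"
  have F: "Ck_on (Suc k) (\<psi> ` V) ?F" using Ck_mapD[OF f V] .
  have "Ck_on k (\<psi> ` V) (\<lambda>p. \<Sum>i<d. l i (frame_field V \<psi> j p) *\<^sub>R dird (b i) ?F p)"
  proof (rule Ck_on_sum[OF op], rule Ck_on_bilinear[OF bounded_bilinear_scaleR op])
    fix i assume "i \<in> {..<d}"
    then have "bounded_linear (l i)" using frame by (auto simp: finite_frame_def)
    then show "Ck_on k (\<psi> ` V) (\<lambda>p. l i (frame_field V \<psi> j p))"
      by (rule Ck_on_linear[OF _ op]) (rule Ck_on_frame_field[OF V])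
    show "Ck_on k (\<psi> ` V) (dird (b i) ?F)" using F by simp
  qed
  then show "Ck_on k (\<psi> ` V) (X j f \<circ> chart_inv V \<psi>)"
  proof (rule Ck_on_cong[OF _ op])
    fix p assume p: "p \<in> \<psi> ` V"
    have "linear (frechet_derivative ?F (at p))"
      using Ck_on_Suc_has_derivative[OF F p] has_derivative_linear by blast
    then have "(\<Sum>i<d. l i w *\<^sub>R dird (b i) ?F p) = dird (\<Sum>i<d. l i w *\<^sub>R b i) ?F p" for w
      by (simp add: linear_sum linear_scale)
    then show "(\<Sum>i<d. l i (frame_field V \<psi> j p) *\<^sub>R dird (b i) ?F p) = (X j f \<circ> chart_inv V \<psi>) p"
      using frame X_chart[OF j V p f] by (simp add: finite_frame_def)
  qed
qed

text \<open>With the identity as first factor, multiplication is the identity map in its second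
  argument.\<close>

lemma frame_field_origin: "frame_field U0 \<phi>0 j (\<phi>0 0) = b j"
proof -
  let ?m = "mult_map U0 \<phi>0 U0 \<phi>0 \<phi>0"
  have p: "\<phi>0 0 \<in> \<phi>0 ` U0" using chart0 by simp
  have "?m differentiable (at (\<phi>0 0, \<phi>0 0))"
    using Ck_on_mult_map[OF chart0(1) chart0(1) chart0(1), of "Suc 0"] mult_dom_origin[OF chart0(1) p] by simp
  then have "((\<lambda>t. ?m ((\<phi>0 0, \<phi>0 0) + t *\<^sub>R (0, b j))) has_vector_derivative frame_field U0 \<phi>0 j (\<phi>0 0)) (at 0)"
    using line_has_vector_derivative[where f="?m" and a="(\<phi>0 0, \<phi>0 0)" and s=0 and v="(0, b j)"]
    by (simp add: frame_field_def)
  moreover have "((\<lambda>t. ?m ((\<phi>0 0, \<phi>0 0) + t *\<^sub>R (0, b j))) has_vector_derivative b j) (at 0)"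
  proof -
    obtain T where T: "open T" "0 \<in> T" "\<And>t. t \<in> T \<Longrightarrow> \<phi>0 0 + t *\<^sub>R b j \<in> \<phi>0 ` U0"
      using frame_curve_nhd[OF chart_open[OF chart0(1)] chart0(2)] by metis
    have "((\<lambda>t. \<phi>0 0 + t *\<^sub>R b j) has_vector_derivative b j) (at 0)"
      by (auto intro!: derivative_eq_intros)
    then show ?thesis
      by (rule has_vector_derivative_transform_within_open[OF _ T(1,2)])
         (use T(3) in \<open>auto simp: mult_map_def chart_inv_origin f_chart_inv[OF chart0(1)]\<close>)
  qed
  ultimately show ?thesis using vector_derivative_unique_at by blast
qed

lemma X_origin:
  assumes "j < d" "Ck_map (Suc k) f"
  shows "X j f 0 = dird (b j) (f \<circ> chart_inv U0 \<phi>0) (\<phi>0 0)"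
  using X_chart[OF assms(1) chart0(1) _ assms(2), of "\<phi>0 0"] chart0
  by (simp add: frame_field_origin chart_inv_origin)

section \<open>Cutoff functions\<close>

lemma Ck_map_bump_chart:
  assumes U: "(U, \<phi>) \<in> A" "x \<in> U" and r: "0 < r" "cball (\<phi> x) r \<subseteq> \<phi> ` U"
  defines "u \<equiv> \<lambda>y. if y \<in> U then bump ((norm (\<phi> y - \<phi> x))\<^sup>2 / r\<^sup>2) else 0"
  shows "Ck_map k u" and "{y. u y \<noteq> 0} \<subseteq> chart_inv U \<phi> ` cball (\<phi> x) r"
    and "compact (chart_inv U \<phi> ` cball (\<phi> x) r)" and "chart_inv U \<phi> ` cball (\<phi> x) r \<subseteq> U"
proof -
  let ?K = "chart_inv U \<phi> ` cball (\<phi> x) r"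
  show K: "compact ?K"
    by (intro compact_continuous_image compact_cball_finite_frame[OF frame]
        continuous_on_subset[OF chart_inv_cont[OF U(1)] r(2)])
  show KU: "?K \<subseteq> U" using r(2) chart_inv_in[OF U(1)] by auto
  have zero: "bump ((norm (\<phi> y - \<phi> x))\<^sup>2 / r\<^sup>2) = 0" if y: "y \<in> U" "y \<notin> ?K" for y
  proof -
    have "\<phi> y \<notin> cball (\<phi> x) r"
    proof
      assume "\<phi> y \<in> cball (\<phi> x) r"
      then have "chart_inv U \<phi> (\<phi> y) \<in> ?K" by (rule imageI)
      then show False using y chart_inv_f[OF U(1)] by simp
    qed
    then have "r < norm (\<phi> y - \<phi> x)" by (simp add: dist_norm norm_minus_commute)
    then have "r\<^sup>2 \<le> (norm (\<phi> y - \<phi> x))\<^sup>2" using r(1) by (intro power_mono) auto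
    then show ?thesis using r(1) by (intro bump_props(3)) (simp add: le_divide_eq)
  qed
  then show "{y. u y \<noteq> 0} \<subseteq> ?K" unfolding u_def by auto
  have op: "open (\<phi> ` U)" using chart_image_open[OF U(1)] .
  have c: "Ck_on k (\<phi> ` U) (\<lambda>p. p + (- \<phi> x))"
    by (rule Ck_on_add[OF op Ck_on_ident Ck_on_const])
  have "Ck_on k (\<phi> ` U) (\<lambda>p. (p + (- \<phi> x)) \<bullet> (p + (- \<phi> x)))"
    by (rule Ck_on_bilinear[OF bounded_bilinear_inner op c c])
  from Ck_on_linear[OF bounded_linear_divide op this, of "r\<^sup>2"]
  have "Ck_on k (\<phi> ` U) (\<lambda>p. (norm (p - \<phi> x))\<^sup>2 / r\<^sup>2)" by (simp add: power2_norm_eq_inner)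
  from Ck_on_compose[OF finite_frame_real op open_UNIV _ this Ck_on_bump_power]
  have "Ck_on k (\<phi> ` U) (\<lambda>p. bump ((norm (p - \<phi> x))\<^sup>2 / r\<^sup>2))" by simp
  from Ck_map_extend_zero[OF U(1) this K KU zero]
  show "Ck_map k u" unfolding u_def by simp
qed

lemma ex_bump:
  assumes "open W" "x \<in> W"
  obtains u :: "'g \<Rightarrow> real" and K where "smooth u" "compact K" "K \<subseteq> W" "{y. u y \<noteq> 0} \<subseteq> K" "u x = 1" "\<And>y. 0 \<le> u y"
proof -
  obtain U \<phi> where U: "(U, \<phi>) \<in> A" "x \<in> U" by (rule ex_chart)
  have "open (\<phi> ` (U \<inter> W))" using open_chart_image[OF U(1)] assms chart_open[OF U(1)] by auto
  then obtain r where r: "r > 0" "cball (\<phi> x) r \<subseteq> \<phi> ` (U \<inter> W)"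
    using U assms open_contains_cball by (metis IntI imageI)
  then have r': "cball (\<phi> x) r \<subseteq> \<phi> ` U" by auto
  note u = Ck_map_bump_chart[OF U r(1) r']
  have "chart_inv U \<phi> ` cball (\<phi> x) r \<subseteq> W" using r(2) chart_inv_f[OF U(1)] by auto
  then show ?thesis
    using that[OF _ u(3) _ u(2)] u(1) U unfolding smooth_def by (simp add: bump_props)
qed

text \<open>Finitely many bumps exceed 1/2 on open sets covering \<open>K\<close>. Doubling makes
  their sum \<open>B\<close> at least 1 there, and \<open>1 - bump\<close> maps 0 to 0 and
  everything from 1 on to 1, so the sum is truncated smoothly.\<close>

lemma ex_cutoff:
  assumes K: "compact K" and W: "open W" "K \<subseteq> W"
  obtains u :: "'g \<Rightarrow> real" and L N where "smooth u" "compact L" "L \<subseteq> W" "{y. u y \<noteq> 0} \<subseteq> L"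
    "open N" "K \<subseteq> N" "\<And>y. y \<in> N \<Longrightarrow> u y = 1" "\<And>y. 0 \<le> u y" "\<And>y. u y \<le> 1"
proof -
  have "\<forall>x\<in>K. \<exists>u L. smooth u \<and> compact L \<and> L \<subseteq> W \<and> {y. u y \<noteq> 0} \<subseteq> L \<and> u x = (1::real) \<and> (\<forall>y. 0 \<le> u y)"
  proof
    fix x assume "x \<in> K"
    then have "x \<in> W" using W by blast
    from ex_bump[OF W(1) this] show "\<exists>u L. smooth u \<and> compact L \<and> L \<subseteq> W \<and> {y. u y \<noteq> 0} \<subseteq> L \<and> u x = (1::real) \<and> (\<forall>y. 0 \<le> u y)"
      by metis
  qed
  from bchoice[OF this] obtain u where
    "\<forall>x\<in>K. \<exists>L. smooth (u x) \<and> compact L \<and> L \<subseteq> W \<and> {y. u x y \<noteq> 0} \<subseteq> L \<and> u x x = (1::real) \<and> (\<forall>y. 0 \<le> u x y)" ..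
  from bchoice[OF this] obtain L where
    "\<forall>x\<in>K. smooth (u x) \<and> compact (L x) \<and> L x \<subseteq> W \<and> {y. u x y \<noteq> 0} \<subseteq> L x \<and> u x x = (1::real) \<and> (\<forall>y. 0 \<le> u x y)" ..
  then have u: "smooth (u x)" "compact (L x)" "L x \<subseteq> W" "{y. u x y \<noteq> 0} \<subseteq> L x" "u x x = 1"
    "0 \<le> u x y" if "x \<in> K" for x y using that by auto
  have cont: "continuous_on UNIV (u x)" if "x \<in> K" for x
    using u(1)[OF that] Ck_map_continuous[of 0 "u x"] by (simp add: smooth_def)
  have "open {y. u x y > 1 / 2}" if "x \<in> K" for x
    using cont[OF that] by (intro open_Collect_less) auto
  then obtain C where C: "C \<subseteq> K" "finite C" "K \<subseteq> (\<Union>x\<in>C. {y. u x y > 1 / 2})"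
    using compactE_image[OF K, of K "\<lambda>x. {y. u x y > 1 / 2}"] u(5) by force
  define B where "B y = (\<Sum>x\<in>C. 2 * u x y)" for y
  have B0: "0 \<le> B y" for y unfolding B_def using u(6) C(1) by (intro sum_nonneg) auto
  have B: "smooth B" unfolding smooth_def B_def
    using u(1) C(1) by (auto intro!: Ck_map_sum Ck_map_linear[OF bounded_linear_mult_right] simp: smooth_def)
  have "smooth (\<lambda>y. 1 - bump (B y))" unfolding smooth_def
    using B by (auto intro!: Ck_map_diff Ck_map_const Ck_map_compose_real[OF _ Ck_on_bump_power] simp: smooth_def)
  moreover have "compact (\<Union>x\<in>C. L x)" using C u(2) by blast
  moreover have "(\<Union>x\<in>C. L x) \<subseteq> W" using C u(3) by blast
  moreover have "{y. 1 - bump (B y) \<noteq> 0} \<subseteq> (\<Union>x\<in>C. L x)"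
  proof
    fix y assume "y \<in> {y. 1 - bump (B y) \<noteq> 0}"
    then have "B y \<noteq> 0" using bump_props(1) by auto
    then obtain x where x: "x \<in> C" "2 * u x y \<noteq> 0" unfolding B_def by (rule sum.not_neutral_contains_not_neutral)
    then have "y \<in> L x" using u(4)[of x] C(1) by auto
    then show "y \<in> (\<Union>x\<in>C. L x)" using x by blast
  qed
  moreover have "open (\<Union>x\<in>C. {y. u x y > 1 / 2})"
    using \<open>\<And>x. x \<in> K \<Longrightarrow> open {y. u x y > 1 / 2}\<close> C(1) by blast
  moreover have "1 - bump (B y) = 1" if y: "y \<in> (\<Union>x\<in>C. {y. u x y > 1 / 2})" for y
  proof -
    obtain x where x: "x \<in> C" "u x y > 1 / 2" using y by blast
    have "2 * u x y \<le> B y" unfolding B_def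
      using x C u(6) by (intro member_le_sum) auto
    then show ?thesis using x by (simp add: bump_props)
  qed
  ultimately show ?thesis
    using that[of "\<lambda>y. 1 - bump (B y)" "\<Union>x\<in>C. L x" "\<Union>x\<in>C. {y. u x y > 1 / 2}"] C(3)
      bump_props(2) bump_props(5)[OF B0] by simp
qed

section \<open>Second-order expansion at the identity\<close>

abbreviation loc :: "('g \<Rightarrow> 'b) \<Rightarrow> 'e \<Rightarrow> 'b" where
  "loc f \<equiv> f \<circ> chart_inv U0 \<phi>0"

abbreviation ff :: "nat \<Rightarrow> 'e \<Rightarrow> 'e" where
  "ff \<equiv> frame_field U0 \<phi>0"

lemma linear_dird: "f differentiable (at q) \<Longrightarrow> linear (\<lambda>w. dird w f q)"
  by (metis frechet_derivative_works has_derivative_linear)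

lemma frame_sum: "(\<Sum>i<d. l i w *\<^sub>R b i) = w"
  using frame by (simp add: finite_frame_def)

lemma bl_l: "i < d \<Longrightarrow> bounded_linear (l i)"
  using frame by (simp add: finite_frame_def)

lemma linear_frame_expand:
  fixes D :: "'e \<Rightarrow> 'c::real_vector"
  assumes "linear D"
  shows "D w = (\<Sum>i<d. l i w *\<^sub>R D (b i))"
proof -
  have "D (\<Sum>i<d. l i w *\<^sub>R b i) = (\<Sum>i<d. l i w *\<^sub>R D (b i))"
    using assms by (simp add: linear_sum linear_scale)
  then show ?thesis by (simp add: frame_sum)
qed

lemma open_U0: "open (\<phi>0 ` U0)" and p0_in: "\<phi>0 0 \<in> \<phi>0 ` U0"
  using chart_image_open chart0 by auto

text \<open>In the first summand both directions are frozen at \<open>q\<close>, so it is a pure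
  second derivative and symmetric in \<open>i\<close> and \<open>j\<close>. The second summand comes
  from differentiating the coefficients of the field \<open>ff j\<close> and involves only first
  derivatives of \<open>f\<close>.\<close>

lemma X_X_chart:
  assumes f: "Ck_map 2 f" and q: "q \<in> \<phi>0 ` U0" and ij: "i < d" "j < d"
  shows "X i (X j f) (chart_inv U0 \<phi>0 q) =
     dird (ff i q) (dird (ff j q) (loc f)) q + dird (dird (ff i q) (ff j) q) (loc f) q"
proof -
  let ?F = "loc f" and ?w = "ff i q"
  have f2: "Ck_map (Suc (Suc 0)) f" using f by (simp add: numeral_2_eq_2)
  have F: "Ck_on (Suc (Suc 0)) (\<phi>0 ` U0) ?F" using Ck_mapD[OF f2 chart0(1)] .
  have diff: "?F differentiable (at p)" "dird v ?F differentiable (at p)" if "p \<in> \<phi>0 ` U0" for p v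
    using F that by auto
  let ?G = "\<lambda>p. \<Sum>k<d. l k (ff j p) *\<^sub>R dird (b k) ?F p"
  have G: "(X j f \<circ> chart_inv U0 \<phi>0) p = ?G p" if "p \<in> \<phi>0 ` U0" for p
    using X_chart[OF ij(2) chart0(1) that f2] linear_frame_expand[OF linear_dird[OF diff(1)[OF that]], of "ff j p"] by simp
  have a: "ff j differentiable (at q)"
    using Ck_on_frame_field[OF chart0(1), of "Suc 0" j] q by auto
  have "(?G has_derivative (\<lambda>w. \<Sum>k<d. l k (ff j q) *\<^sub>R dird w (dird (b k) ?F) q + l k (dird w (ff j) q) *\<^sub>R dird (b k) ?F q)) (at q)"
  proof (rule has_derivative_sum)
    fix k assume k: "k \<in> {..<d}"
    have "((\<lambda>p. l k (ff j p)) has_derivative (\<lambda>w. l k (dird w (ff j) q))) (at q)"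
      using a bounded_linear.has_derivative[OF bl_l] k by (simp add: frechet_derivative_works)
    moreover have "(dird (b k) ?F has_derivative (\<lambda>w. dird w (dird (b k) ?F) q)) (at q)"
      using diff(2)[OF q] by (simp add: frechet_derivative_works)
    ultimately show "((\<lambda>p. l k (ff j p) *\<^sub>R dird (b k) ?F p) has_derivative
        (\<lambda>w. l k (ff j q) *\<^sub>R dird w (dird (b k) ?F) q + l k (dird w (ff j) q) *\<^sub>R dird (b k) ?F q)) (at q)"
      by (rule bounded_bilinear.FDERIV[OF bounded_bilinear_scaleR])
  qed
  then have "((X j f \<circ> chart_inv U0 \<phi>0) has_derivative (\<lambda>w. \<Sum>k<d. l k (ff j q) *\<^sub>R dird w (dird (b k) ?F) q + l k (dird w (ff j) q) *\<^sub>R dird (b k) ?F q)) (at q)"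
    by (rule has_derivative_transform_within_open[OF _ open_U0 q]) (simp only: G)
  then have 1: "dird ?w (X j f \<circ> chart_inv U0 \<phi>0) q =
      (\<Sum>k<d. l k (ff j q) *\<^sub>R dird ?w (dird (b k) ?F) q) + (\<Sum>k<d. l k (dird ?w (ff j) q) *\<^sub>R dird (b k) ?F q)"
    by (simp add: frechet_derivative_at[symmetric] sum.distrib)
  have sym: "dird ?w (dird v ?F) q = dird v (dird ?w ?F) q" for v
    using second_derivative_symmetric[of "\<phi>0 ` U0" ?F q v ?w] F open_U0 q by (simp add: numeral_2_eq_2)
  have 2: "(\<Sum>k<d. l k (ff j q) *\<^sub>R dird ?w (dird (b k) ?F) q) = dird ?w (dird (ff j q) ?F) q"
    unfolding sym using linear_frame_expand[OF linear_dird[OF diff(2)[OF q]], of ?w "ff j q"] by simp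
  have 3: "(\<Sum>k<d. l k (dird ?w (ff j) q) *\<^sub>R dird (b k) ?F q) = dird (dird ?w (ff j) q) ?F q"
    using linear_frame_expand[OF linear_dird[OF diff(1)[OF q]], of "dird ?w (ff j) q"] by simp
  have "X i (X j f) (chart_inv U0 \<phi>0 q) = dird ?w (X j f \<circ> chart_inv U0 \<phi>0) q"
    using X_chart[OF ij(1) chart0(1) q Ck_map_X[OF ij(2) f2]] .
  then show ?thesis by (simp add: 1 2 3)
qed

text \<open>The largest of the values \<open>norm (D (b i))\<close> is absorbed into the left-hand side, so that the matrix
  relating the frames \<open>a\<close> and \<open>b\<close> need not be inverted.\<close>

lemma perturbed_frame_bound:
  fixes D :: "'e \<Rightarrow> complex"
  assumes D: "linear D" and a: "\<And>i. i < d \<Longrightarrow> norm (D (a i)) \<le> M"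
    and small: "\<And>i. i < d \<Longrightarrow> (\<Sum>k<d. \<bar>l k (b i - a i)\<bar>) \<le> 1 / 4" and i: "i < d"
  shows "norm (D (b i)) \<le> 2 * M"
proof -
  define m where "m = Max ((\<lambda>i. norm (D (b i))) ` {..<d})"
  have m: "norm (D (b k)) \<le> m" if "k < d" for k unfolding m_def using that by (intro Max_ge) auto
  have m0: "0 \<le> m" using m[OF i] norm_ge_zero order_trans by blast
  have "norm (D (b k)) \<le> M + m / 4" if k: "k < d" for k
  proof -
    have "norm (D (b k)) = norm (D (a k) + D (b k - a k))" using D by (simp add: linear_diff)
    also have "\<dots> \<le> M + norm (D (b k - a k))" using a[OF k] norm_triangle_ineq order_trans
      by (metis add_right_mono)
    also have "norm (D (b k - a k)) \<le> (\<Sum>n<d. \<bar>l n (b k - a k)\<bar> * m)"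
      unfolding linear_frame_expand[OF D, of "b k - a k"]
      by (rule sum_norm_le) (use m in \<open>auto intro: mult_left_mono\<close>)
    also have "\<dots> = (\<Sum>n<d. \<bar>l n (b k - a k)\<bar>) * m" by (simp add: sum_distrib_right)
    also have "\<dots> \<le> (1 / 4) * m" using small[OF k] m0 by (intro mult_right_mono) auto
    finally show ?thesis by simp
  qed
  \<comment> \<open>This gives m \<le> 4 M / 3, which is below the claimed 2 M.\<close>
  then have "m \<le> M + m / 4" unfolding m_def by (subst Max_le_iff) (use i in auto)
  then show ?thesis using m[OF i] m0 by linarith
qed

text \<open>The products \<open>X j (X k f)\<close> are restricted to j \<le> k because X^\<alpha>
  takes the fields in the order of their indices. A real bound \<open>M\<close> replaces the
  extended-real norm, to which \<open>Cnorm_le_iff\<close> relates it.\<close>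

definition C2_bound :: "('g \<Rightarrow> complex) \<Rightarrow> real \<Rightarrow> bool" where
  "C2_bound f M \<longleftrightarrow> (\<forall>x. norm (f x) \<le> M) \<and> (\<forall>j<d. \<forall>x. norm (X j f x) \<le> M) \<and>
     (\<forall>j k. j \<le> k \<longrightarrow> k < d \<longrightarrow> (\<forall>x. norm (X j (X k f) x) \<le> M))"

text \<open>At the identity the fields take exactly the values \<open>b i\<close>, so by continuity
  they stay close to them on a small ball. The threshold 1/4 is the one of
  \<open>perturbed_frame_bound\<close>; \<open>B\<close> bounds the coefficients of the first-order
  term in \<open>X_X_chart\<close>.\<close>

lemma eventually_frame_near:
  "\<exists>r B. 0 < r \<and> 0 \<le> B \<and> cball (\<phi>0 0) r \<subseteq> \<phi>0 ` U0 \<and>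
    (\<forall>q\<in>cball (\<phi>0 0) r. (\<forall>i<d. (\<Sum>k<d. \<bar>l k (b i - ff i q)\<bar>) \<le> 1 / 4) \<and>
      (\<forall>i<d. \<forall>j<d. (\<Sum>k<d. \<bar>l k (dird (ff i q) (ff j) q)\<bar>) \<le> B))"
proof -
  let ?p = "\<phi>0 0"
  have isCont_Ck: "isCont h ?p" if "Ck_on k (\<phi>0 ` U0) h" for k and h :: "'e \<Rightarrow> 'e"
    using Ck_on_imp_continuous_on[OF that] open_U0 p0_in continuous_on_eq_continuous_at by blast
  have cff: "isCont (ff i) ?p" for i
    using isCont_Ck[OF Ck_on_frame_field[OF chart0(1), of 0 i]] .
  have cl: "isCont (\<lambda>q. l k (h q)) ?p" if "k < d" "isCont h ?p" for k h
    using bounded_linear.continuous[OF bl_l[OF that(1)] that(2)] .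
  have cd: "isCont (\<lambda>q. dird (ff i q) (ff j) q) ?p" if "j < d" for i j
  proof -
    have C1: "Ck_on (Suc 0) (\<phi>0 ` U0) (ff j)" using Ck_on_frame_field[OF chart0(1)] .
    have "isCont (\<lambda>q. \<Sum>k<d. l k (ff i q) *\<^sub>R dird (b k) (ff j) q) ?p"
    proof (intro continuous_sum continuous_scaleR)
      fix k assume "k \<in> {..<d}"
      then show "isCont (\<lambda>q. l k (ff i q)) ?p" using cl cff by simp
      show "isCont (dird (b k) (ff j)) ?p"
        by (rule isCont_Ck[of 0]) (use C1 in simp)
    qed
    moreover have "\<forall>\<^sub>F q in nhds ?p. (\<Sum>k<d. l k (ff i q) *\<^sub>R dird (b k) (ff j) q) = dird (ff i q) (ff j) q"
      using eventually_nhds_in_open[OF open_U0 p0_in]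
    proof eventually_elim
      case (elim q)
      then have "ff j differentiable (at q)" using C1 by auto
      from linear_frame_expand[OF linear_dird[OF this], of "ff i q"] show ?case by simp
    qed
    ultimately show ?thesis using isCont_cong by force
  qed
  define c where "c i j q = (\<Sum>k<d. \<bar>l k (dird (ff i q) (ff j) q)\<bar>)" for i j q
  define B where "B = (\<Sum>i<d. \<Sum>j<d. c i j ?p + 1)"
  have c0: "0 \<le> c i j q" for i j q unfolding c_def by (intro sum_nonneg) auto
  have cB: "c i j ?p < B + 1" if "i < d" "j < d" for i j
  proof -
    have "c i j ?p + 1 \<le> (\<Sum>j<d. c i j ?p + 1)"
      using that c0 by (intro member_le_sum) (auto intro: add_nonneg_nonneg)
    also have "\<dots> \<le> B" unfolding B_def
      using that c0 by (intro member_le_sum) (auto intro!: sum_nonneg add_nonneg_nonneg)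
    finally show ?thesis by simp
  qed
  have "isCont (c i j) ?p" if "j < d" for i j
    unfolding c_def[abs_def] by (intro continuous_sum continuous_rabs cl cd that) auto
  then have "\<forall>\<^sub>F q in at ?p. c i j q < B + 1" if "i < d" "j < d" for i j
    using order_tendstoD(2)[OF _ cB[OF that]] that unfolding isCont_def by blast
  then have "\<forall>\<^sub>F q in at ?p. \<forall>i\<in>{..<d}. \<forall>j\<in>{..<d}. c i j q < B + 1"
    by (intro eventually_ball_finite ballI) auto
  moreover have "\<forall>\<^sub>F q in at ?p. (\<Sum>k<d. \<bar>l k (b i - ff i q)\<bar>) < 1 / 4" if "i < d" for i
  proof -
    have "isCont (\<lambda>q. \<Sum>k<d. \<bar>l k (b i - ff i q)\<bar>) ?p"
      by (intro continuous_sum continuous_rabs cl continuous_diff cff continuous_const) auto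
    moreover have "(\<Sum>k<d. \<bar>l k (b i - ff i ?p)\<bar>) = 0"
      by (simp add: frame_field_origin linear_0[OF bounded_linear.linear[OF bl_l]])
    ultimately have "((\<lambda>q. \<Sum>k<d. \<bar>l k (b i - ff i q)\<bar>) \<longlongrightarrow> 0) (at ?p)" by (simp add: isCont_def)
    then show ?thesis by (rule order_tendstoD) simp
  qed
  then have "\<forall>\<^sub>F q in at ?p. \<forall>i\<in>{..<d}. (\<Sum>k<d. \<bar>l k (b i - ff i q)\<bar>) < 1 / 4"
    by (intro eventually_ball_finite ballI) auto
  moreover have "\<forall>\<^sub>F q in at ?p. q \<in> \<phi>0 ` U0"
    unfolding eventually_at_filter
    by (rule eventually_mono[OF eventually_nhds_in_open[OF open_U0 p0_in]]) simp
  ultimately have "\<forall>\<^sub>F q in at ?p. q \<in> \<phi>0 ` U0 \<and> (\<forall>i<d. (\<Sum>k<d. \<bar>l k (b i - ff i q)\<bar>) \<le> 1 / 4) \<and>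
     (\<forall>i<d. \<forall>j<d. c i j q \<le> B + 1)"
    by eventually_elim (auto intro: less_imp_le)
  then obtain s where s: "s > 0" and "\<And>q. q \<noteq> ?p \<Longrightarrow> dist q ?p < s \<Longrightarrow> q \<in> \<phi>0 ` U0 \<and> (\<forall>i<d. (\<Sum>k<d. \<bar>l k (b i - ff i q)\<bar>) \<le> 1 / 4) \<and>
     (\<forall>i<d. \<forall>j<d. c i j q \<le> B + 1)"
    unfolding eventually_at by auto
  moreover have "?p \<in> \<phi>0 ` U0 \<and> (\<forall>i<d. (\<Sum>k<d. \<bar>l k (b i - ff i ?p)\<bar>) \<le> 1 / 4) \<and> (\<forall>i<d. \<forall>j<d. c i j ?p \<le> B + 1)"
    using p0_in cB by (auto simp: frame_field_origin linear_0[OF bounded_linear.linear[OF bl_l]] intro: less_imp_le)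
  ultimately have *: "q \<in> \<phi>0 ` U0 \<and> (\<forall>i<d. (\<Sum>k<d. \<bar>l k (b i - ff i q)\<bar>) \<le> 1 / 4) \<and>
     (\<forall>i<d. \<forall>j<d. c i j q \<le> B + 1)" if "dist q ?p < s" for q
    using that by (cases "q = ?p") auto
  have "0 \<le> B" unfolding B_def using c0 by (intro sum_nonneg add_nonneg_nonneg) auto
  then show ?thesis
    using s * unfolding c_def
    by (intro exI[of _ "s / 2"] exI[of _ "B + 1"]) (auto simp: dist_commute)
qed

section \<open>Taylor's formula at the identity in terms of the fields\<close>

definition lnorm :: real where "lnorm = (\<Sum>i<d. onorm (l i))"

lemma sum_l_le: "(\<Sum>i<d. \<bar>l i v\<bar>) \<le> lnorm * norm v"
  unfolding lnorm_def sum_distrib_right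
  by (intro sum_mono) (metis bl_l lessThan_iff onorm real_norm_def)

lemma lnorm_nonneg: "0 \<le> lnorm"
  unfolding lnorm_def by (intro sum_nonneg onorm_pos_le bl_l) auto

lemma taylor_chart_bound:
  assumes f: "Ck_map 2 f" and v: "cball (\<phi>0 0) (norm v) \<subseteq> \<phi>0 ` U0"
    and Q: "\<And>q i j. q \<in> cball (\<phi>0 0) (norm v) \<Longrightarrow> i < d \<Longrightarrow> j < d \<Longrightarrow> norm (dird (b i) (dird (b j) (loc f)) q) \<le> M"
    and M0: "0 \<le> M"
  shows "norm (loc f (\<phi>0 0 + v) - f 0 - (\<Sum>j<d. l j v *\<^sub>R X j f 0)) \<le> M * (lnorm * norm v)\<^sup>2"
proof -
  let ?F = "loc f"
  have f2: "Ck_map (Suc (Suc 0)) f" using f by (simp add: numeral_2_eq_2)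
  have F: "Ck_on (Suc (Suc 0)) (\<phi>0 ` U0) ?F" using Ck_mapD[OF f2 chart0(1)] .
  have diff: "?F differentiable (at p)" "dird w ?F differentiable (at p)" if "p \<in> \<phi>0 ` U0" for p w
    using F that by auto
  have seg: "\<phi>0 0 + t *\<^sub>R v \<in> cball (\<phi>0 0) (norm v)" if "0 \<le> t" "t \<le> 1" for t
    using that by (simp add: dist_norm mult_left_le_one_le)
  have bound: "norm (dird v (dird v ?F) q) \<le> M * (lnorm * norm v)\<^sup>2" if q: "q \<in> cball (\<phi>0 0) (norm v)" for q
  proof -
    have qU: "q \<in> \<phi>0 ` U0" using q v by auto
    have sym: "dird w (dird u ?F) q = dird u (dird w ?F) q" for u w
      using second_derivative_symmetric[of "\<phi>0 ` U0" ?F q u w] F open_U0 qU by (simp add: numeral_2_eq_2)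
    have 1: "norm (dird v (dird (b j) ?F) q) \<le> M * (lnorm * norm v)" if j: "j < d" for j
    proof -
      have "norm (dird v (dird (b j) ?F) q) \<le> (\<Sum>i<d. \<bar>l i v\<bar> * M)"
        unfolding linear_frame_expand[OF linear_dird[OF diff(2)[OF qU]], of "b j" v]
        by (rule sum_norm_le) (use Q[OF q _ j] in \<open>auto intro: mult_left_mono\<close>)
      also have "\<dots> \<le> (lnorm * norm v) * M"
        unfolding sum_distrib_right[symmetric] by (intro mult_right_mono sum_l_le M0)
      finally show ?thesis by (simp add: mult.commute)
    qed
    have "dird v (dird v ?F) q = (\<Sum>j<d. l j v *\<^sub>R dird v (dird (b j) ?F) q)"
      using linear_frame_expand[OF linear_dird[OF diff(2)[OF qU]], of v v] by (simp add: sym[of "b _" v])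
    then have "norm (dird v (dird v ?F) q) \<le> (\<Sum>j<d. \<bar>l j v\<bar> * (M * (lnorm * norm v)))"
      using 1 by (auto intro!: sum_norm_le mult_left_mono)
    also have "\<dots> \<le> (lnorm * norm v) * (M * (lnorm * norm v))"
      unfolding sum_distrib_right[symmetric]
      by (intro mult_right_mono sum_l_le mult_nonneg_nonneg M0 lnorm_nonneg norm_ge_zero)
    finally show ?thesis by (simp add: power2_eq_square mult_ac)
  qed
  have "norm (?F (\<phi>0 0 + v) - ?F (\<phi>0 0) - dird v ?F (\<phi>0 0)) \<le> M * (lnorm * norm v)\<^sup>2"
  proof (rule taylor_bound[OF Ck_mapD[OF f chart0(1)]])
    fix t :: real assume "0 \<le> t" "t \<le> 1"
    note seg[OF this]
    then show "\<phi>0 0 + t *\<^sub>R v \<in> \<phi>0 ` U0" "norm (dird v (dird v ?F) (\<phi>0 0 + t *\<^sub>R v)) \<le> M * (lnorm * norm v)\<^sup>2"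
      using v bound by blast+
  qed
  moreover have "dird v ?F (\<phi>0 0) = (\<Sum>j<d. l j v *\<^sub>R X j f 0)"
    using linear_frame_expand[OF linear_dird[OF diff(1)[OF p0_in]], of v] X_origin[OF _ f2] by simp
  ultimately show ?thesis by (simp add: chart_inv_origin)
qed

text \<open>\<^term>\<open>C2_bound\<close> controls \<open>X\<^sub>j X\<^sub>k f\<close> only for \<open>j \<le> k\<close>. For \<open>j > k\<close> symmetry of the second derivative
  in the chart is used; the commutator contributes a first-order term.\<close>

lemma C2_bound_taylor:
  "\<exists>r C. 0 < r \<and> 0 \<le> C \<and> cball (\<phi>0 0) r \<subseteq> \<phi>0 ` U0 \<and>
    (\<forall>f M v. Ck_map 2 f \<longrightarrow> C2_bound f M \<longrightarrow> norm v \<le> r \<longrightarrow>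
       norm (loc f (\<phi>0 0 + v) - f 0 - (\<Sum>j<d. l j v *\<^sub>R X j f 0)) \<le> C * M * (norm v)\<^sup>2)"
proof -
  obtain r B where r: "0 < r" "0 \<le> B" "cball (\<phi>0 0) r \<subseteq> \<phi>0 ` U0"
    and small: "\<And>q i. q \<in> cball (\<phi>0 0) r \<Longrightarrow> i < d \<Longrightarrow> (\<Sum>k<d. \<bar>l k (b i - ff i q)\<bar>) \<le> 1 / 4"
    and B: "\<And>q i j. q \<in> cball (\<phi>0 0) r \<Longrightarrow> i < d \<Longrightarrow> j < d \<Longrightarrow> (\<Sum>k<d. \<bar>l k (dird (ff i q) (ff j) q)\<bar>) \<le> B"
    using eventually_frame_near by metis
  \<comment> \<open>Along the fields the second derivatives are at most
    \<open>M + B * (2 * M)\<close>; replacing each of the two field directions by a basis direction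
    through \<open>perturbed_frame_bound\<close> costs a factor 2.\<close>
  define C where "C = 2 * (2 * (1 + B * 2))"
  have C0: "0 \<le> C" using r by (simp add: C_def)
  have main: "norm (loc f (\<phi>0 0 + v) - f 0 - (\<Sum>j<d. l j v *\<^sub>R X j f 0)) \<le> C * M * (lnorm * norm v)\<^sup>2"
    if f: "Ck_map 2 f" and bd: "C2_bound f M" and v: "norm v \<le> r" for f M v
  proof (rule taylor_chart_bound[OF f])
    let ?F = "loc f"
    have M0: "0 \<le> M" using bd norm_ge_zero[of "f 0"] order_trans unfolding C2_bound_def by blast
    then show "0 \<le> C * M" using C0 by simp
    show "cball (\<phi>0 0) (norm v) \<subseteq> \<phi>0 ` U0" using r v by auto
    fix q i j assume "q \<in> cball (\<phi>0 0) (norm v)" and ij: "i < d" "j < d"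
    then have q: "q \<in> cball (\<phi>0 0) r" using v by auto
    have qU: "q \<in> \<phi>0 ` U0" using q r by auto
    have f2: "Ck_map (Suc (Suc 0)) f" using f by (simp add: numeral_2_eq_2)
    have F: "Ck_on (Suc (Suc 0)) (\<phi>0 ` U0) ?F" using Ck_mapD[OF f2 chart0(1)] .
    have diff: "?F differentiable (at q)" "dird w ?F differentiable (at q)" for w
      using F qU by auto
    have sym: "dird w (dird u ?F) q = dird u (dird w ?F) q" for u w
      using second_derivative_symmetric[of "\<phi>0 ` U0" ?F q u w] F open_U0 qU by (simp add: numeral_2_eq_2)
    have 1: "norm (dird (b i) ?F q) \<le> 2 * M" if "i < d" for i
    proof (rule perturbed_frame_bound[OF linear_dird[OF diff(1)] _ small[OF q] that])
      show "norm (dird (ff i q) ?F q) \<le> M" if "i < d" for i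
        using bd that X_chart[OF that chart0(1) qU f2] unfolding C2_bound_def by metis
    qed
    have 2: "norm (dird (dird (ff i q) (ff j) q) ?F q) \<le> B * (2 * M)" if "i < d" "j < d" for i j
    proof -
      have "norm (dird (dird (ff i q) (ff j) q) ?F q) \<le> (\<Sum>k<d. \<bar>l k (dird (ff i q) (ff j) q)\<bar> * (2 * M))"
        unfolding linear_frame_expand[OF linear_dird[OF diff(1)], of "dird (ff i q) (ff j) q"]
        by (rule sum_norm_le) (use 1 in \<open>auto intro: mult_left_mono\<close>)
      also have "\<dots> \<le> B * (2 * M)"
        unfolding sum_distrib_right[symmetric] by (intro mult_right_mono B[OF q that]) (use M0 in auto)
      finally show ?thesis .
    qed
    have 3: "norm (dird (ff i q) (dird (ff j q) ?F) q) \<le> M + B * (2 * M)" if "i \<le> j" "j < d" for i j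
    proof -
      have "i < d" using that by simp
      have "norm (X i (X j f) (chart_inv U0 \<phi>0 q)) \<le> M" using bd that unfolding C2_bound_def by blast
      then show ?thesis
        using X_X_chart[OF f qU \<open>i < d\<close> \<open>j < d\<close>] 2[OF \<open>i < d\<close> \<open>j < d\<close>]
          norm_triangle_ineq4[of "X i (X j f) (chart_inv U0 \<phi>0 q)" "dird (dird (ff i q) (ff j) q) ?F q"]
        by simp
    qed
    have 4: "norm (dird (ff i q) (dird (ff j q) ?F) q) \<le> M + B * (2 * M)" if "i < d" "j < d" for i j
      using 3[of i j] 3[of j i] sym[of "ff i q" "ff j q"] that by (cases "i \<le> j") auto
    have 5: "norm (dird (b i) (dird (ff j q) ?F) q) \<le> 2 * (M + B * (2 * M))" if "i < d" "j < d" for i j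
      by (rule perturbed_frame_bound[OF linear_dird[OF diff(2)] 4[OF _ that(2)] small[OF q] that(1)])
    have "norm (dird (b j) (dird (b i) ?F) q) \<le> 2 * (2 * (M + B * (2 * M)))"
      by (rule perturbed_frame_bound[OF linear_dird[OF diff(2)] _ small[OF q] ij(2)])
         (use 5[OF ij(1)] sym in auto)
    then show "norm (dird (b i) (dird (b j) ?F) q) \<le> C * M"
      using sym[of "b i" "b j"] by (simp add: C_def algebra_simps)
  qed
  have eq: "C * M * (lnorm * norm v)\<^sup>2 = (C * lnorm\<^sup>2) * M * (norm v)\<^sup>2" for M and v :: 'e
    by (simp add: power_mult_distrib)
  show ?thesis
    by (rule exI[of _ r], rule exI[of _ "C * lnorm\<^sup>2"]) (use main[unfolded eq] r C0 in auto)
qed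

section \<open>Test functions\<close>

definition csupp :: "('g \<Rightarrow> 'b::zero) \<Rightarrow> bool" where
  "csupp f \<longleftrightarrow> (\<exists>L. compact L \<and> {y. f y \<noteq> 0} \<subseteq> L)"

lemma csuppI: "compact L \<Longrightarrow> {y. f y \<noteq> 0} \<subseteq> L \<Longrightarrow> csupp f"
  by (auto simp: csupp_def)

lemma csupp_imp: "csupp f \<Longrightarrow> (\<And>x. f x = 0 \<Longrightarrow> g x = 0) \<Longrightarrow> csupp g"
  unfolding csupp_def by blast

lemma csupp_bounded:
  assumes "csupp f" "continuous_on UNIV f"
  shows "\<exists>B\<ge>0. \<forall>x. norm (f x :: 'b::real_normed_vector) \<le> B"
proof -
  obtain L where L: "compact L" "{y. f y \<noteq> 0} \<subseteq> L" using assms(1) by (auto simp: csupp_def)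
  have "bounded (f ` L)"
    by (intro compact_imp_bounded compact_continuous_image continuous_on_subset[OF assms(2)] L(1)) auto
  then obtain B where B: "\<And>x. x \<in> L \<Longrightarrow> norm (f x) \<le> B" by (auto simp: bounded_iff)
  have "norm (f x) \<le> max B 0" for x proof (cases "x \<in> L")
    case False
    then have "f x = 0" using L(2) by blast
    then show ?thesis by simp
  qed (use B[of x] in auto)
  then show ?thesis by (intro exI[of _ "max B 0"]) auto
qed

lemma Cc_smooth_eq: "Cc_smooth A = {f. smooth f \<and> csupp f}"
proof -
  have "compact (fsupport f) \<longleftrightarrow> csupp f" for f :: "'g \<Rightarrow> complex"
  proof
    assume "compact (fsupport f)"
    then show "csupp f" by (rule csuppI) (simp add: fsupport_def closure_subset)
  next
    assume "csupp f"
    then obtain L where L: "compact L" "{y. f y \<noteq> 0} \<subseteq> L" by (auto simp: csupp_def)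
    then have "fsupport f \<subseteq> L" unfolding fsupport_def by (intro closure_minimal compact_imp_closed)
    then show "compact (fsupport f)"
      using L(1) by (metis compact_Int_closed closed_closure fsupport_def inf.absorb_iff2)
  qed
  then show ?thesis by (auto simp: Cc_smooth_def Ck_eq smooth_def)
qed

lemma chart_nhd:
  assumes "open N" "0 \<in> N"
  obtains \<rho> where "0 < \<rho>" "\<And>y. y \<in> U0 \<Longrightarrow> norm (\<phi>0 y - \<phi>0 0) \<le> \<rho> \<Longrightarrow> y \<in> N"
proof -
  have "open (\<phi>0 ` (N \<inter> U0))"
    using assms chart_open[OF chart0(1)] by (intro open_chart_image[OF chart0(1)]) auto
  moreover have "\<phi>0 0 \<in> \<phi>0 ` (N \<inter> U0)" using assms chart0 by auto
  ultimately obtain \<rho> where \<rho>: "0 < \<rho>" "cball (\<phi>0 0) \<rho> \<subseteq> \<phi>0 ` (N \<inter> U0)"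
    using open_contains_cball by blast
  have "y \<in> N" if y: "y \<in> U0" "norm (\<phi>0 y - \<phi>0 0) \<le> \<rho>" for y
  proof -
    have "\<phi>0 y \<in> \<phi>0 ` (N \<inter> U0)" using \<rho>(2) y(2) by (auto simp: dist_norm norm_minus_commute)
    then obtain z where z: "z \<in> N \<inter> U0" "\<phi>0 y = \<phi>0 z" by blast
    then have "y = z" using chart_inv_f[OF chart0(1)] y(1) by (metis IntD2)
    then show ?thesis using z by simp
  qed
  then show ?thesis using that \<rho>(1) by blast
qed

lemma nhd_chart_open:
  assumes "0 < \<rho>"
  shows "open {y \<in> U0. norm (\<phi>0 y - \<phi>0 0) < \<rho>}" "0 \<in> {y \<in> U0. norm (\<phi>0 y - \<phi>0 0) < \<rho>}"
proof -
  have "open {y \<in> U0. \<phi>0 y \<in> ball (\<phi>0 0) \<rho>}"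
    by (rule open_chart_preimage[OF chart0(1) open_ball])
  then show "open {y \<in> U0. norm (\<phi>0 y - \<phi>0 0) < \<rho>}" by (simp add: dist_norm norm_minus_commute)
qed (use assms chart0 in auto)

text \<open>\<open>\<xi> j\<close> are coordinates cut off near the identity; \<open>\<psi>\<close> is comparable to the squared distance from
  the identity and, off any neighbourhood of it, bounded below. The last two clauses are Taylor's formula
  with global remainder and with Peano remainder.\<close>

definition test_functions :: "(nat \<Rightarrow> 'g \<Rightarrow> real) \<Rightarrow> ('g \<Rightarrow> real) \<Rightarrow> real \<Rightarrow> bool" where
  "test_functions \<xi> \<psi> C \<longleftrightarrow>
     (\<forall>j<d. smooth (\<xi> j) \<and> csupp (\<xi> j) \<and> \<xi> j 0 = 0) \<and>
     smooth \<psi> \<and> csupp (\<lambda>x. 1 - \<psi> x) \<and> \<psi> 0 = 0 \<and> (\<forall>x. 0 \<le> \<psi> x \<and> \<psi> x \<le> 1) \<and>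
     (\<forall>N. open N \<and> 0 \<in> N \<longrightarrow> (\<exists>c>0. \<forall>x. x \<notin> N \<longrightarrow> c \<le> \<psi> x)) \<and> 0 \<le> C \<and>
     (\<forall>f M x. Ck_map 2 f \<longrightarrow> C2_bound f M \<longrightarrow> norm (f x - f 0 - (\<Sum>j<d. \<xi> j x *\<^sub>R X j f 0)) \<le> C * M * \<psi> x) \<and>
     (\<forall>(h :: 'g \<Rightarrow> complex) e. Ck_map 2 h \<and> h 0 = 0 \<and> (\<forall>i<d. dird (b i) (loc h) (\<phi>0 0) = 0) \<and>
        (\<forall>i<d. \<forall>j<d. dird (b i) (dird (b j) (loc h)) (\<phi>0 0) = 0) \<and> 0 < e \<longrightarrow>
        (\<exists>N. open N \<and> 0 \<in> N \<and> (\<forall>x\<in>N. norm (h x) \<le> e * \<psi> x)))"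

text \<open>The second derivatives vanish at the identity and are continuous, hence at most
  \<open>e\<close> on a small ball, where \<open>taylor_chart_bound\<close> applies; the terms of
  order zero and one vanish.\<close>

lemma peano_bound:
  fixes h :: "'g \<Rightarrow> complex"
  assumes h: "Ck_map 2 h" "h 0 = 0" and D: "\<And>i. i < d \<Longrightarrow> dird (b i) (loc h) (\<phi>0 0) = 0"
    and D2: "\<And>i j. i < d \<Longrightarrow> j < d \<Longrightarrow> dird (b i) (dird (b j) (loc h)) (\<phi>0 0) = 0" and e: "0 < e"
  shows "\<exists>\<rho>>0. \<forall>v. norm v < \<rho> \<longrightarrow> norm (loc h (\<phi>0 0 + v)) \<le> e * (lnorm * norm v)\<^sup>2"
proof -
  let ?p = "\<phi>0 0"
  have h2: "Ck_map (Suc (Suc 0)) h" using h by (simp add: numeral_2_eq_2)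
  have F: "Ck_on (Suc (Suc 0)) (\<phi>0 ` U0) (loc h)" using Ck_mapD[OF h2 chart0(1)] .
  have "\<forall>\<^sub>F q in at ?p. norm (dird (b i) (dird (b j) (loc h)) q) < e" if "i < d" "j < d" for i j
  proof -
    have "isCont (dird (b i) (dird (b j) (loc h))) ?p"
      using F open_U0 p0_in by (auto simp: continuous_on_eq_continuous_at)
    then have "((\<lambda>q. norm (dird (b i) (dird (b j) (loc h)) q)) \<longlongrightarrow> 0) (at ?p)"
      using D2[OF that] by (intro tendsto_norm_zero) (simp add: isCont_def)
    then show ?thesis by (rule order_tendstoD) (rule e)
  qed
  then have "\<forall>\<^sub>F q in at ?p. \<forall>i\<in>{..<d}. \<forall>j\<in>{..<d}. norm (dird (b i) (dird (b j) (loc h)) q) < e"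
    by (intro eventually_ball_finite ballI) auto
  moreover have "\<forall>\<^sub>F q in at ?p. q \<in> \<phi>0 ` U0"
    unfolding eventually_at_filter
    by (rule eventually_mono[OF eventually_nhds_in_open[OF open_U0 p0_in]]) simp
  ultimately have "\<forall>\<^sub>F q in at ?p. q \<in> \<phi>0 ` U0 \<and> (\<forall>i\<in>{..<d}. \<forall>j\<in>{..<d}. norm (dird (b i) (dird (b j) (loc h)) q) < e)"
    by eventually_elim auto
  then obtain \<rho> where \<rho>: "\<rho> > 0" and *: "\<And>q. q \<noteq> ?p \<Longrightarrow> dist q ?p < \<rho> \<Longrightarrow> q \<in> \<phi>0 ` U0 \<and>
      (\<forall>i<d. \<forall>j<d. norm (dird (b i) (dird (b j) (loc h)) q) < e)"
    unfolding eventually_at by auto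
  have near: "q \<in> \<phi>0 ` U0 \<and> (\<forall>i<d. \<forall>j<d. norm (dird (b i) (dird (b j) (loc h)) q) \<le> e)" if "dist q ?p < \<rho>" for q
  proof (cases "q = ?p")
    case True then show ?thesis using D2 p0_in e by (auto intro: less_imp_le)
  next
    case False then show ?thesis using *[OF False that] by (auto intro: less_imp_le)
  qed
  have "norm (loc h (?p + v)) \<le> e * (lnorm * norm v)\<^sup>2" if v: "norm v < \<rho>" for v
  proof -
    have "norm (loc h (?p + v) - h 0 - (\<Sum>j<d. l j v *\<^sub>R X j h 0)) \<le> e * (lnorm * norm v)\<^sup>2"
    proof (rule taylor_chart_bound[OF h(1)])
      show "cball ?p (norm v) \<subseteq> \<phi>0 ` U0" using near v by (auto simp: dist_commute)
      show "norm (dird (b i) (dird (b j) (loc h)) q) \<le> e" if "q \<in> cball ?p (norm v)" "i < d" "j < d" for q i j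
        using near[of q] v that by (auto simp: dist_commute)
    qed (use e in simp)
    moreover have "X j h 0 = 0" if "j < d" for j using X_origin[OF that h2] D[OF that] by simp
    ultimately show ?thesis using h(2) by simp
  qed
  then show ?thesis using \<rho> by blast
qed

lemma Ck_on_linear_form: "i < d \<Longrightarrow> open S \<Longrightarrow> Ck_on k S (\<lambda>p. l i (p - c))"
proof -
  assume i: "i < d" and S: "open S"
  have "Ck_on k S (\<lambda>p. p + (- c))" by (rule Ck_on_add[OF S Ck_on_ident Ck_on_const])
  from Ck_on_linear[OF bl_l[OF i] S this] show ?thesis by simp
qed

lemma smooth_chart_product:
  fixes F :: "'e \<Rightarrow> 'b::real_normed_vector"
  assumes u: "smooth u" "compact L" "L \<subseteq> U0" "{y. u y \<noteq> 0} \<subseteq> L" and F: "\<And>k. Ck_on k (\<phi>0 ` U0) F"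
  shows "smooth (\<lambda>y. if y \<in> U0 then u y *\<^sub>R F (\<phi>0 y) else 0)" and "csupp (\<lambda>y. if y \<in> U0 then u y *\<^sub>R F (\<phi>0 y) else 0)"
proof -
  let ?F = "\<lambda>p. loc u p *\<^sub>R F p"
  have "Ck_on k (\<phi>0 ` U0) ?F" for k
    using Ck_on_bilinear[OF bounded_bilinear_scaleR open_U0 Ck_mapD[OF _ chart0(1)] F, of k u] u(1)
    by (simp add: smooth_def)
  from Ck_map_extend_zero[OF chart0(1) this u(2,3)]
  have "Ck_map k (\<lambda>y. if y \<in> U0 then ?F (\<phi>0 y) else 0)" for k
    using u(4) chart_inv_f[OF chart0(1)] by fastforce
  moreover have "(\<lambda>y. if y \<in> U0 then ?F (\<phi>0 y) else 0) = (\<lambda>y. if y \<in> U0 then u y *\<^sub>R F (\<phi>0 y) else 0)"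
    using chart_inv_f[OF chart0(1)] by auto
  ultimately show "smooth (\<lambda>y. if y \<in> U0 then u y *\<^sub>R F (\<phi>0 y) else 0)" by (simp add: smooth_def)
  show "csupp (\<lambda>y. if y \<in> U0 then u y *\<^sub>R F (\<phi>0 y) else 0)"
    by (rule csuppI[OF u(2)]) (use u(4) in auto)
qed

lemma C2_bound_nonneg: "C2_bound f M \<Longrightarrow> 0 \<le> M"
  unfolding C2_bound_def using norm_ge_zero[of "f 0"] order_trans by blast

lemma ex_test_functions: "\<exists>\<xi> \<psi> C. test_functions \<xi> \<psi> C"
proof -
  obtain r C where rC: "0 < r" "0 \<le> C" "cball (\<phi>0 0) r \<subseteq> \<phi>0 ` U0"
    and taylor: "\<And>f M v. Ck_map 2 f \<Longrightarrow> C2_bound f M \<Longrightarrow> norm v \<le> r \<Longrightarrow>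
       norm (loc f (\<phi>0 0 + v) - f 0 - (\<Sum>j<d. l j v *\<^sub>R X j f 0)) \<le> C * M * (norm v)\<^sup>2"
    using C2_bound_taylor by blast
  define \<eta> where "\<eta> = (\<lambda>y. if y \<in> U0 then bump ((norm (\<phi>0 y - \<phi>0 0))\<^sup>2 / r\<^sup>2) else 0)"
  define \<psi> where "\<psi> y = 1 - \<eta> y" for y
  have bc: "Ck_map k \<eta>" "{y. \<eta> y \<noteq> 0} \<subseteq> chart_inv U0 \<phi>0 ` cball (\<phi>0 0) r"
      "compact (chart_inv U0 \<phi>0 ` cball (\<phi>0 0) r)" for k
    unfolding \<eta>_def by (rule Ck_map_bump_chart[OF chart0 rC(1,3)])+
  have \<psi>1: "smooth \<psi>" unfolding \<psi>_def smooth_def by (intro allI Ck_map_diff Ck_map_const bc(1))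
  have \<psi>2: "csupp (\<lambda>x. 1 - \<psi> x)" by (rule csuppI[OF bc(3)]) (use bc(2) in \<open>simp add: \<psi>_def\<close>)
  have \<psi>3: "\<psi> 0 = 0" using chart0 by (simp add: \<psi>_def \<eta>_def bump_props)
  have \<psi>4: "0 \<le> \<psi> x \<and> \<psi> x \<le> 1" for x by (auto simp: \<psi>_def \<eta>_def bump_props)
  have \<psi>5: "(norm (\<phi>0 y - \<phi>0 0))\<^sup>2 \<le> 2 * r\<^sup>2 * \<psi> y" if "y \<in> U0" "norm (\<phi>0 y - \<phi>0 0) \<le> r" for y
  proof -
    have "(norm (\<phi>0 y - \<phi>0 0))\<^sup>2 / r\<^sup>2 \<le> 1" using that(2) rC(1) by (simp add: power_mono)
    then have "(norm (\<phi>0 y - \<phi>0 0))\<^sup>2 / r\<^sup>2 / 2 \<le> \<psi> y"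
      using bump_le[of "(norm (\<phi>0 y - \<phi>0 0))\<^sup>2 / r\<^sup>2"] that(1) by (simp add: \<psi>_def \<eta>_def)
    then show ?thesis using rC(1) by (simp add: field_simps)
  qed
  have \<psi>6: "\<psi> y = 1" if "\<not> (y \<in> U0 \<and> norm (\<phi>0 y - \<phi>0 0) \<le> r)" for y
  proof (cases "y \<in> U0")
    case True
    then have "1 \<le> (norm (\<phi>0 y - \<phi>0 0))\<^sup>2 / r\<^sup>2"
      using that rC(1) by (simp add: le_divide_eq power_mono)
    then show ?thesis by (simp add: \<psi>_def \<eta>_def bump_props)
  qed (simp add: \<psi>_def \<eta>_def)
  have \<psi>7: "\<exists>c>0. \<forall>y. \<not> (y \<in> U0 \<and> norm (\<phi>0 y - \<phi>0 0) \<le> \<rho>) \<longrightarrow> c \<le> \<psi> y" if \<rho>: "0 < \<rho>" for \<rho>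
  proof (intro exI conjI allI impI)
    let ?c = "min 1 (\<rho>\<^sup>2 / (2 * r\<^sup>2))"
    show "0 < ?c" using \<rho> rC(1) by simp
    fix y assume y: "\<not> (y \<in> U0 \<and> norm (\<phi>0 y - \<phi>0 0) \<le> \<rho>)"
    show "?c \<le> \<psi> y"
    proof (cases "y \<in> U0 \<and> norm (\<phi>0 y - \<phi>0 0) \<le> r")
      case True
      then have "\<rho>\<^sup>2 \<le> (norm (\<phi>0 y - \<phi>0 0))\<^sup>2" using y \<rho> by (intro power_mono) auto
      also have "\<dots> \<le> 2 * r\<^sup>2 * \<psi> y" using \<psi>5 True by blast
      finally show ?thesis using rC(1) by (intro min.coboundedI2) (simp add: divide_le_eq mult_ac)
    qed (use \<psi>6[of y] in auto)
  qed
  obtain u :: "'g \<Rightarrow> real" and L N where u: "smooth u" "compact L" "L \<subseteq> U0" "{y. u y \<noteq> 0} \<subseteq> L"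
    "open N" "{0} \<subseteq> N" "\<And>y. y \<in> N \<Longrightarrow> u y = 1" "\<And>y. 0 \<le> u y" "\<And>y. u y \<le> 1"
    using ex_cutoff[of "{0}" U0] chart_open[OF chart0(1)] chart0(2) by auto
  define \<xi> where "\<xi> j = (\<lambda>y. if y \<in> U0 then u y *\<^sub>R l j (\<phi>0 y - \<phi>0 0) else 0)" for j
  have \<xi>1: "smooth (\<xi> j)" "csupp (\<xi> j)" if "j < d" for j
    unfolding \<xi>_def using smooth_chart_product[OF u(1-4) Ck_on_linear_form[OF that open_U0]] by auto
  have \<xi>2: "\<xi> j 0 = 0" if "j < d" for j
    using linear_0[OF bounded_linear.linear[OF bl_l[OF that]]] by (simp add: \<xi>_def)
  have "\<forall>j\<in>{..<d}. \<exists>B\<ge>0. \<forall>x. norm (\<xi> j x) \<le> B"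
    using csupp_bounded[OF \<xi>1(2) Ck_map_continuous[of 0]] \<xi>1(1) by (simp add: smooth_def)
  from bchoice[OF this] obtain B where B: "\<forall>j\<in>{..<d}. B j \<ge> 0 \<and> (\<forall>x. norm (\<xi> j x) \<le> B j)" ..
  obtain \<rho>0 where \<rho>0: "0 < \<rho>0" "\<And>y. y \<in> U0 \<Longrightarrow> norm (\<phi>0 y - \<phi>0 0) \<le> \<rho>0 \<Longrightarrow> y \<in> N"
    using chart_nhd[OF u(5)] u(6) by auto
  define \<rho> where "\<rho> = min \<rho>0 r"
  have \<rho>: "0 < \<rho>" "\<rho> \<le> r" using \<rho>0 rC by (auto simp: \<rho>_def)
  obtain c where c: "0 < c" "\<And>y. \<not> (y \<in> U0 \<and> norm (\<phi>0 y - \<phi>0 0) \<le> \<rho>) \<Longrightarrow> c \<le> \<psi> y"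
    using \<psi>7[OF \<rho>(1)] by blast
  \<comment> \<open>Near the identity Taylor's bound is combined with \<open>\<psi>5\<close>.
    Elsewhere the crude bound 2 M plus the sum of the \<open>B j * M\<close> is divided by the lower
    bound \<open>c\<close> of \<open>\<psi>\<close>.\<close>
  define K where "K = max (C * (2 * r\<^sup>2)) ((2 + (\<Sum>j<d. B j)) / c)"
  have K0: "0 \<le> K" using rC by (simp add: K_def max.coboundedI1)
  have main: "norm (f x - f 0 - (\<Sum>j<d. \<xi> j x *\<^sub>R X j f 0)) \<le> K * M * \<psi> x"
    if f: "Ck_map 2 f" and bd: "C2_bound f M" for f M x
  proof -
    have M0: "0 \<le> M" using C2_bound_nonneg[OF bd] .
    show ?thesis
    proof (cases "x \<in> U0 \<and> norm (\<phi>0 x - \<phi>0 0) \<le> \<rho>")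
      case True
      then have "u x = 1" using u(7) \<rho>0(2) by (simp add: \<rho>_def)
      then have "\<xi> j x = l j (\<phi>0 x - \<phi>0 0)" for j using True by (simp add: \<xi>_def)
      moreover have "loc f (\<phi>0 0 + (\<phi>0 x - \<phi>0 0)) = f x" using True by (simp add: chart_inv_f[OF chart0(1)])
      ultimately have "norm (f x - f 0 - (\<Sum>j<d. \<xi> j x *\<^sub>R X j f 0)) \<le> C * M * (norm (\<phi>0 x - \<phi>0 0))\<^sup>2"
        using taylor[OF f bd, of "\<phi>0 x - \<phi>0 0"] True \<rho>(2) by simp
      also have "\<dots> \<le> C * M * (2 * r\<^sup>2 * \<psi> x)"
        using \<psi>5[of x] True \<rho>(2) rC(2) M0 by (intro mult_left_mono) auto
      also have "\<dots> = (C * (2 * r\<^sup>2)) * (M * \<psi> x)" by simp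
      also have "\<dots> \<le> K * (M * \<psi> x)" unfolding K_def using M0 \<psi>4 by (intro mult_right_mono) auto
      finally show ?thesis by (simp add: mult.assoc)
    next
      case False
      have "norm (f x - f 0 - (\<Sum>j<d. \<xi> j x *\<^sub>R X j f 0)) \<le> norm (f x) + norm (f 0) + norm (\<Sum>j<d. \<xi> j x *\<^sub>R X j f 0)"
        using norm_triangle_ineq4[of "f x - f 0" "\<Sum>j<d. \<xi> j x *\<^sub>R X j f 0"] norm_triangle_ineq4[of "f x" "f 0"]
        by linarith
      also have "\<dots> \<le> M + M + (\<Sum>j<d. B j * M)"
        using bd B unfolding C2_bound_def
        by (intro add_mono sum_norm_le) (auto intro!: mult_mono)
      also have "\<dots> = (2 + (\<Sum>j<d. B j)) / c * M * c"
        unfolding sum_distrib_right[symmetric] using c(1) by (simp add: field_simps)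
      also have "\<dots> \<le> K * M * c" unfolding K_def using M0 c(1) by (intro mult_right_mono) auto
      also have "\<dots> \<le> K * M * \<psi> x" using c(2)[OF False] K0 M0 by (intro mult_left_mono) auto
      finally show ?thesis .
    qed
  qed
  have peano: "\<exists>N. open N \<and> 0 \<in> N \<and> (\<forall>x\<in>N. norm (h x) \<le> e * \<psi> x)"
    if h: "Ck_map 2 h" "h 0 = 0" "\<forall>i<d. dird (b i) (loc h) (\<phi>0 0) = 0"
        "\<forall>i<d. \<forall>j<d. dird (b i) (dird (b j) (loc h)) (\<phi>0 0) = 0" "0 < e" for h :: "'g \<Rightarrow> complex" and e
  proof -
    \<comment> \<open>Scaled so that \<open>lnorm\<close> and the factor 2 r^2 from
      \<open>\<psi>5\<close> are compensated. The added 1 avoids division by zero when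
      \<open>lnorm\<close> is 0, as in dimension 0.\<close>
    let ?e = "e / (2 * r\<^sup>2 * (lnorm\<^sup>2 + 1))"
    have pos: "0 < 2 * r\<^sup>2 * (lnorm\<^sup>2 + 1)" using rC(1) by (simp add: add_nonneg_pos)
    then have "0 < ?e" using h(5) by simp
    then obtain s where s: "0 < s" "\<And>v. norm v < s \<Longrightarrow> norm (loc h (\<phi>0 0 + v)) \<le> ?e * (lnorm * norm v)\<^sup>2"
      using peano_bound[OF h(1,2)] h(3,4) by blast
    define t where "t = min s r"
    have "norm (h x) \<le> e * \<psi> x" if x: "x \<in> {y \<in> U0. norm (\<phi>0 y - \<phi>0 0) < t}" for x
    proof -
      have "norm (h x) \<le> ?e * (lnorm * norm (\<phi>0 x - \<phi>0 0))\<^sup>2"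
        using s(2)[of "\<phi>0 x - \<phi>0 0"] x by (simp add: t_def chart_inv_f[OF chart0(1)])
      also have "\<dots> = ?e * lnorm\<^sup>2 * (norm (\<phi>0 x - \<phi>0 0))\<^sup>2" by (simp add: power_mult_distrib)
      also have "\<dots> \<le> ?e * (lnorm\<^sup>2 + 1) * (2 * r\<^sup>2 * \<psi> x)"

      proof (rule mult_mono)
        show "?e * lnorm\<^sup>2 \<le> ?e * (lnorm\<^sup>2 + 1)" using \<open>0 < ?e\<close> by (intro mult_left_mono) auto
        show "0 \<le> ?e * (lnorm\<^sup>2 + 1)" using \<open>0 < ?e\<close> by (intro mult_nonneg_nonneg) auto
        show "(norm (\<phi>0 x - \<phi>0 0))\<^sup>2 \<le> 2 * r\<^sup>2 * \<psi> x" using \<psi>5[of x] x by (simp add: t_def)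
      qed simp
      also have "\<dots> = e * \<psi> x"
      proof -
        have "r \<noteq> 0" "lnorm\<^sup>2 + 1 \<noteq> 0" using pos by (metis mult_zero_left mult_zero_right less_irrefl power_zero_numeral)+
        then show ?thesis by simp
      qed
      finally show ?thesis .
    qed
    moreover have "0 < t" using s rC by (simp add: t_def)
    ultimately show ?thesis using nhd_chart_open[of t] by blast
  qed
  have lower: "\<exists>c>0. \<forall>x. x \<notin> N \<longrightarrow> c \<le> \<psi> x" if N: "open N" "0 \<in> N" for N
  proof -
    obtain \<rho> where \<rho>: "0 < \<rho>" "\<And>y. y \<in> U0 \<Longrightarrow> norm (\<phi>0 y - \<phi>0 0) \<le> \<rho> \<Longrightarrow> y \<in> N"
      using chart_nhd[OF N] by blast
    obtain c where "0 < c" "\<forall>y. \<not> (y \<in> U0 \<and> norm (\<phi>0 y - \<phi>0 0) \<le> \<rho>) \<longrightarrow> c \<le> \<psi> y" using \<psi>7[OF \<rho>(1)] by blast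
    then show ?thesis using \<rho>(2) by blast
  qed
  have "test_functions \<xi> \<psi> K"
    unfolding test_functions_def
  proof (intro conjI)
    show "\<forall>j<d. smooth (\<xi> j) \<and> csupp (\<xi> j) \<and> \<xi> j 0 = 0" using \<xi>1 \<xi>2 by blast
    show "\<forall>x. 0 \<le> \<psi> x \<and> \<psi> x \<le> 1" using \<psi>4 by blast
    show "\<forall>N. open N \<and> 0 \<in> N \<longrightarrow> (\<exists>c>0. \<forall>x. x \<notin> N \<longrightarrow> c \<le> \<psi> x)" using lower by blast
    show "\<forall>f M x. Ck_map 2 f \<longrightarrow> C2_bound f M \<longrightarrow> norm (f x - f 0 - (\<Sum>j<d. \<xi> j x *\<^sub>R X j f 0)) \<le> K * M * \<psi> x"
      using main by blast
    show "\<forall>(h :: 'g \<Rightarrow> complex) e. Ck_map 2 h \<and> h 0 = 0 \<and> (\<forall>i<d. dird (b i) (loc h) (\<phi>0 0) = 0) \<and>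
        (\<forall>i<d. \<forall>j<d. dird (b i) (dird (b j) (loc h)) (\<phi>0 0) = 0) \<and> 0 < e \<longrightarrow>
        (\<exists>N. open N \<and> 0 \<in> N \<and> (\<forall>x\<in>N. norm (h x) \<le> e * \<psi> x))"
      by (intro allI impI, elim conjE) (rule peano)
  qed (rule \<psi>1 \<psi>2 \<psi>3 K0)+
  then show ?thesis by blast
qed

section \<open>Matching second-order jets\<close>

text \<open>\<open>g\<close> is the second-order Taylor polynomial of \<open>f\<close> in chart
  coordinates, multiplied by a cutoff that is 1 near the identity. The difference then falls under
  the clause of \<open>extended_to_Cb2\<close> that gives its value as an integral.\<close>

lemma ex_same_jet:
  assumes f: "Ck_map 2 f"
  obtains g :: "'g \<Rightarrow> complex" where "smooth g" "csupp g" "f 0 = g 0"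
    "\<And>i. i < d \<Longrightarrow> dird (b i) (loc (\<lambda>x. f x - g x)) (\<phi>0 0) = 0"
    "\<And>i j. i < d \<Longrightarrow> j < d \<Longrightarrow> dird (b i) (dird (b j) (loc (\<lambda>x. f x - g x))) (\<phi>0 0) = 0"
proof -
  let ?p = "\<phi>0 0"
  have f2: "Ck_map (Suc (Suc 0)) f" using f by (simp add: numeral_2_eq_2)
  have F: "Ck_on (Suc (Suc 0)) (\<phi>0 ` U0) (loc f)" using Ck_mapD[OF f2 chart0(1)] .
  define D where "D i = dird (b i) (loc f) ?p" for i
  define Q where "Q i j = dird (b i) (dird (b j) (loc f)) ?p" for i j
  have Qsym: "Q i j = Q j i" for i j
    unfolding Q_def using second_derivative_symmetric[of "\<phi>0 ` U0" "loc f" ?p "b j" "b i"] F open_U0 p0_in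
    by (simp add: numeral_2_eq_2)
  define T where "T p = f 0 + ((\<Sum>i<d. l i (p - ?p) *\<^sub>R D i) +
      (\<Sum>i<d. \<Sum>j<d. (l i (p - ?p) * l j (p - ?p)) *\<^sub>R ((1 / 2) *\<^sub>R Q i j)))" for p
  have T_smooth: "Ck_on k (\<phi>0 ` U0) T" for k
    unfolding T_def
    by (intro Ck_on_add[OF open_U0] Ck_on_sum[OF open_U0] Ck_on_const
        Ck_on_bilinear[OF bounded_bilinear_scaleR open_U0] Ck_on_bilinear[OF bounded_bilinear_mult open_U0]
        Ck_on_linear_form open_U0) auto
  have dl: "((\<lambda>p. l i (p - ?p)) has_derivative l i) (at q)" if "i < d" for i q
  proof -
    have "((\<lambda>p. p - ?p) has_derivative (\<lambda>h. h)) (at q)" by (auto intro!: derivative_eq_intros)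
    from bounded_linear.has_derivative[OF bl_l[OF that] this] show ?thesis .
  qed
  have dT: "(T has_derivative (\<lambda>w. (\<Sum>i<d. l i w *\<^sub>R D i) +
     (\<Sum>i<d. \<Sum>j<d. (l i (q - ?p) * l j w + l i w * l j (q - ?p)) *\<^sub>R ((1 / 2) *\<^sub>R Q i j)))) (at q)" for q
  proof -
    have "(T has_derivative (\<lambda>w. 0 + ((\<Sum>i<d. l i w *\<^sub>R D i) +
     (\<Sum>i<d. \<Sum>j<d. (l i (q - ?p) * l j w + l i w * l j (q - ?p)) *\<^sub>R ((1 / 2) *\<^sub>R Q i j))))) (at q)"
      unfolding T_def[abs_def]
      by (intro has_derivative_add has_derivative_sum has_derivative_const has_derivative_scaleR_left
          has_derivative_mult dl) auto
    then show ?thesis by simp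
  qed
  \<comment> \<open>Symmetry of \<open>Q\<close> merges the two halves of the differentiated
    quadratic form, which cancels the factor 1/2.\<close>
  have dTb: "dird (b k) T q = D k + (\<Sum>j<d. l j (q - ?p) *\<^sub>R Q k j)" if k: "k < d" for k q
  proof -
    have "dird (b k) T q = (\<Sum>i<d. l i (b k) *\<^sub>R D i) +
     (\<Sum>i<d. \<Sum>j<d. (l i (q - ?p) * l j (b k) + l i (b k) * l j (q - ?p)) *\<^sub>R ((1 / 2) *\<^sub>R Q i j))"
      using dT[of q] by (simp add: frechet_derivative_at[symmetric])
    also have "(\<Sum>i<d. l i (b k) *\<^sub>R D i) = (\<Sum>i<d. if i = k then D i else 0)"
      using k by (intro sum.cong) (auto simp: l_b)
    also have "\<dots> = D k" using k by simp
    also have "(\<Sum>i<d. \<Sum>j<d. (l i (q - ?p) * l j (b k) + l i (b k) * l j (q - ?p)) *\<^sub>R ((1 / 2) *\<^sub>R Q i j)) =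
       (\<Sum>i<d. \<Sum>j<d. (l i (q - ?p) * l j (b k)) *\<^sub>R ((1 / 2) *\<^sub>R Q i j)) +
       (\<Sum>i<d. \<Sum>j<d. (l i (b k) * l j (q - ?p)) *\<^sub>R ((1 / 2) *\<^sub>R Q i j))"
      by (simp only: scaleR_add_left sum.distrib)
    also have "(\<Sum>i<d. \<Sum>j<d. (l i (q - ?p) * l j (b k)) *\<^sub>R ((1 / 2) *\<^sub>R Q i j)) =
       (\<Sum>i<d. \<Sum>j<d. if j = k then l i (q - ?p) *\<^sub>R ((1 / 2) *\<^sub>R Q k i) else 0)"
      using k by (intro sum.cong refl) (auto simp: l_b Qsym)
    also have "\<dots> = (\<Sum>i<d. l i (q - ?p) *\<^sub>R ((1 / 2) *\<^sub>R Q k i))" using k by simp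
    also have "(\<Sum>i<d. \<Sum>j<d. (l i (b k) * l j (q - ?p)) *\<^sub>R ((1 / 2) *\<^sub>R Q i j)) =
       (\<Sum>i<d. if i = k then (\<Sum>j<d. l j (q - ?p) *\<^sub>R ((1 / 2) *\<^sub>R Q k j)) else 0)"
      using k by (intro sum.cong refl) (auto simp: l_b)
    also have "\<dots> = (\<Sum>j<d. l j (q - ?p) *\<^sub>R ((1 / 2) *\<^sub>R Q k j))" using k by simp
    also have "(\<Sum>j<d. l j (q - ?p) *\<^sub>R ((1 / 2) *\<^sub>R Q k j)) + (\<Sum>j<d. l j (q - ?p) *\<^sub>R ((1 / 2) *\<^sub>R Q k j)) =
      (\<Sum>j<d. l j (q - ?p) *\<^sub>R Q k j)"
      unfolding sum.distrib[symmetric] by (intro sum.cong refl) (simp add: scaleR_conv_of_real)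
    finally show ?thesis .
  qed
  have l0: "l j (0::'e) = 0" if "j < d" for j
    using linear_0[OF bounded_linear.linear[OF bl_l[OF that]]] .
  have dT0: "dird (b k) T ?p = D k" if "k < d" for k using dTb[OF that, of ?p] l0 by simp
  have ddT0: "dird (b i) (dird (b k) T) ?p = Q i k" if "i < d" "k < d" for i k
  proof -
    have "((\<lambda>q. D k + (\<Sum>j<d. l j (q - ?p) *\<^sub>R Q k j)) has_derivative (\<lambda>w. 0 + (\<Sum>j<d. l j w *\<^sub>R Q k j))) (at ?p)"
      by (intro has_derivative_add has_derivative_sum has_derivative_const has_derivative_scaleR_left dl) auto
    moreover have "dird (b k) T = (\<lambda>q. D k + (\<Sum>j<d. l j (q - ?p) *\<^sub>R Q k j))"
      using dTb[OF that(2)] by (rule ext)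
    ultimately have "dird (b i) (dird (b k) T) ?p = (\<Sum>j<d. l j (b i) *\<^sub>R Q k j)"
      by (simp add: frechet_derivative_at[symmetric])
    also have "\<dots> = (\<Sum>j<d. if j = i then Q k j else 0)" using that by (intro sum.cong) (auto simp: l_b)
    finally show ?thesis using that Qsym by simp
  qed
  obtain u :: "'g \<Rightarrow> real" and L N where u: "smooth u" "compact L" "L \<subseteq> U0" "{y. u y \<noteq> 0} \<subseteq> L"
    "open N" "{0} \<subseteq> N" "\<And>y. y \<in> N \<Longrightarrow> u y = 1" "\<And>y. 0 \<le> u y" "\<And>y. u y \<le> 1"
    using ex_cutoff[of "{0}" U0] chart_open[OF chart0(1)] chart0(2) by auto
  define g where "g = (\<lambda>y. if y \<in> U0 then u y *\<^sub>R T (\<phi>0 y) else 0)"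
  have g: "smooth g" "csupp g" unfolding g_def using smooth_chart_product[OF u(1-4) T_smooth] by auto
  let ?O = "\<phi>0 ` (N \<inter> U0)"
  have O: "open ?O" "?p \<in> ?O" "?O \<subseteq> \<phi>0 ` U0"
    using u(5,6) chart_open[OF chart0(1)] chart0(2) by (auto intro!: open_chart_image[OF chart0(1)])
  have h: "loc (\<lambda>x. f x - g x) q = loc f q - T q" if "q \<in> ?O" for q
    using that u(7) by (auto simp: g_def chart_inv_f[OF chart0(1)])
  have "Ck_map 2 (\<lambda>x. f x - g x)" using f g(1) by (intro Ck_map_diff) (auto simp: smooth_def)
  have Fd: "loc f differentiable (at q)" "dird v (loc f) differentiable (at q)" if "q \<in> ?O" for q v
    using F O(3) that by auto
  have Td: "T differentiable (at q)" for q using dT differentiable_def by blast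
  have T2d: "dird v T differentiable (at q)" if "q \<in> ?O" for q v
    using T_smooth[of "Suc (Suc 0)"] O(3) that by auto
  have d1: "dird v (loc (\<lambda>x. f x - g x)) q = dird v (loc f) q - dird v T q" if q: "q \<in> ?O" for q v
  proof -
    have "((\<lambda>q. loc f q - T q) has_derivative (\<lambda>v. dird v (loc f) q - dird v T q)) (at q)"
      using Fd(1)[OF q] Td unfolding frechet_derivative_works by (intro has_derivative_diff)
    from has_derivative_transform_within_open[OF this O(1) q, of "loc (\<lambda>x. f x - g x)"]
    have "(loc (\<lambda>x. f x - g x) has_derivative (\<lambda>v. dird v (loc f) q - dird v T q)) (at q)" using h by simp
    from fun_cong[OF frechet_derivative_at[OF this], of v] show ?thesis by (rule sym)
  qed
  have d2: "dird w (dird v (loc (\<lambda>x. f x - g x))) ?p = dird w (dird v (loc f)) ?p - dird w (dird v T) ?p" for v w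
  proof -
    have "((\<lambda>q. dird v (loc f) q - dird v T q) has_derivative (\<lambda>w. dird w (dird v (loc f)) ?p - dird w (dird v T) ?p)) (at ?p)"
      using Fd(2)[OF O(2)] T2d[OF O(2)] unfolding frechet_derivative_works by (intro has_derivative_diff)
    from has_derivative_transform_within_open[OF this O(1) O(2), of "dird v (loc (\<lambda>x. f x - g x))"]
    have "(dird v (loc (\<lambda>x. f x - g x)) has_derivative (\<lambda>w. dird w (dird v (loc f)) ?p - dird w (dird v T) ?p)) (at ?p)"
      using d1 by simp
    from fun_cong[OF frechet_derivative_at[OF this], of w] show ?thesis by (rule sym)
  qed
  have "T ?p = f 0" using l0 by (simp add: T_def)
  then have "f 0 = g 0" using u(6,7) chart0 by (simp add: g_def)
  moreover have "dird (b i) (loc (\<lambda>x. f x - g x)) ?p = 0" if "i < d" for i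
    using d1[OF O(2)] dT0[OF that] by (simp add: D_def)
  moreover have "dird (b i) (dird (b j) (loc (\<lambda>x. f x - g x))) ?p = 0" if "i < d" "j < d" for i j
    using d2 ddT0[OF that] by (simp add: Q_def)
  ultimately show ?thesis using that[of g] g by blast
qed

text \<open>Flatness is arranged for the derivatives in the chart, while
  \<open>extended_to_Cb2\<close> asks for it in terms of the fields; \<open>X_X_chart\<close>
  translates the one into the other.\<close>

lemma zero_jet_X:
  assumes h: "Ck_map 2 h" and D: "\<And>i. i < d \<Longrightarrow> dird (b i) (loc h) (\<phi>0 0) = 0"
    and D2: "\<And>i j. i < d \<Longrightarrow> j < d \<Longrightarrow> dird (b i) (dird (b j) (loc h)) (\<phi>0 0) = 0"
  shows "j < d \<Longrightarrow> X j h 0 = 0" and "i < d \<Longrightarrow> j < d \<Longrightarrow> X i (X j h) 0 = 0"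
proof -
  have h2: "Ck_map (Suc (Suc 0)) h" using h by (simp add: numeral_2_eq_2)
  show "X j h 0 = 0" if "j < d" for j using X_origin[OF that h2] D[OF that] by simp
  have F: "Ck_on (Suc (Suc 0)) (\<phi>0 ` U0) (loc h)" using Ck_mapD[OF h2 chart0(1)] .
  have diff: "loc h differentiable (at (\<phi>0 0))" using F p0_in by auto
  have "dird w (loc h) (\<phi>0 0) = 0" for w
    using linear_frame_expand[OF linear_dird[OF diff], of w] D by simp
  then show "X i (X j h) 0 = 0" if "i < d" "j < d"
    using X_X_chart[OF h p0_in that] D2[OF that] by (simp add: chart_inv_origin frame_field_origin)
qed

section \<open>The space of twice differentiable bounded functions\<close>

lemma field_power_Suc: "field_power (Suc n) X \<alpha> = field_power n X \<alpha> \<circ> (X n ^^ \<alpha> n)"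
proof -
  have *: "foldr (\<lambda>j F. (X j ^^ \<alpha> j) \<circ> F) xs F = foldr (\<lambda>j F. (X j ^^ \<alpha> j) \<circ> F) xs id \<circ> F" for xs F
    by (induction xs) (auto simp: o_assoc)
  show ?thesis unfolding field_power_def by (simp add: *[of _ "X n ^^ \<alpha> n"])
qed

lemma field_power_0: "(\<Sum>j<n. \<alpha> j) = 0 \<Longrightarrow> field_power n X \<alpha> = id"
  by (induction n) (auto simp: field_power_Suc, auto simp: field_power_def)

text \<open>The clause on \<open>\<alpha>\<close> determines the index \<open>j\<close>;
  \<open>Cnorm_le_iff\<close> uses it to recognise the field that belongs to a prescribed
  multi-index.\<close>

lemma field_power_1:
  "(\<Sum>j<n. \<alpha> j) = 1 \<Longrightarrow> \<exists>j<n. field_power n X \<alpha> = X j \<and> (\<forall>k<n. \<alpha> k = (if k = j then 1 else 0))"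
proof (induction n)
  case (Suc n)
  show ?case
  proof (cases "\<alpha> n = 0")
    case True
    then obtain j where "j < n" "field_power n X \<alpha> = X j" "\<forall>k<n. \<alpha> k = (if k = j then 1 else 0)"
      using Suc by auto
    then show ?thesis using True by (intro exI[of _ j]) (auto simp: field_power_Suc less_Suc_eq)
  next
    case False
    then have "\<alpha> n = 1" "(\<Sum>j<n. \<alpha> j) = 0" using Suc.prems unfolding sum.lessThan_Suc by linarith+
    then show ?thesis by (intro exI[of _ n]) (auto simp: field_power_Suc field_power_0 less_Suc_eq)
  qed
qed simp

text \<open>The cases concern the last exponent, whose field acts first; this is why the indices
  come out in increasing order.\<close>

lemma field_power_2:
  "(\<Sum>j<n. \<alpha> j) = 2 \<Longrightarrow> \<exists>i j. i \<le> j \<and> j < n \<and> field_power n X \<alpha> = X i \<circ> X j \<and>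
     (\<forall>k<n. \<alpha> k = (if k = i then 1 else 0) + (if k = j then 1 else 0))"
proof (induction n)
  case (Suc n)
  consider "\<alpha> n = 0" "(\<Sum>j<n. \<alpha> j) = 2" | "\<alpha> n = 1" "(\<Sum>j<n. \<alpha> j) = 1" | "\<alpha> n = 2" "(\<Sum>j<n. \<alpha> j) = 0"
    using Suc.prems by fastforce
  then show ?case
  proof cases
    case 1
    then obtain i j where "i \<le> j" "j < n" "field_power n X \<alpha> = X i \<circ> X j"
      "\<forall>k<n. \<alpha> k = (if k = i then 1 else 0) + (if k = j then 1 else 0)" using Suc.IH[OF 1(2)] by blast
    then show ?thesis using 1 by (intro exI[of _ i] exI[of _ j]) (auto simp: field_power_Suc less_Suc_eq)
  next
    case 2
    then obtain i where "i < n" "field_power n X \<alpha> = X i" "\<forall>k<n. \<alpha> k = (if k = i then 1 else 0)"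
      using field_power_1 by blast
    then show ?thesis using 2 by (intro exI[of _ i] exI[of _ n]) (auto simp: field_power_Suc less_Suc_eq)
  next
    case 3
    then show ?thesis
      by (intro exI[of _ n]) (auto simp: field_power_Suc field_power_0 numeral_2_eq_2 less_Suc_eq)
  qed
qed simp

lemma Cnorm_le_iff:
  assumes M: "0 \<le> M"
  shows "Cnorm d X 2 f \<le> ennreal M \<longleftrightarrow> C2_bound f M"
proof -
  have "Cnorm d X 2 f \<le> ennreal M \<longleftrightarrow> (\<forall>\<alpha>\<in>multi_indices d 2. \<forall>x. norm (field_power d X \<alpha> f x) \<le> M)"
    unfolding Cnorm_def SUP_le_iff using M by simp
  also have "\<dots> \<longleftrightarrow> C2_bound f M"
  proof
    assume b: "\<forall>\<alpha>\<in>multi_indices d 2. \<forall>x. norm (field_power d X \<alpha> f x) \<le> M"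
    have "norm (f x) \<le> M" for x
      using b[rule_format, of "\<lambda>_. 0" x] field_power_0[of "\<lambda>_. 0" d] by (simp add: multi_indices_def)
    moreover have "norm (X j f x) \<le> M" if j: "j < d" for j x
    proof -
      let ?a = "\<lambda>k. if k = j then 1 else (0::nat)"
      have s: "(\<Sum>k<d. ?a k) = 1" using j by simp
      obtain i where i: "i < d" "field_power d X ?a = X i" "\<forall>k<d. ?a k = (if k = i then 1 else 0)"
        using field_power_1[OF s] by blast
      then have "i = j" using j by (metis zero_neq_one)
      moreover have "?a \<in> multi_indices d 2" using j s by (auto simp: multi_indices_def)
      ultimately show ?thesis using b i by fastforce
    qed
    moreover have "norm (X i (X j f) x) \<le> M" if ij: "i \<le> j" "j < d" for i j x
    proof -
      let ?a = "\<lambda>k. (if k = i then 1 else 0) + (if k = j then 1 else (0::nat))"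
      have s: "(\<Sum>k<d. ?a k) = 2" using ij by (simp add: sum.distrib)
      obtain i' j' where i: "i' \<le> j'" "j' < d" "field_power d X ?a = X i' \<circ> X j'"
        "\<forall>k<d. ?a k = (if k = i' then 1 else 0) + (if k = j' then 1 else 0)"
        using field_power_2[OF s] by blast
      have iff: "k = i \<or> k = j \<longleftrightarrow> k = i' \<or> k = j'" if "k < d" for k
        using i(4)[rule_format, OF that] by (cases "k = i"; cases "k = j"; cases "k = i'"; cases "k = j'") simp_all
      have "i < d" "i' < d" using ij i(1,2) by simp_all
      then have "i = i' \<and> j = j'"
        using iff[of i] iff[of j] iff[of i'] iff[of j'] ij i(1,2) by presburger
      moreover have "?a \<in> multi_indices d 2" using ij s by (auto simp: multi_indices_def)
      ultimately show ?thesis using b i(3) by fastforce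
    qed
    ultimately show "C2_bound f M" unfolding C2_bound_def by blast
  next
    assume b: "C2_bound f M"
    show "\<forall>\<alpha>\<in>multi_indices d 2. \<forall>x. norm (field_power d X \<alpha> f x) \<le> M"
    proof (intro ballI allI)
      fix \<alpha> x assume "\<alpha> \<in> multi_indices d 2"
      then consider "(\<Sum>j<d. \<alpha> j) = 0" | "(\<Sum>j<d. \<alpha> j) = 1" | "(\<Sum>j<d. \<alpha> j) = 2"
        unfolding multi_indices_def by fastforce
      then show "norm (field_power d X \<alpha> f x) \<le> M"
      proof cases
        case 1 then show ?thesis using b field_power_0 by (simp add: C2_bound_def)
      next
        case 2
        from field_power_1[OF this] show ?thesis using b by (auto simp: C2_bound_def)
      next
        case 3
        from field_power_2[OF this] show ?thesis using b by (auto simp: C2_bound_def)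
      qed
    qed
  qed
  finally show ?thesis .
qed

lemma Cb2_eq: "Cb2 A d X = {f. Ck_map 2 f \<and> (\<exists>M. C2_bound f M)}"
proof -
  have "Cnorm d X 2 f < \<infinity> \<longleftrightarrow> (\<exists>M. C2_bound f M)" for f
  proof
    assume "Cnorm d X 2 f < \<infinity>"
    then obtain M where "0 \<le> M" "Cnorm d X 2 f = ennreal M" by (cases "Cnorm d X 2 f") auto
    then show "\<exists>M. C2_bound f M" using Cnorm_le_iff by (metis order_refl)
  next
    assume "\<exists>M. C2_bound f M"
    then obtain M where M: "C2_bound f M" by blast
    then have "Cnorm d X 2 f \<le> ennreal M" using Cnorm_le_iff[OF C2_bound_nonneg[OF M]] by blast
    then show "Cnorm d X 2 f < \<infinity>" by (metis ennreal_less_top infinity_ennreal_def order_le_less_trans)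
  qed
  then show ?thesis by (auto simp: Cb2_def Ck_eq)
qed

section \<open>Linear operations and translations in the C^2 norm\<close>

lemma C2_SucSuc: "Ck_map 2 f \<Longrightarrow> Ck_map (Suc (Suc 0)) f"
  by (simp add: numeral_2_eq_2)

lemma X_X_linear:
  assumes "i < d" "j < d" "Ck_map 2 f" "Ck_map 2 g"
  shows "X i (X j (\<lambda>x. a * f x + c * g x)) = (\<lambda>x. a * X i (X j f) x + c * X i (X j g) x)"
  by (simp only: X_linear[OF assms(2) C2_SucSuc C2_SucSuc, OF assms(3,4)]
      X_linear[OF assms(1) Ck_map_X[OF assms(2) C2_SucSuc[OF assms(3)]] Ck_map_X[OF assms(2) C2_SucSuc[OF assms(4)]]])

lemma C2_bound_linear:
  assumes "Ck_map 2 f" "Ck_map 2 g" "C2_bound f M" "C2_bound g M'"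
  shows "C2_bound (\<lambda>x. a * f x + c * g x) (norm a * M + norm c * M')"
proof -
  have t: "norm (a * p + c * q) \<le> norm a * M + norm c * M'" if "norm p \<le> M" "norm q \<le> M'" for p q
    using norm_triangle_ineq[of "a * p" "c * q"] mult_left_mono[OF that(1), of "norm a"]
      mult_left_mono[OF that(2), of "norm c"] by (simp add: norm_mult)
  show ?thesis
    unfolding C2_bound_def
    using assms(3,4) X_linear[OF _ C2_SucSuc[OF assms(1)] C2_SucSuc[OF assms(2)], of _ a c]
      X_X_linear[OF _ _ assms(1,2), of _ _ a c]
    by (auto intro!: t simp: C2_bound_def)
qed

lemma Ck_map_lin: "Ck_map k f \<Longrightarrow> Ck_map k g \<Longrightarrow> Ck_map k (\<lambda>x. a * f x + c * g x :: complex)"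
  by (intro Ck_map_add Ck_map_mult Ck_map_const)

lemma Cb2_linear: "f \<in> Cb2 A d X \<Longrightarrow> g \<in> Cb2 A d X \<Longrightarrow> (\<lambda>x. a * f x + c * g x) \<in> Cb2 A d X"
  unfolding Cb2_eq using C2_bound_linear Ck_map_lin by blast

lemma C2_bound_const: "C2_bound (\<lambda>x. c) (norm c)"
  by (auto simp: C2_bound_def X_const)

lemma csupp_X:
  assumes "j < d" "Ck_map (Suc k) f" "csupp f"
  shows "csupp (X j f)"
proof -
  obtain L where L: "compact L" "{y. f y \<noteq> 0} \<subseteq> L" using assms(3) by (auto simp: csupp_def)
  have "X j f x = 0" if "x \<notin> L" for x
  proof -
    have "X j f x = X j (\<lambda>x. 0) x"
      by (rule X_cong_open[OF assms(1) Ck_map_const, of "- L"])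
         (use L that in \<open>auto simp: compact_imp_closed\<close>)
    then show ?thesis using X_const[OF assms(1)] by simp
  qed
  then show ?thesis by (intro csuppI[OF L(1)]) blast
qed

text \<open>A finite family, so that bounds and neighbourhoods found for each member separately can
  be combined.\<close>

definition jet_functions :: "('g \<Rightarrow> complex) \<Rightarrow> ('g \<Rightarrow> complex) set" where
  "jet_functions f = insert f ((\<lambda>j. X j f) ` {..<d} \<union> (\<lambda>(j, k). X j (X k f)) ` ({..<d} \<times> {..<d}))"

lemma finite_jet_functions: "finite (jet_functions f)"
  by (simp add: jet_functions_def)

lemma jet_functions_props:
  assumes f: "Ck_map 2 f" and h: "h \<in> jet_functions f"
  shows "continuous_on UNIV h" "csupp f \<Longrightarrow> csupp h"
proof -
  note f2 = C2_SucSuc[OF f]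
  have X1: "Ck_map (Suc 0) (X j f)" if "j < d" for j using Ck_map_X[OF that f2] .
  have X2: "Ck_map 0 (X i (X j f))" if "i < d" "j < d" for i j using Ck_map_X[OF that(1) X1[OF that(2)]] .
  show "continuous_on UNIV h"
    using h Ck_map_continuous[OF f] Ck_map_continuous[OF X1] Ck_map_continuous[OF X2]
    unfolding jet_functions_def by auto
  show "csupp h" if "csupp f"
    using h that csupp_X[OF _ f2 that] csupp_X[OF _ X1 csupp_X[OF _ f2 that]]
    unfolding jet_functions_def by auto
qed

lemma jet_functions_mem:
  "f \<in> jet_functions f" "j < d \<Longrightarrow> X j f \<in> jet_functions f"
  "j < d \<Longrightarrow> k < d \<Longrightarrow> X j (X k f) \<in> jet_functions f"
  by (auto simp: jet_functions_def intro!: image_eqI[of _ _ "(j, k)"])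

lemma C2_bound_jetI: "(\<And>h x. h \<in> jet_functions f \<Longrightarrow> norm (h x) \<le> M) \<Longrightarrow> C2_bound f M"
  unfolding C2_bound_def using jet_functions_mem by (meson le_less_trans)

lemma csupp_C2_bound:
  assumes f: "Ck_map 2 f" "csupp f"
  shows "\<exists>M. C2_bound f M"
proof -
  have "\<forall>h\<in>jet_functions f. \<exists>B\<ge>0. \<forall>x. norm (h x) \<le> B"
    using csupp_bounded jet_functions_props[OF f(1)] f(2) by blast
  from bchoice[OF this] obtain B where B: "\<forall>h\<in>jet_functions f. 0 \<le> B h \<and> (\<forall>x. norm (h x) \<le> B h)" ..
  have "C2_bound f (\<Sum>h\<in>jet_functions f. B h)"
  proof (rule C2_bound_jetI)
    fix h x assume h: "h \<in> jet_functions f"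
    then have "norm (h x) \<le> B h" using B by blast
    also have "\<dots> \<le> (\<Sum>h\<in>jet_functions f. B h)"
      using h B finite_jet_functions by (intro member_le_sum) auto
    finally show "norm (h x) \<le> (\<Sum>h\<in>jet_functions f. B h)" .
  qed
  then show ?thesis by blast
qed

lemma csupp_Cb2: "Ck_map 2 f \<Longrightarrow> csupp f \<Longrightarrow> f \<in> Cb2 A d X"
  using csupp_C2_bound by (simp add: Cb2_eq)

lemma Cc_smooth_Cb2: "f \<in> Cc_smooth A \<Longrightarrow> f \<in> Cb2 A d X"
  using csupp_Cb2 by (simp add: Cc_smooth_eq smooth_def)

text \<open>Left-invariant fields commute with left translations, so derivatives of a translation
  difference are the translation differences of the derivatives.\<close>

lemma X_translate_diff:
  assumes f: "Ck_map 2 f"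
  shows "j < d \<Longrightarrow> X j (\<lambda>y. f (x + y) - f y) = (\<lambda>y. X j f (x + y) - X j f y)"
    and "i < d \<Longrightarrow> j < d \<Longrightarrow> X i (X j (\<lambda>y. f (x + y) - f y)) = (\<lambda>y. X i (X j f) (x + y) - X i (X j f) y)"
proof -
  have f': "Ck_map 2 (\<lambda>y. f (x + y))" by (rule Ck_map_left_translate[OF f])
  have eq: "(\<lambda>y. f (x + y) - f y) = (\<lambda>y. 1 * f (x + y) + (- 1) * f y)" by auto
  have tr: "X j (\<lambda>y. h (x + y)) = (\<lambda>y. X j h (x + y))" if "j < d" for j h
    by (rule ext) (rule X_left_translate[OF that])
  show "X j (\<lambda>y. f (x + y) - f y) = (\<lambda>y. X j f (x + y) - X j f y)" if "j < d" for j
    unfolding eq X_linear[OF that C2_SucSuc[OF f'] C2_SucSuc[OF f]] tr[OF that] by simp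
  show "X i (X j (\<lambda>y. f (x + y) - f y)) = (\<lambda>y. X i (X j f) (x + y) - X i (X j f) y)" if "i < d" "j < d"
    unfolding eq X_X_linear[OF that f' f] tr[OF that(2)] tr[OF that(1)] by simp
qed

lemma C2_bound_translate_diffI:
  assumes "Ck_map 2 f" "\<And>h y. h \<in> jet_functions f \<Longrightarrow> norm (h (x + y) - h y) \<le> e"
  shows "C2_bound (\<lambda>y. f (x + y) - f y) e"
  unfolding C2_bound_def
proof (intro conjI allI impI)
  fix j k y assume "j \<le> k" "k < d"
  then show "norm (X j (X k (\<lambda>y. f (x + y) - f y)) y) \<le> e"
    using assms(2)[OF jet_functions_mem(3)] by (simp add: X_translate_diff(2)[OF assms(1)])
next
  fix j y assume "j < d"
  then show "norm (X j (\<lambda>y. f (x + y) - f y) y) \<le> e"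
    using assms(2)[OF jet_functions_mem(2)] by (simp add: X_translate_diff(1)[OF assms(1)])
qed (rule assms(2)[OF jet_functions_mem(1)])

lemma C2_bound_translate_diff:
  assumes "Ck_map 2 f" "C2_bound f M"
  shows "C2_bound (\<lambda>y. f (x + y) - f y) (2 * M)"
proof -
  have t: "norm (p - q) \<le> 2 * M" if "norm p \<le> M" "norm q \<le> M" for p q :: complex
    using norm_triangle_ineq4[of p q] that by linarith
  show ?thesis
    using assms(2) X_translate_diff[OF assms(1)] by (auto simp: C2_bound_def intro!: t)
qed

text \<open>The tube lemma gives a neighbourhood \<open>N\<close> that works for all
  \<open>y\<close> in the compact set \<open>L\<close>. If only \<open>x + y\<close> lies in
  \<open>L\<close>, the two points exchange their roles under translation by \<open>- x\<close>,
  which is why \<open>N\<close> is made symmetric.\<close>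

lemma csupp_left_uniformly_continuous:
  fixes h :: "'g \<Rightarrow> 'b::real_normed_vector"
  assumes h: "csupp h" "continuous_on UNIV h" and e: "0 < e"
  shows "\<exists>N. open N \<and> 0 \<in> N \<and> (\<forall>x\<in>N. \<forall>y. norm (h (x + y) - h y) < e)"
proof -
  obtain L where L: "compact L" "{y. h y \<noteq> 0} \<subseteq> L" using h(1) by (auto simp: csupp_def)
  let ?W = "{p. norm (h (fst p + snd p) - h (snd p)) < e}"
  have W: "open ?W"
  proof (rule open_Collect_less)
    show "continuous_on UNIV (\<lambda>p. norm (h (fst p + snd p) - h (snd p)))"
      by (intro continuous_on_norm continuous_on_diff continuous_on_compose2[OF h(2)] continuous_intros) auto
  qed (intro continuous_intros)
  have "{0} \<times> L \<subseteq> ?W" using e by auto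
  from Elementary_Topology.tube_lemma[OF L(1) W this] obtain N where "0 \<in> N \<and> open N \<and> N \<times> L \<subseteq> ?W" ..
  then have N: "0 \<in> N" "open N" "N \<times> L \<subseteq> ?W" by auto
  let ?N = "N \<inter> uminus -` N"
  have "open (uminus -` N)"
  proof (rule open_vimage[OF N(2)])
    show "continuous_on UNIV (uminus :: 'g \<Rightarrow> 'g)"
      using continuous_on_minus[OF continuous_on_id, of UNIV] by simp
  qed
  then have "open ?N" "0 \<in> ?N" using N by auto
  moreover have "norm (h (x + y) - h y) < e" if x: "x \<in> ?N" for x y
  proof -
    have L_bound: "norm (h (x + y) - h y) < e" if "x \<in> N" "y \<in> L" for x y
      using N(3) that by auto
    consider "y \<in> L" | "x + y \<in> L" | "h y = 0" "h (x + y) = 0" using L(2) by blast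
    then show ?thesis
    proof cases
      case 1 then show ?thesis using L_bound x by blast
    next
      case 2
      then show ?thesis using L_bound[of "- x" "x + y"] x by (simp add: norm_minus_commute flip: add.assoc)
    qed (use e in simp)
  qed
  ultimately show ?thesis by blast
qed

lemma translate_diff_small:
  assumes f: "Ck_map 2 f" "csupp f" and e: "0 < e"
  shows "\<exists>N. open N \<and> 0 \<in> N \<and> (\<forall>x\<in>N. C2_bound (\<lambda>y. f (x + y) - f y) e)"
proof -
  have "\<forall>h\<in>jet_functions f. \<exists>N. open N \<and> 0 \<in> N \<and> (\<forall>x\<in>N. \<forall>y. norm (h (x + y) - h y) < e)"
    using csupp_left_uniformly_continuous[OF jet_functions_props(2)[OF f(1) _ f(2)] jet_functions_props(1)[OF f(1)] e]
    by blast
  from bchoice[OF this] obtain N where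
    N: "\<forall>h\<in>jet_functions f. open (N h) \<and> 0 \<in> N h \<and> (\<forall>x\<in>N h. \<forall>y. norm (h (x + y) - h y) < e)" ..
  let ?N = "\<Inter>h\<in>jet_functions f. N h"
  have "open ?N" "0 \<in> ?N" using N finite_jet_functions by auto
  moreover have "C2_bound (\<lambda>y. f (x + y) - f y) e" if "x \<in> ?N" for x
    by (rule C2_bound_translate_diffI[OF f(1)]) (use N that in \<open>auto intro: less_imp_le\<close>)
  ultimately show ?thesis by blast
qed

section \<open>Exhaustion by cutoff functions\<close>

definition cutoff :: "('g \<Rightarrow> real) \<Rightarrow> bool" where
  "cutoff u \<longleftrightarrow> smooth u \<and> csupp u \<and> (\<forall>x. 0 \<le> u x \<and> u x \<le> 1)"

lemma ex_cutoff_function: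
  assumes "compact K" "open W" "K \<subseteq> W"
  shows "\<exists>u N. cutoff u \<and> {x. u x \<noteq> 0} \<subseteq> W \<and> open N \<and> K \<subseteq> N \<and> (\<forall>x\<in>N. u x = 1)"
proof -
  obtain u :: "'g \<Rightarrow> real" and L N where u: "smooth u" "compact L" "L \<subseteq> W" "{y. u y \<noteq> 0} \<subseteq> L"
    "open N" "K \<subseteq> N" "\<And>y. y \<in> N \<Longrightarrow> u y = 1" "\<And>y. 0 \<le> u y" "\<And>y. u y \<le> 1"
    using ex_cutoff[OF assms] by metis
  then have "cutoff u" by (auto simp: cutoff_def intro: csuppI)
  then show ?thesis using u by blast
qed

text \<open>The group is locally compact because of the charts, and second countability, through
  Lindelof's theorem, yields a countable cover by open sets \<open>N i\<close> inside compact sets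
  \<open>L i\<close>. The i-th cutoff equals 1 on the sets \<open>L k\<close> with k \<le>
  i.\<close>

lemma ex_exhaustion:
  "\<exists>u. (\<forall>i. cutoff (u i)) \<and> (\<forall>K. compact K \<longrightarrow> (\<forall>\<^sub>F i :: nat in sequentially. \<forall>x\<in>K. u i x = 1))"
proof -
  let ?F = "{N :: 'g set. open N \<and> (\<exists>L. compact L \<and> N \<subseteq> L)}"
  have "x \<in> \<Union>?F" for x
  proof -
    obtain u N where u: "cutoff u" "open N" "{x} \<subseteq> N" "\<forall>x\<in>N. u x = 1"
      using ex_cutoff_function[of "{x}" UNIV] by auto
    obtain L where "compact L" "{y. u y \<noteq> 0} \<subseteq> L" using u(1) by (auto simp: cutoff_def csupp_def)
    then have "N \<in> ?F" using u by fastforce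
    then show ?thesis using u(3) by blast
  qed
  then have cov: "\<Union>?F = UNIV" by blast
  obtain F' where F': "F' \<subseteq> ?F" "countable F'" "\<Union>F' = \<Union>?F"
    using Lindelof[of ?F] by auto
  have "F' \<noteq> {}" using F'(3) cov by auto
  define N where "N = from_nat_into F'"
  have N: "N i \<in> F'" for i unfolding N_def by (rule from_nat_into[OF \<open>F' \<noteq> {}\<close>])
  have "\<forall>i. \<exists>L. compact L \<and> N i \<subseteq> L" using N F'(1) by blast
  from choice[OF this] obtain L where L: "\<forall>i. compact (L i) \<and> N i \<subseteq> L i" ..
  have "\<forall>i. \<exists>u. cutoff u \<and> (\<forall>x\<in>(\<Union>k\<le>i. L k). u x = 1)"
  proof
    fix i
    have "compact (\<Union>k\<le>i. L k)" using L by auto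
    from ex_cutoff_function[OF this open_UNIV] show "\<exists>u. cutoff u \<and> (\<forall>x\<in>(\<Union>k\<le>i. L k). u x = 1)" by blast
  qed
  from choice[OF this] obtain u where u: "\<forall>i. cutoff (u i) \<and> (\<forall>x\<in>(\<Union>k\<le>i. L k). u i x = 1)" ..
  have "\<forall>\<^sub>F i in sequentially. \<forall>x\<in>K. u i x = 1" if K: "compact K" for K
  proof -
    have op: "\<And>B. B \<in> F' \<Longrightarrow> open B" using F'(1) by blast
    have "K \<subseteq> \<Union>F'" using F'(3) cov by simp
    then obtain C where C: "C \<subseteq> F'" "finite C" "K \<subseteq> \<Union>C" using compactE[OF K _ op] by blast
    have "\<forall>B\<in>C. \<exists>k. N k = B"
      unfolding N_def using C(1) F'(2) from_nat_into_surj by (metis subsetD)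
    from bchoice[OF this] obtain k where k: "\<forall>B\<in>C. N (k B) = B" ..
    \<comment> \<open>The sum of the finitely many indices is an upper bound for each of
      them.\<close>
    have "\<forall>x\<in>K. u i x = 1" if i: "i \<ge> (\<Sum>B\<in>C. k B)" for i
    proof
      fix x assume "x \<in> K"
      then obtain B where B: "B \<in> C" "x \<in> B" using C(3) by blast
      then have "x \<in> L (k B)" using k L by blast
      moreover have "k B \<le> i" using member_le_sum[OF B(1), of k] C(2) i by simp
      ultimately show "u i x = 1" using u by blast
    qed
    then show ?thesis unfolding eventually_sequentially by blast
  qed
  then show ?thesis using u by blast
qed

lemma ex_shrinking_cutoffs:
  "\<exists>v. (\<forall>i. cutoff (v i) \<and> (\<exists>N. open N \<and> 0 \<in> N \<and> (\<forall>x\<in>N. v i x = 1))) \<and>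
     (\<forall>N. open N \<and> 0 \<in> N \<longrightarrow> (\<forall>\<^sub>F i :: nat in sequentially. {x. v i x \<noteq> 0} \<subseteq> N))"
proof -
  obtain B :: "nat \<Rightarrow> 'g set" where B: "\<And>i. open (B i)" "\<And>i. 0 \<in> B i"
    "\<And>S. open S \<Longrightarrow> 0 \<in> S \<Longrightarrow> \<forall>\<^sub>F i in sequentially. B i \<subseteq> S"
    by (rule countable_basis_at_decseq[of 0]) blast
  have "\<forall>i. \<exists>u N. cutoff u \<and> {x. u x \<noteq> 0} \<subseteq> B i \<and> open N \<and> {0} \<subseteq> N \<and> (\<forall>x\<in>N. u x = 1)"
    using ex_cutoff_function[of "{0}"] B by simp
  from choice[OF this] obtain v where v: "\<forall>i. \<exists>N. cutoff (v i) \<and> {x. v i x \<noteq> 0} \<subseteq> B i \<and> open N \<and> {0} \<subseteq> N \<and> (\<forall>x\<in>N. v i x = 1)" ..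
  have "\<forall>\<^sub>F i in sequentially. {x. v i x \<noteq> 0} \<subseteq> N" if "open N" "0 \<in> N" for N
    using B(3)[OF that] by (rule eventually_mono) (use v in blast)
  moreover have "cutoff (v i) \<and> (\<exists>N. open N \<and> 0 \<in> N \<and> (\<forall>x\<in>N. v i x = 1))" for i
    using v[rule_format, of i] by blast
  ultimately show ?thesis by blast
qed

lemma smooth_of_real: "smooth f \<Longrightarrow> smooth (\<lambda>x. of_real (f x) :: complex)"
  using Ck_map_of_real by (auto simp: smooth_def)

lemma csupp_of_real: "csupp f \<Longrightarrow> csupp (\<lambda>x. of_real (f x) :: complex)"
  by (erule csupp_imp) simp

lemma smooth_Ck_map: "smooth f \<Longrightarrow> Ck_map k f"
  by (simp add: smooth_def)

text \<open>Stone-Weierstrass for the algebra of smooth real functions, which separates points by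
  means of cutoffs, applied to real and imaginary parts. It bridges the gap between C^2 functions
  and the smooth ones on which a generating functional is given.\<close>

lemma smooth_approximation:
  fixes h :: "'g \<Rightarrow> complex"
  assumes S: "compact S" and h: "continuous_on UNIV h" and e: "0 < e"
  shows "\<exists>w. smooth w \<and> (\<forall>x\<in>S. norm (h x - w x) \<le> e)"
proof -
  let ?R = "{f :: 'g \<Rightarrow> real. smooth f}"
  interpret R: function_ring_on ?R S
  proof
    show "continuous_on S f" if "f \<in> ?R" for f
      using that Ck_map_continuous[of 0 f] continuous_on_subset[of UNIV f S] by (simp add: smooth_def)
    show "(\<lambda>x. f x + g x) \<in> ?R" "(\<lambda>x. f x * g x) \<in> ?R" if "f \<in> ?R" "g \<in> ?R" for f g
      using that by (auto simp: smooth_def intro: Ck_map_add Ck_map_mult)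
    show "(\<lambda>_. c) \<in> ?R" for c using Ck_map_const by (auto simp: smooth_def)
    fix x y :: 'g assume "x \<noteq> y"
    then obtain W where W: "open W" "x \<in> W" "y \<notin> W" using t1_space by blast
    obtain u N where "cutoff u" "{z. u z \<noteq> 0} \<subseteq> W" "{x} \<subseteq> N" "\<forall>z\<in>N. u z = 1"
      using ex_cutoff_function[of "{x}" W] W by auto
    then have "u \<in> ?R" "u x = 1" "u y = 0" using W(3) by (auto simp: cutoff_def)
    then have "u \<in> ?R \<and> u x \<noteq> u y" by simp
    then show "\<exists>f\<in>?R. f x \<noteq> f y" by blast
  qed (rule S)
  have "continuous_on S (\<lambda>x. Re (h x))" "continuous_on S (\<lambda>x. Im (h x))"
    using continuous_on_subset[OF h] by (auto intro!: continuous_intros)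
  then obtain p q where pq: "p \<in> ?R" "\<And>x. x \<in> S \<Longrightarrow> \<bar>Re (h x) - p x\<bar> < e / 2"
    "q \<in> ?R" "\<And>x. x \<in> S \<Longrightarrow> \<bar>Im (h x) - q x\<bar> < e / 2"
    using R.Stone_Weierstrass_basic[of _ "e / 2"] e by (metis half_gt_zero)
  let ?w = "\<lambda>x. of_real (p x) + \<i> * of_real (q x)"
  have "smooth ?w"
    using pq by (auto simp: smooth_def intro!: Ck_map_add Ck_map_mult Ck_map_const Ck_map_of_real)
  moreover have "norm (h x - ?w x) \<le> e" if "x \<in> S" for x
  proof -
    have "norm (h x - ?w x) \<le> \<bar>Re (h x - ?w x)\<bar> + \<bar>Im (h x - ?w x)\<bar>" by (rule cmod_le)
    then show ?thesis using pq(2,4)[OF that] by simp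
  qed
  ultimately show ?thesis by blast
qed

end

section \<open>Convolution semigroups\<close>

locale semigroup_of_measures =
  fixes \<mu> :: "real \<Rightarrow> 'g::{topological_group_add, t2_space, second_countable_topology} measure"
  assumes sg: "convolution_semigroup \<mu>"
begin

lemma sets_\<mu>: "0 < t \<Longrightarrow> sets (\<mu> t) = sets borel"
  and subprob_\<mu>: "0 < t \<Longrightarrow> subprob_space (\<mu> t)"
  and conv_\<mu>: "0 < s \<Longrightarrow> 0 < t \<Longrightarrow> group_convolution (\<mu> s) (\<mu> t) = \<mu> (s + t)"
  and lim_\<mu>: "f \<in> bcontfun \<Longrightarrow> ((\<lambda>t. \<integral>x. f x \<partial>\<mu> t) \<longlongrightarrow> (f 0 :: complex)) (at_right 0)"
  using sg unfolding convolution_semigroup_def by blast+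

lemma space_\<mu>: "0 < t \<Longrightarrow> space (\<mu> t) = UNIV"
  using sets_eq_imp_space_eq[OF sets_\<mu>] by simp

lemma finite_\<mu>: "0 < t \<Longrightarrow> finite_measure (\<mu> t)"
  using subprob_\<mu> subprob_space_def by blast

lemma measure_le_1: "0 < t \<Longrightarrow> measure (\<mu> t) B \<le> 1"
  using subprob_space.subprob_measure_le_1[OF subprob_\<mu>] .

lemma emeasure_le_1: "0 < t \<Longrightarrow> emeasure (\<mu> t) B \<le> 1"
  using subprob_space.subprob_emeasure_le_1[OF subprob_\<mu>] .

lemma emeasure_eq: "0 < t \<Longrightarrow> emeasure (\<mu> t) B = ennreal (measure (\<mu> t) B)"
  using finite_measure.emeasure_eq_measure[OF finite_\<mu>] .

lemma meas_\<mu>: "0 < t \<Longrightarrow> f \<in> borel_measurable borel \<Longrightarrow> f \<in> borel_measurable (\<mu> t)"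
  using measurable_cong_sets[OF sets_\<mu> refl] by blast

lemma integrable_bounded:
  fixes f :: "'g \<Rightarrow> 'b::{banach, second_countable_topology}"
  shows "0 < t \<Longrightarrow> f \<in> borel_measurable borel \<Longrightarrow> (\<And>x. norm (f x) \<le> B) \<Longrightarrow> integrable (\<mu> t) f"
  by (rule finite_measure.integrable_const_bound[OF finite_\<mu> AE_I2 meas_\<mu>])

lemma norm_integral_le:
  fixes f :: "'g \<Rightarrow> 'b::{banach, second_countable_topology}"
  assumes t: "0 < t" and f: "f \<in> borel_measurable borel" and g: "g \<in> borel_measurable borel"
    and fg: "\<And>x. norm (f x) \<le> g x" and gB: "\<And>x. g x \<le> B"
  shows "norm (\<integral>x. f x \<partial>\<mu> t) \<le> (\<integral>x. g x \<partial>\<mu> t)"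
proof -
  have g0: "0 \<le> g x" for x using fg[of x] norm_ge_zero order_trans by blast
  have "integrable (\<mu> t) f" by (rule integrable_bounded[OF t f, of B]) (use fg gB order_trans in blast)
  moreover have "integrable (\<mu> t) g" by (rule integrable_bounded[OF t g, of B]) (use g0 gB in auto)
  ultimately show ?thesis
    using fg by (intro order_trans[OF integral_norm_bound integral_mono] integrable_norm)
qed

lemma norm_integral_le_const:
  fixes f :: "'g \<Rightarrow> 'b::{banach, second_countable_topology}"
  assumes t: "0 < t" and f: "f \<in> borel_measurable borel" and B: "\<And>x. norm (f x) \<le> B"
  shows "norm (\<integral>x. f x \<partial>\<mu> t) \<le> B"
proof -
  have B0: "0 \<le> B" using B norm_ge_zero order_trans by blast
  have "norm (\<integral>x. f x \<partial>\<mu> t) \<le> (\<integral>x. B \<partial>\<mu> t)" by (rule norm_integral_le[OF t f _ B order_refl]) simp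
  also have "\<dots> = measure (\<mu> t) UNIV * B" by (simp add: space_\<mu>[OF t])
  also have "\<dots> \<le> 1 * B" by (intro mult_right_mono measure_le_1 t B0)
  finally show ?thesis by simp
qed

lemma pair_meas: "0 < s \<Longrightarrow> 0 < t \<Longrightarrow> (\<lambda>p. fst p + snd p) \<in> borel_measurable (\<mu> s \<Otimes>\<^sub>M \<mu> t)"
proof -
  assume "0 < s" "0 < t"
  then have 1: "sets (\<mu> s \<Otimes>\<^sub>M \<mu> t) = sets (borel \<Otimes>\<^sub>M borel)"
    by (intro sets_pair_measure_cong sets_\<mu>)
  have "(\<lambda>p. fst p + snd p :: 'g) \<in> borel_measurable (borel \<Otimes>\<^sub>M borel)" by measurable
  then show ?thesis using measurable_cong_sets[OF 1 refl] by blast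
qed

lemma nn_integral_conv:
  assumes st: "0 < s" "0 < t" and f: "f \<in> borel_measurable borel"
  shows "(\<integral>\<^sup>+x. f x \<partial>\<mu> (s + t)) = (\<integral>\<^sup>+x. \<integral>\<^sup>+y. f (x + y) \<partial>\<mu> t \<partial>\<mu> s)"
proof -
  interpret t: finite_measure "\<mu> t" using finite_\<mu> st by blast
  have m: "(\<lambda>p. f (fst p + snd p)) \<in> borel_measurable (\<mu> s \<Otimes>\<^sub>M \<mu> t)"
    using measurable_compose[OF pair_meas[OF st] f] .
  have "(\<integral>\<^sup>+x. f x \<partial>\<mu> (s + t)) = (\<integral>\<^sup>+p. f (fst p + snd p) \<partial>(\<mu> s \<Otimes>\<^sub>M \<mu> t))"
    unfolding conv_\<mu>[OF st, symmetric] group_convolution_def case_prod_beta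
    by (rule nn_integral_distr[OF pair_meas[OF st]]) (use f in simp)
  also have "\<dots> = (\<integral>\<^sup>+x. \<integral>\<^sup>+y. f (x + y) \<partial>\<mu> t \<partial>\<mu> s)"
    using t.nn_integral_fst[OF m] by simp
  finally show ?thesis .
qed

lemma integral_conv:
  fixes f :: "'g \<Rightarrow> 'b::{banach, second_countable_topology}"
  assumes st: "0 < s" "0 < t" and f: "f \<in> borel_measurable borel" and B: "\<And>x. norm (f x) \<le> B"
  shows "(\<integral>x. f x \<partial>\<mu> (s + t)) = (\<integral>x. \<integral>y. f (x + y) \<partial>\<mu> t \<partial>\<mu> s)"
    and "(\<lambda>x. \<integral>y. f (x + y) \<partial>\<mu> t) \<in> borel_measurable borel"
proof -
  interpret t: finite_measure "\<mu> t" using finite_\<mu> st by blast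
  interpret s: finite_measure "\<mu> s" using finite_\<mu> st by blast
  interpret st: pair_sigma_finite "\<mu> s" "\<mu> t" ..
  interpret stf: finite_measure "\<mu> s \<Otimes>\<^sub>M \<mu> t" using finite_measure_pair_measure finite_\<mu> st by blast
  have m: "(\<lambda>p. f (fst p + snd p)) \<in> borel_measurable (\<mu> s \<Otimes>\<^sub>M \<mu> t)"
    using measurable_compose[OF pair_meas[OF st] f] .
  have i: "integrable (\<mu> s \<Otimes>\<^sub>M \<mu> t) (\<lambda>p. f (fst p + snd p))"
    by (rule stf.integrable_const_bound[OF _ m, of B]) (use B in auto)
  have "(\<integral>x. f x \<partial>\<mu> (s + t)) = (\<integral>p. f (fst p + snd p) \<partial>(\<mu> s \<Otimes>\<^sub>M \<mu> t))"
    unfolding conv_\<mu>[OF st, symmetric] group_convolution_def case_prod_beta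
    by (rule integral_distr[OF pair_meas[OF st] f])
  also have "\<dots> = (\<integral>x. \<integral>y. f (x + y) \<partial>\<mu> t \<partial>\<mu> s)"
    using st.integral_fst'[OF i] by simp
  finally show "(\<integral>x. f x \<partial>\<mu> (s + t)) = (\<integral>x. \<integral>y. f (x + y) \<partial>\<mu> t \<partial>\<mu> s)" .
  have "case_prod (\<lambda>x y. f (x + y)) \<in> borel_measurable (\<mu> s \<Otimes>\<^sub>M \<mu> t)" using m by (simp add: case_prod_beta)
  then have "(\<lambda>x. \<integral>y. f (x + y) \<partial>\<mu> t) \<in> borel_measurable (\<mu> s)" by (rule t.borel_measurable_lebesgue_integral)
  then show "(\<lambda>x. \<integral>y. f (x + y) \<partial>\<mu> t) \<in> borel_measurable borel"
    using measurable_cong_sets[OF sets_\<mu>[OF st(1)] refl] by blast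
qed

lemma lim_\<mu>_real:
  fixes f :: "'g \<Rightarrow> real"
  assumes "continuous_on UNIV f" "\<And>x. \<bar>f x\<bar> \<le> B"
  shows "((\<lambda>t. \<integral>x. f x \<partial>\<mu> t) \<longlongrightarrow> f 0) (at_right 0)"
proof -
  have "(\<lambda>x. complex_of_real (f x)) \<in> bcontfun"
    using assms by (auto simp: bcontfun_def bounded_iff intro!: continuous_intros)
  from tendsto_Re[OF lim_\<mu>[OF this]] show ?thesis by simp
qed

text \<open>Since \<mu>(h) is the convolution of \<mu>(s) and \<mu>(h - s), continuity from the
  right at \<open>s\<close> reduces to weak continuity at 0 under the integral over
  \<mu>(s).\<close>

lemma integral_right_continuous:
  fixes f :: "'g \<Rightarrow> real"
  assumes f: "continuous_on UNIV f" "\<And>x. \<bar>f x\<bar> \<le> B" and s: "0 < s"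
    and h: "\<And>k. s < h k" "h \<longlonglongrightarrow> s"
  shows "(\<lambda>k. \<integral>x. f x \<partial>\<mu> (h k)) \<longlonglongrightarrow> (\<integral>x. f x \<partial>\<mu> s)"
proof -
  have fm: "f \<in> borel_measurable borel" using f by (simp add: borel_measurable_continuous_onI)
  have h0: "0 < h k - s" for k using h(1)[of k] by simp
  have "filterlim (\<lambda>k. h k - s) (at_right 0) sequentially"
    using tendsto_diff[OF h(2) tendsto_const[of s]] h0
    by (auto simp: filterlim_at intro!: always_eventually)
  have "(\<lambda>k. \<integral>x. \<integral>y. f (x + y) \<partial>\<mu> (h k - s) \<partial>\<mu> s) \<longlonglongrightarrow> (\<integral>x. f x \<partial>\<mu> s)"
  proof (rule integral_dominated_convergence[where w="\<lambda>_. B"])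
    show "f \<in> borel_measurable (\<mu> s)" using meas_\<mu>[OF s fm] .
    show "(\<lambda>x. \<integral>y. f (x + y) \<partial>\<mu> (h k - s)) \<in> borel_measurable (\<mu> s)" for k
      using meas_\<mu>[OF s integral_conv(2)[OF s h0 fm, of B]] f(2) by simp
    show "integrable (\<mu> s) (\<lambda>_. B)" using integrable_bounded[OF s, of "\<lambda>_. B" "\<bar>B\<bar>"] by simp
    show "AE x in \<mu> s. (\<lambda>k. \<integral>y. f (x + y) \<partial>\<mu> (h k - s)) \<longlonglongrightarrow> f x"
    proof (rule AE_I2)
      fix x
      have "continuous_on UNIV (\<lambda>y. f (x + y))"
        by (rule continuous_on_compose2[OF f(1)]) (auto intro!: continuous_intros)
      from lim_\<mu>_real[OF this, of B] f(2) have "((\<lambda>t. \<integral>y. f (x + y) \<partial>\<mu> t) \<longlongrightarrow> f x) (at_right 0)" by simp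
      from filterlim_compose[OF this \<open>filterlim _ (at_right 0) sequentially\<close>]
      show "(\<lambda>k. \<integral>y. f (x + y) \<partial>\<mu> (h k - s)) \<longlonglongrightarrow> f x" .
    qed
    show "AE x in \<mu> s. norm (\<integral>y. f (x + y) \<partial>\<mu> (h k - s)) \<le> B" for k
      using norm_integral_le_const[OF h0, of "\<lambda>y. f (_ + y)" B] f(2) fm by (intro AE_I2) auto
  qed
  moreover have "(\<integral>x. \<integral>y. f (x + y) \<partial>\<mu> (h k - s) \<partial>\<mu> s) = (\<integral>x. f x \<partial>\<mu> (h k))" for k
    using integral_conv(1)[OF s h0 fm, of B] f(2) by simp
  ultimately show ?thesis by simp
qed

text \<open>This permits integration over the time \<open>s\<close> in
  \<open>uniformly_concentrated\<close>. By right continuity the function is a limit of functions of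
  \<open>s\<close> with countably many values on bounded pieces of a grid.\<close>

lemma integral_borel_measurable:
  fixes f :: "'g \<Rightarrow> real"
  assumes f: "continuous_on UNIV f" "\<And>x. \<bar>f x\<bar> \<le> B"
  shows "(\<lambda>s. if 0 < s then \<integral>x. f x \<partial>\<mu> s else 0) \<in> borel_measurable borel"
proof (rule borel_measurable_LIMSEQ_metric)
  \<comment> \<open>The next grid point strictly above \<open>s\<close>: the added 1 keeps the
    inequality strict when \<open>s\<close> itself is a grid point.\<close>
  let ?r = "\<lambda>k s::real. (of_int \<lfloor>real (Suc k) * s\<rfloor> + 1) / real (Suc k)"
  let ?m = "\<lambda>k s. if 0 < s then \<integral>x. f x \<partial>\<mu> (?r k s) else 0"
  show "?m k \<in> borel_measurable borel" for k
  proof -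
    have "(\<lambda>s::real. \<lfloor>real (Suc k) * s\<rfloor>) \<in> borel \<rightarrow>\<^sub>M count_space UNIV" by measurable
    from measurable_compose[OF this, of "\<lambda>i. \<integral>x. f x \<partial>\<mu> ((of_int i + 1) / real (Suc k))" borel]
    have "(\<lambda>s. \<integral>x. f x \<partial>\<mu> (?r k s)) \<in> borel_measurable borel" by simp
    then show ?thesis by measurable
  qed
  fix s :: real
  show "(\<lambda>k. ?m k s) \<longlonglongrightarrow> (if 0 < s then \<integral>x. f x \<partial>\<mu> s else 0)"
  proof (cases "0 < s")
    case True
    have gt: "s < ?r k s" for k
    proof -
      have "real (Suc k) * s < of_int \<lfloor>real (Suc k) * s\<rfloor> + 1" by linarith
      then show ?thesis by (simp add: less_divide_eq mult.commute)
    qed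
    have "?r k s \<le> s + 1 / real (Suc k)" for k
    proof -
      have "of_int \<lfloor>real (Suc k) * s\<rfloor> + 1 \<le> real (Suc k) * s + 1" by linarith
      then show ?thesis by (simp add: divide_le_eq distrib_left distrib_right mult.commute)
    qed
    moreover have lim: "(\<lambda>k. s + 1 / real (Suc k)) \<longlonglongrightarrow> s"
      using tendsto_add[OF tendsto_const LIMSEQ_inverse_real_of_nat, of s] by (simp only: inverse_eq_divide add_0_right)
    ultimately have "(\<lambda>k. ?r k s) \<longlonglongrightarrow> s"
      using tendsto_sandwich[OF always_eventually always_eventually tendsto_const lim, of "\<lambda>k. ?r k s"]
        less_imp_le[OF gt] by simp
    from integral_right_continuous[OF f True gt this] True show ?thesis by simp
  qed simp
qed

text \<open>By the hypothesis on \<open>V\<close>, u(x + y) + u(y) can exceed 1 only for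
  \<open>x\<close> in \<open>V\<close>. Integrating this over the convolution bounds the mass that
  \<mu>(t) lacks in \<open>V\<close> by what the integrals of \<open>u\<close> lack from 1 at the
  times \<open>s\<close> and \<open>t + s\<close>.\<close>

lemma translated_mass:
  fixes u :: "'g \<Rightarrow> real"
  assumes st: "0 < s" "0 < t" and u: "u \<in> borel_measurable borel" "\<And>x. 0 \<le> u x \<and> u x \<le> 1"
    and V: "V \<in> sets borel" "\<And>x y. u (x + y) \<noteq> 0 \<Longrightarrow> u y \<noteq> 0 \<Longrightarrow> x \<in> V"
  shows "(\<integral>x. u x \<partial>\<mu> (t + s)) + (\<integral>x. u x \<partial>\<mu> s) \<le> measure (\<mu> t) V + 1"
proof -
  let ?m = "\<integral>x. u x \<partial>\<mu> s" and ?S = "measure (\<mu> s) UNIV"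
  have ub: "norm (u x) \<le> 1" for x using u(2)[of x] by simp
  have ui: "integrable (\<mu> s) u" using integrable_bounded[OF st(1) u(1) ub] .
  have le: "u (x + y) \<le> indicator V x + (1 - u y)" for x y
    using V(2)[of x y] u(2)[of y] u(2)[of "x + y"]
    by (cases "u y = 0"; cases "u (x + y) = 0") (auto simp: indicator_def)
  have m_le: "?m \<le> ?S"
  proof -
    have "?m \<le> (\<integral>x. 1 \<partial>\<mu> s)" using ui integrable_bounded[OF st(1), of "\<lambda>_. 1::real" 1] u(2)
      by (intro integral_mono) auto
    then show ?thesis by (simp add: space_\<mu>[OF st(1)])
  qed
  have inner: "(\<integral>y. u (x + y) \<partial>\<mu> s) \<le> indicator V x * ?S + (?S - ?m)" for x
  proof -
    have "(\<integral>y. u (x + y) \<partial>\<mu> s) \<le> (\<integral>y. indicator V x + (1 - u y) \<partial>\<mu> s)"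
    proof (rule integral_mono)
      show "integrable (\<mu> s) (\<lambda>y. u (x + y))"
        by (rule integrable_bounded[OF st(1) _ ub]) (use u(1) in measurable)
      show "integrable (\<mu> s) (\<lambda>y. indicator V x + (1 - u y))"
        using ui integrable_bounded[OF st(1), of "\<lambda>_. 1::real" 1]
          integrable_bounded[OF st(1), of "\<lambda>_. indicator V x::real" 1] by (auto simp: indicator_def)
    qed (rule le)
    also have "\<dots> = indicator V x * ?S + (?S - ?m)"
      using ui integrable_bounded[OF st(1), of "\<lambda>_. 1::real" 1]
        integrable_bounded[OF st(1), of "\<lambda>_. indicator V x::real" 1]
      by (simp add: space_\<mu>[OF st(1)] indicator_def)
    finally show ?thesis .
  qed
  have "(\<integral>x. u x \<partial>\<mu> (t + s)) = (\<integral>x. \<integral>y. u (x + y) \<partial>\<mu> s \<partial>\<mu> t)"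
    by (rule integral_conv(1)[OF st(2,1) u(1) ub])
  also have "\<dots> \<le> (\<integral>x. indicator V x * ?S + (?S - ?m) \<partial>\<mu> t)"
  proof (rule integral_mono)
    show "integrable (\<mu> t) (\<lambda>x. \<integral>y. u (x + y) \<partial>\<mu> s)"
    proof (rule integrable_bounded[OF st(2)])
      show "norm (\<integral>y. u (x + y) \<partial>\<mu> s) \<le> 1" for x
        by (rule norm_integral_le_const[OF st(1) _ ub]) (use u(1) in measurable)
    qed (rule integral_conv(2)[OF st(2,1) u(1) ub])
    show "integrable (\<mu> t) (\<lambda>x. indicator V x * ?S + (?S - ?m))"
    proof (rule integrable_bounded[OF st(2)])
      show "(\<lambda>x. indicator V x * ?S + (?S - ?m)) \<in> borel_measurable borel" using V(1) by measurable
      show "norm (indicator V x * ?S + (?S - ?m)) \<le> ?S + (?S - ?m)" for x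
        using m_le by (auto simp: indicator_def)
    qed
  qed (rule inner)
  also have "\<dots> = measure (\<mu> t) V * ?S + (?S - ?m) * measure (\<mu> t) UNIV"
  proof -
    have "integrable (\<mu> t) (\<lambda>x. indicator V x * ?S)"
      by (rule integrable_bounded[OF st(2), where B = ?S]) (use V(1) in \<open>auto simp: indicator_def\<close>)
    moreover have "integrable (\<mu> t) (\<lambda>x. ?S - ?m)"
      by (rule integrable_bounded[OF st(2), where B = "?S - ?m"]) (use m_le in auto)
    ultimately show ?thesis
      using V(1) by (simp add: space_\<mu>[OF st(2)] sets_\<mu>[OF st(2)])
  qed
  also have "\<dots> \<le> measure (\<mu> t) V * 1 + (1 - ?m) * 1"
  proof -
    have "measure (\<mu> t) V * ?S \<le> measure (\<mu> t) V * 1"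
      by (intro mult_left_mono measure_le_1 st) auto
    moreover have "(?S - ?m) * measure (\<mu> t) UNIV \<le> (?S - ?m) * 1"
      using m_le by (intro mult_left_mono measure_le_1 st) auto
    ultimately have "measure (\<mu> t) V * ?S + (?S - ?m) * measure (\<mu> t) UNIV \<le> measure (\<mu> t) V * 1 + (?S - ?m) * 1"
      by (rule add_mono)
    also have "\<dots> \<le> measure (\<mu> t) V * 1 + (1 - ?m) * 1"
      using measure_le_1[OF st(1), of UNIV] by simp
    finally show ?thesis .
  qed
  finally show ?thesis by simp
qed

section \<open>Large jumps\<close>

text \<open>The mass of \<open>small_steps t L h i\<close> at \<open>x\<close> is that of \<open>i\<close> steps of \<open>\<mu> t\<close> from \<open>x\<close> all of which lie in \<open>L\<close>,
  weighted by the value of \<open>h\<close> at the end point.\<close>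

primrec small_steps :: "real \<Rightarrow> 'g set \<Rightarrow> ('g \<Rightarrow> ennreal) \<Rightarrow> nat \<Rightarrow> 'g \<Rightarrow> ennreal" where
  "small_steps t L h 0 = h"
| "small_steps t L h (Suc i) = (\<lambda>x. \<integral>\<^sup>+y. indicator L y * small_steps t L h i (x + y) \<partial>\<mu> t)"

text \<open>The mean of \<open>h\<close> after \<open>i\<close> unrestricted steps from
  \<open>x\<close>. The case i = 0 is separate because the semigroup has only positive times; the
  unit mass at the identity takes its place.\<close>

definition steps :: "real \<Rightarrow> ('g \<Rightarrow> ennreal) \<Rightarrow> nat \<Rightarrow> 'g \<Rightarrow> ennreal" where
  "steps t h i x = (if i = 0 then h x else \<integral>\<^sup>+w. h (x + w) \<partial>\<mu> (real i * t))"

lemma meas_translate_nn: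
  assumes t: "0 < t" and f: "case_prod f \<in> borel_measurable (borel \<Otimes>\<^sub>M borel)"
  shows "(\<lambda>x::'g. \<integral>\<^sup>+y. f x y \<partial>\<mu> t :: ennreal) \<in> borel_measurable borel"
proof -
  interpret t: finite_measure "\<mu> t" using finite_\<mu> t by blast
  have "sets (borel \<Otimes>\<^sub>M \<mu> t) = sets (borel \<Otimes>\<^sub>M borel)"
    by (intro sets_pair_measure_cong sets_\<mu> t refl)
  then have "case_prod f \<in> borel_measurable (borel \<Otimes>\<^sub>M \<mu> t)"
    using f measurable_cong_sets by blast
  then show ?thesis by (rule t.borel_measurable_nn_integral)
qed

lemma small_steps_meas:
  assumes t: "0 < t" and h: "h \<in> borel_measurable borel" and L: "L \<in> sets borel"
  shows "small_steps t L h i \<in> borel_measurable borel"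
proof (induction i)
  case (Suc i)
  note [measurable] = Suc L
  show ?case unfolding small_steps.simps
    by (rule meas_translate_nn[OF t]) measurable
qed (simp add: h)

lemma steps_Suc:
  assumes t: "0 < t" and h: "h \<in> borel_measurable borel"
  shows "steps t h (Suc i) x = (\<integral>\<^sup>+y. steps t h i (x + y) \<partial>\<mu> t)"
proof (cases "i = 0")
  case False
  then have it: "0 < real i * t" using t by simp
  have m: "(\<lambda>w. h (x + w)) \<in> borel_measurable borel" using h by measurable
  have "real (Suc i) * t = t + real i * t" by (simp add: algebra_simps)
  then show ?thesis using nn_integral_conv[OF t it m] False by (simp add: steps_def add.assoc)
qed (simp add: steps_def)

lemma steps_meas:
  assumes t: "0 < t" and h: "h \<in> borel_measurable borel"
  shows "steps t h i \<in> borel_measurable borel"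
proof (induction i)
  case 0
  then show ?case using h by (simp add: steps_def[abs_def])
next
  case (Suc i)
  note [measurable] = Suc
  have "(\<lambda>x. \<integral>\<^sup>+y. steps t h i (x + y) \<partial>\<mu> t) \<in> borel_measurable borel"
    by (rule meas_translate_nn[OF t]) measurable
  then show ?case using steps_Suc[OF t h, of i] by (simp add: fun_eq_iff[symmetric] cong: measurable_cong)
qed

lemma steps_le_1:
  assumes t: "0 < t" and h: "\<And>x. h x \<le> 1"
  shows "steps t h i x \<le> 1"
proof (cases "i = 0")
  case False
  then have it: "0 < real i * t" using t by simp
  have "(\<integral>\<^sup>+w. h (x + w) \<partial>\<mu> (real i * t)) \<le> (\<integral>\<^sup>+w. 1 \<partial>\<mu> (real i * t))" by (intro nn_integral_mono h)
  also have "\<dots> \<le> 1" using emeasure_le_1[OF it] by simp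
  finally show ?thesis using False by (simp add: steps_def)
qed (simp add: steps_def h)

lemma nn_integral_split:
  assumes t: "0 < t" and L: "L \<in> sets borel" and f: "f \<in> borel_measurable borel"
  shows "(\<integral>\<^sup>+y. f y \<partial>\<mu> t) = (\<integral>\<^sup>+y. indicator L y * f y \<partial>\<mu> t) + (\<integral>\<^sup>+y. indicator (- L) y * f y \<partial>\<mu> t)"
proof -
  note [measurable] = L f
  have "(\<integral>\<^sup>+y. f y \<partial>\<mu> t) = (\<integral>\<^sup>+y. indicator L y * f y + indicator (- L) y * f y \<partial>\<mu> t)"
    by (intro nn_integral_cong) (auto simp: indicator_def)
  also have "\<dots> = (\<integral>\<^sup>+y. indicator L y * f y \<partial>\<mu> t) + (\<integral>\<^sup>+y. indicator (- L) y * f y \<partial>\<mu> t)"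
    by (intro nn_integral_add meas_\<mu> t) measurable
  finally show ?thesis .
qed

lemma nn_integral_indicator_\<mu>: "0 < t \<Longrightarrow> B \<in> sets borel \<Longrightarrow> (\<integral>\<^sup>+y. indicator B y \<partial>\<mu> t) = emeasure (\<mu> t) B"
  using nn_integral_indicator sets_\<mu> by blast

text \<open>A union bound: each of the \<open>i\<close> steps leaves \<open>L\<close> with
  probability at most the mass of \<open>- L\<close>, and \<open>h\<close> is at most 1.\<close>

lemma steps_le_small_steps:
  assumes t: "0 < t" and h: "h \<in> borel_measurable borel" "\<And>x. h x \<le> 1" and L: "L \<in> sets borel"
  shows "steps t h i x \<le> small_steps t L h i x + of_nat i * emeasure (\<mu> t) (- L)"
proof (induction i arbitrary: x)
  case (Suc i)
  let ?b = "emeasure (\<mu> t) (- L)"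
  note [measurable] = L steps_meas[OF t h(1)] small_steps_meas[OF t h(1) L]
  have "steps t h (Suc i) x = (\<integral>\<^sup>+y. steps t h i (x + y) \<partial>\<mu> t)" by (rule steps_Suc[OF t h(1)])
  also have "\<dots> = (\<integral>\<^sup>+y. indicator L y * steps t h i (x + y) \<partial>\<mu> t) + (\<integral>\<^sup>+y. indicator (- L) y * steps t h i (x + y) \<partial>\<mu> t)"
    by (rule nn_integral_split[OF t L]) measurable
  also have "(\<integral>\<^sup>+y. indicator (- L) y * steps t h i (x + y) \<partial>\<mu> t) \<le> (\<integral>\<^sup>+y. indicator (- L) y \<partial>\<mu> t)"
    using steps_le_1[OF t h(2)] by (intro nn_integral_mono) (auto simp: indicator_def)
  also have "(\<integral>\<^sup>+y. indicator (- L) y \<partial>\<mu> t) = ?b"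
    by (rule nn_integral_indicator_\<mu>[OF t]) measurable
  also have "(\<integral>\<^sup>+y. indicator L y * steps t h i (x + y) \<partial>\<mu> t) \<le>
      (\<integral>\<^sup>+y. indicator L y * small_steps t L h i (x + y) + of_nat i * ?b \<partial>\<mu> t)"
    using Suc by (intro nn_integral_mono) (auto simp: indicator_def)
  also have "\<dots> = (\<integral>\<^sup>+y. indicator L y * small_steps t L h i (x + y) \<partial>\<mu> t) + (\<integral>\<^sup>+y. of_nat i * ?b \<partial>\<mu> t)"
    by (intro nn_integral_add meas_\<mu> t) measurable
  also have "(\<integral>\<^sup>+y. of_nat i * ?b \<partial>\<mu> t) \<le> of_nat i * ?b * 1"
    unfolding nn_integral_const by (intro mult_left_mono emeasure_le_1[OF t]) simp
  finally have "steps t h (Suc i) x \<le> small_steps t L h (Suc i) x + of_nat i * ?b * 1 + ?b" by simp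
  then show ?case by (simp add: algebra_simps)
qed (simp add: steps_def)

text \<open>Decomposition of an \<open>m\<close>-step path at its last jump outside \<open>L\<close>: started in \<open>K\<close>, such a jump leads out
  of \<open>K\<close>, and the remaining steps stay in \<open>L0\<close> with probability at least \<open>3/4\<close> before the restriction to jumps
  in \<open>L\<close> and \<open>1/2\<close> after it.\<close>

lemma big_jump_bound:
  assumes t: "0 < t" and sets: "K \<in> sets borel" "L \<in> sets borel" "L0 \<in> sets borel"
    and escape: "\<And>x y w. x \<in> K \<Longrightarrow> y \<notin> L \<Longrightarrow> w \<in> L0 \<Longrightarrow> x + y + w \<notin> K"
    and zero: "0 \<in> L0" "L0 \<subseteq> K"
    and stay: "\<And>k. 1 \<le> k \<Longrightarrow> k \<le> m \<Longrightarrow> 3 / 4 \<le> measure (\<mu> (real k * t)) L0"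
    and few: "real m * measure (\<mu> t) (- L) \<le> 1 / 4" and m: "1 \<le> m"
  shows "real m * (3 / 8) * measure (\<mu> t) (- L) \<le> measure (\<mu> (real m * t)) (- K)"
proof -
  define h :: "'g \<Rightarrow> ennreal" where "h = indicator (- K)"
  define \<beta> where "\<beta> = measure (\<mu> t) (- L)"
  have \<beta>0: "0 \<le> \<beta>" by (simp add: \<beta>_def)
  have \<beta>: "emeasure (\<mu> t) (- L) = ennreal \<beta>" unfolding \<beta>_def by (rule emeasure_eq[OF t])
  have h: "h \<in> borel_measurable borel" "\<And>x. h x \<le> 1"
    unfolding h_def using sets(1) by (measurable, auto simp: indicator_def)
  let ?S = "small_steps t L h"
  note [measurable] = sets small_steps_meas[OF t h(1) sets(2)] h(1)
  \<comment> \<open>The mean of \<open>f\<close> after \<open>j\<close> unrestricted steps from the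
    identity.\<close>
  define I where "I j f = (if j = 0 then f 0 else \<integral>\<^sup>+x. f x \<partial>\<mu> (real j * t))" for j and f :: "'g \<Rightarrow> ennreal"
  have jt: "0 < real j * t" if "j \<noteq> 0" for j using that t by simp
  have I_Suc: "I (Suc j) f = I j (\<lambda>x. \<integral>\<^sup>+y. f (x + y) \<partial>\<mu> t)" if "f \<in> borel_measurable borel" for j f
  proof (cases "j = 0")
    case False
    have "real (Suc j) * t = real j * t + t" by (simp add: algebra_simps)
    then show ?thesis using nn_integral_conv[OF jt[OF False] t that] False by (simp add: I_def)
  qed (simp add: I_def)
  have I_mono: "I j f \<le> I j g" if "\<And>x. f x \<le> g x" for j f g
    using that by (auto simp: I_def intro: nn_integral_mono)
  have I_K: "ennreal (3 / 4) \<le> I j (indicator K)" if "j \<le> m" for j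
  proof (cases "j = 0")
    case True then show ?thesis using zero by (auto simp: I_def)
  next
    case False
    have "3 / 4 \<le> measure (\<mu> (real j * t)) L0" using stay[of j] False that by simp
    also have "\<dots> \<le> measure (\<mu> (real j * t)) K"
      using finite_measure.finite_measure_mono[OF finite_\<mu>[OF jt[OF False]] zero(2)] sets sets_\<mu>[OF jt[OF False]] by simp
    finally show ?thesis
      using nn_integral_indicator_\<mu>[OF jt[OF False] sets(1)] False
      by (simp add: I_def emeasure_eq[OF jt[OF False]] ennreal_leI)
  qed
  have half: "ennreal (1 / 2) \<le> ?S i (x + y)" if "x \<in> K" "y \<notin> L" "i < m" for i x y
  proof -
    have "ennreal (3 / 4) \<le> steps t h i (x + y)"
    proof (cases "i = 0")
      case True
      have "x + y \<notin> K" using escape[OF that(1,2) zero(1)] by simp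
      then show ?thesis using True by (simp add: steps_def h_def)
    next
      case False
      have "ennreal (3 / 4) \<le> emeasure (\<mu> (real i * t)) L0"
        unfolding emeasure_eq[OF jt[OF False]] using stay[of i] False that by (intro ennreal_leI) auto
      also have "\<dots> = (\<integral>\<^sup>+w. indicator L0 w \<partial>\<mu> (real i * t))"
        by (rule nn_integral_indicator_\<mu>[OF jt[OF False] sets(3), symmetric])
      also have "\<dots> \<le> (\<integral>\<^sup>+w. h (x + y + w) \<partial>\<mu> (real i * t))"
        using escape[OF that(1,2)] by (intro nn_integral_mono) (auto simp: h_def indicator_def)
      finally show ?thesis using False by (simp add: steps_def)
    qed
    also have "\<dots> \<le> ?S i (x + y) + of_nat i * emeasure (\<mu> t) (- L)"
      by (rule steps_le_small_steps[OF t h sets(2)])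
    also have "of_nat i * emeasure (\<mu> t) (- L) \<le> ennreal (1 / 4)"
    proof -
      have "real i * \<beta> \<le> real m * \<beta>" using that(3) \<beta>0 by (intro mult_right_mono) auto
      then have "real i * \<beta> \<le> 1 / 4" using few by (simp add: \<beta>_def)
      then show ?thesis unfolding \<beta> by (simp add: ennreal_of_nat_eq_real_of_nat ennreal_mult[symmetric] \<beta>0 ennreal_leI)
    qed
    finally have ge: "ennreal (3 / 4) \<le> ?S i (x + y) + ennreal (1 / 4)" by (simp add: add_left_mono)
    show ?thesis
    proof (cases "?S i (x + y)")
      case (real r)
      then have "1 / 2 \<le> r"
        using ge by (simp add: ennreal_plus[symmetric] del: ennreal_plus)
      then show ?thesis using real by (simp only: ennreal_leI)
    qed simp
  qed
  \<comment> \<open>The last unrestricted step is split according to whether it stays in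
    \<open>L\<close>. A jump out of \<open>L\<close> contributes at least 3/4 (for being in
    \<open>K\<close> before it) times \<open>\<beta>\<close> times 1/2 (from \<open>half\<close>),
    that is 3/8 of \<open>\<beta>\<close>.\<close>
  have step: "I (Suc j) (?S i) \<ge> I j (?S (Suc i)) + ennreal (3 / 8 * \<beta>)" if "i < m" "j \<le> m" for i j
  proof -
    have "?S (Suc i) x + ennreal (1 / 2 * \<beta>) * indicator K x \<le> (\<integral>\<^sup>+y. ?S i (x + y) \<partial>\<mu> t)" for x
    proof -
      have "(\<integral>\<^sup>+y. ?S i (x + y) \<partial>\<mu> t) = ?S (Suc i) x + (\<integral>\<^sup>+y. indicator (- L) y * ?S i (x + y) \<partial>\<mu> t)"
        unfolding small_steps.simps by (rule nn_integral_split[OF t sets(2)]) measurable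
      moreover have "ennreal (1 / 2 * \<beta>) * indicator K x \<le> (\<integral>\<^sup>+y. indicator (- L) y * ?S i (x + y) \<partial>\<mu> t)"
      proof (cases "x \<in> K")
        case True
        have "ennreal (1 / 2 * \<beta>) = ennreal (1 / 2) * emeasure (\<mu> t) (- L)"
          unfolding \<beta> by (subst ennreal_mult) (auto simp: \<beta>0)
        also have "\<dots> = (\<integral>\<^sup>+y. ennreal (1 / 2) * indicator (- L) y \<partial>\<mu> t)"
          using sets(2) sets_\<mu>[OF t] by (subst nn_integral_cmult_indicator) auto
        also have "\<dots> \<le> (\<integral>\<^sup>+y. indicator (- L) y * ?S i (x + y) \<partial>\<mu> t)"
          using half[OF True _ that(1)] by (intro nn_integral_mono) (auto simp: indicator_def)
        finally show ?thesis using True by simp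
      qed simp
      ultimately show ?thesis by (simp add: add_left_mono)
    qed
    then have A: "I j (\<lambda>x. ?S (Suc i) x + ennreal (1 / 2 * \<beta>) * indicator K x) \<le> I (Suc j) (?S i)"
      unfolding I_Suc[OF small_steps_meas[OF t h(1) sets(2)]] by (rule I_mono)
    have B: "I j (\<lambda>x. ?S (Suc i) x + ennreal (1 / 2 * \<beta>) * indicator K x) =
        I j (?S (Suc i)) + ennreal (1 / 2 * \<beta>) * I j (indicator K)"
    proof (cases "j = 0")
      case False
      have "(\<integral>\<^sup>+x. ?S (Suc i) x + ennreal (1 / 2 * \<beta>) * indicator K x \<partial>\<mu> (real j * t)) =
        (\<integral>\<^sup>+x. ?S (Suc i) x \<partial>\<mu> (real j * t)) + (\<integral>\<^sup>+x. ennreal (1 / 2 * \<beta>) * indicator K x \<partial>\<mu> (real j * t))"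
        by (intro nn_integral_add meas_\<mu>[OF jt[OF False]] small_steps_meas[OF t h(1) sets(2)]) measurable
      also have "(\<integral>\<^sup>+x. ennreal (1 / 2 * \<beta>) * indicator K x \<partial>\<mu> (real j * t)) =
        ennreal (1 / 2 * \<beta>) * (\<integral>\<^sup>+x. indicator K x \<partial>\<mu> (real j * t))"
        by (intro nn_integral_cmult meas_\<mu>[OF jt[OF False]]) measurable
      finally show ?thesis using False by (simp add: I_def)
    qed (simp add: I_def)
    have C: "ennreal (3 / 8 * \<beta>) \<le> ennreal (1 / 2 * \<beta>) * I j (indicator K)"
    proof -
      have "ennreal (3 / 8 * \<beta>) = ennreal (1 / 2 * \<beta>) * ennreal (3 / 4)"
        using \<beta>0 by (simp add: ennreal_mult[symmetric])
      then show ?thesis using I_K[OF that(2)] by (simp add: mult_left_mono)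
    qed
    from order_trans[OF add_left_mono[OF C] A[unfolded B]] show ?thesis .
  qed
  \<comment> \<open>The contributions of the possible positions of the last big jump are collected
    one by one; at k = m the remaining first summand is dropped.\<close>
  have "I (m - k) (?S k) + ennreal (real k * (3 / 8 * \<beta>)) \<le> I m h" if "k \<le> m" for k
    using that
  proof (induction k)
    case (Suc k)
    have eq: "m - k = Suc (m - Suc k)" using Suc.prems by simp
    have "I (m - Suc k) (?S (Suc k)) + ennreal (real (Suc k) * (3 / 8 * \<beta>)) =
        (I (m - Suc k) (?S (Suc k)) + ennreal (3 / 8 * \<beta>)) + ennreal (real k * (3 / 8 * \<beta>))"
      using \<beta>0 by (simp add: distrib_right ennreal_plus add_ac del: ennreal_plus add: ennreal_plus[symmetric])
    also have "\<dots> \<le> I (Suc (m - Suc k)) (?S k) + ennreal (real k * (3 / 8 * \<beta>))"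
      using Suc.prems by (intro add_right_mono step) auto
    also have "\<dots> \<le> I m h" using Suc eq by simp
    finally show ?case .
  qed simp
  from this[of m] have "ennreal (real m * (3 / 8 * \<beta>)) \<le> I m h"
    by (metis add_increasing order_refl order_trans zero_le)
  also have "I m h = emeasure (\<mu> (real m * t)) (- K)"
    using m nn_integral_indicator_\<mu>[OF jt, of m "- K"] sets(1) by (simp add: I_def h_def)
  also have "\<dots> = ennreal (measure (\<mu> (real m * t)) (- K))" using m by (intro emeasure_eq jt) auto
  finally show ?thesis by (simp add: \<beta>_def mult.assoc)
qed

section \<open>Difference quotients of the semigroup\<close>

definition quot :: "real \<Rightarrow> ('g \<Rightarrow> complex) \<Rightarrow> complex" where
  "quot t f = ((\<integral>x. f x \<partial>\<mu> t) - f 0) / of_real t"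

lemma quot_linear:
  assumes "0 < t" "f \<in> borel_measurable borel" "g \<in> borel_measurable borel"
    "\<And>x. norm (f x) \<le> B" "\<And>x. norm (g x) \<le> B'"
  shows "quot t (\<lambda>x. a * f x + c * g x) = a * quot t f + c * quot t g"
  using integrable_bounded[OF assms(1,2,4)] integrable_bounded[OF assms(1,3,5)]
  by (simp add: quot_def divide_simps algebra_simps)

text \<open>The increment of \<open>\<integral>f d\<mu>\<close> from time \<open>kt\<close> to \<open>(k + 1)t\<close> is \<open>t\<close> times the \<open>\<mu> (kt)\<close>-average of the quotients
  of the translates of \<open>f\<close>.\<close>

lemma quot_telescope:
  fixes f :: "'g \<Rightarrow> complex"
  assumes t: "0 < t" and f: "f \<in> borel_measurable borel" "\<And>x. norm (f x) \<le> B" and V: "V \<in> sets borel"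
    and a: "0 \<le> a" "\<And>x. x \<in> V \<Longrightarrow> norm (quot t (\<lambda>y. f (x + y) - f y)) \<le> a"
    and c: "\<And>x. norm (quot t (\<lambda>y. f (x + y) - f y)) \<le> c" "norm (quot t f) \<le> c'"
    and \<delta>: "\<And>k. 1 \<le> k \<Longrightarrow> k < m \<Longrightarrow> 1 - measure (\<mu> (real k * t)) V \<le> \<delta>" "0 \<le> \<delta>" and m: "1 \<le> m"
  shows "norm (quot (real m * t) f - quot t f) \<le> a + (c + c') * \<delta>"
proof -
  let ?R = "a + (c + c') * \<delta>"
  have c0: "0 \<le> c" "0 \<le> c'" using c norm_ge_zero order_trans by blast+
  then have R0: "0 \<le> ?R" using a \<delta> by simp
  have main: "norm ((\<integral>x. f x \<partial>\<mu> (real k * t)) - f 0 - real k * t * quot t f) \<le> real k * t * ?R"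
    if "1 \<le> k" "k \<le> m" for k
    using that
  proof (induction k rule: dec_induct)
    case base
    have "(\<integral>x. f x \<partial>\<mu> (real 1 * t)) - f 0 - real 1 * t * quot t f = 0" using t by (simp add: quot_def)
    then show ?case using t R0 by simp
  next
    case (step k)
    have kt: "0 < real k * t" using step t by simp
    define g where "g x = quot t (\<lambda>y. f (x + y) - f y)" for x
    have fx: "(\<lambda>y. f (x + y)) \<in> borel_measurable borel" for x using f(1) by measurable
    have g_eq: "(\<integral>y. f (x + y) \<partial>\<mu> t) = f x + of_real t * (quot t f + g x)" for x
    proof -
      have "g x = quot t (\<lambda>y. f (x + y)) - quot t f"
        using quot_linear[OF t fx f(1), of x B B 1 "- 1"] f(2) by (simp add: g_def)
      then show ?thesis using t by (simp add: quot_def)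
    qed
    have g_meas: "g \<in> borel_measurable borel"
    proof -
      have "g x = ((\<integral>y. f (x + y) \<partial>\<mu> t) - f x) / of_real t - quot t f" for x
        using t by (simp add: g_eq)
      then have "g = (\<lambda>x. ((\<integral>y. f (x + y) \<partial>\<mu> t) - f x) / of_real t - quot t f)" by blast
      then show ?thesis using integral_conv(2)[OF kt t f] f(1) by simp
    qed
    note gc = c(1)[folded g_def]
    have ig: "integrable (\<mu> (real k * t)) g" by (rule integrable_bounded[OF kt g_meas gc])
    have iq: "integrable (\<mu> (real k * t)) (\<lambda>_. quot t f)" by (rule integrable_bounded[OF kt, where B=c']) (use c in auto)
    have if_: "integrable (\<mu> (real k * t)) f" by (rule integrable_bounded[OF kt f])
    let ?mV = "measure (\<mu> (real k * t)) V" and ?mG = "measure (\<mu> (real k * t)) UNIV"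
    have "?mV \<le> ?mG"
      using finite_measure.finite_measure_mono[OF finite_\<mu>[OF kt], of V UNIV] sets_\<mu>[OF kt] by simp
    have \<delta>k: "1 - ?mV \<le> \<delta>" using \<delta>(1)[of k] step by simp
    have "real (Suc k) * t = real k * t + t" by (simp add: algebra_simps)
    then have "(\<integral>x. f x \<partial>\<mu> (real (Suc k) * t)) = (\<integral>x. f x + of_real t * (quot t f + g x) \<partial>\<mu> (real k * t))"
      using integral_conv(1)[OF kt t f] by (simp add: g_eq)
    also have "\<dots> = (\<integral>x. f x \<partial>\<mu> (real k * t)) + of_real t * (?mG * quot t f + (\<integral>x. g x \<partial>\<mu> (real k * t)))"
      using ig iq if_ by (simp add: space_\<mu>[OF kt] scaleR_conv_of_real)
    \<comment> \<open>One step adds \<open>t\<close> times the mean of \<open>g\<close>, corrected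
      by the mass \<open>1 - ?mG\<close> that \<mu>(kt) lacks as a subprobability measure. As
      \<open>V\<close> has at most the total mass, this defect is at most \<open>\<delta>\<close>
      too.\<close>
    finally have eq: "(\<integral>x. f x \<partial>\<mu> (real (Suc k) * t)) - f 0 - real (Suc k) * t * quot t f =
      ((\<integral>x. f x \<partial>\<mu> (real k * t)) - f 0 - real k * t * quot t f) +
      of_real t * ((\<integral>x. g x \<partial>\<mu> (real k * t)) - of_real (1 - ?mG) * quot t f)"
      by (simp add: algebra_simps)
    have "norm (\<integral>x. g x \<partial>\<mu> (real k * t)) \<le> (\<integral>x. a + c * indicator (- V) x \<partial>\<mu> (real k * t))"
    proof (rule norm_integral_le[OF kt g_meas, where B="a + c"])
      show "(\<lambda>x. a + c * indicator (- V) x) \<in> borel_measurable borel" using V by measurable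
      show "norm (g x) \<le> a + c * indicator (- V) x" for x
        using a(2)[of x] gc[of x] a(1) c0 by (cases "x \<in> V") (auto simp: g_def)
      show "a + c * indicator (- V) x \<le> a + c" for x using c0 by (auto simp: indicator_def)
    qed
    also have "\<dots> = a * ?mG + c * (?mG - ?mV)"
    proof -
      have "integrable (\<mu> (real k * t)) (\<lambda>x. c * indicator (- V) x)"
        by (rule integrable_bounded[OF kt, where B=c]) (use V c0 in \<open>auto simp: indicator_def\<close>)
      moreover have "integrable (\<mu> (real k * t)) (\<lambda>x. a)" by (rule integrable_bounded[OF kt, where B=a]) (use a in auto)
      moreover have "measure (\<mu> (real k * t)) (- V) = ?mG - ?mV"
        using finite_measure.finite_measure_compl[OF finite_\<mu>[OF kt], of V] V sets_\<mu>[OF kt] space_\<mu>[OF kt]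
        by (simp add: Compl_eq_Diff_UNIV)
      ultimately show ?thesis using V by (simp add: space_\<mu>[OF kt] sets_\<mu>[OF kt])
    qed
    also have "\<dots> \<le> a * 1 + c * \<delta>"
      using measure_le_1[OF kt, of UNIV] \<delta>k a(1) c0 by (intro add_mono mult_left_mono) auto
    finally have 1: "norm (\<integral>x. g x \<partial>\<mu> (real k * t)) \<le> a + c * \<delta>" by simp
    have "norm (of_real (1 - ?mG) * quot t f) = (1 - ?mG) * norm (quot t f)"
      using measure_le_1[OF kt, of UNIV] by (simp only: norm_mult norm_of_real)
    also have "\<dots> \<le> \<delta> * c'"
      using \<open>?mV \<le> ?mG\<close> \<delta>k c(2) \<delta>(2) measure_le_1[OF kt, of UNIV] by (intro mult_mono) auto
    finally have 2: "norm (of_real (1 - ?mG) * quot t f) \<le> \<delta> * c'" .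
    have "norm ((\<integral>x. g x \<partial>\<mu> (real k * t)) - of_real (1 - ?mG) * quot t f) \<le> ?R"
      using norm_triangle_ineq4[of "\<integral>x. g x \<partial>\<mu> (real k * t)" "of_real (1 - ?mG) * quot t f"] 1 2
      by (simp add: algebra_simps)
    then have 3: "norm (of_real t * ((\<integral>x. g x \<partial>\<mu> (real k * t)) - of_real (1 - ?mG) * quot t f)) \<le> t * ?R"
      using t by (simp only: norm_mult norm_of_real abs_of_pos) (intro mult_left_mono, auto)
    have "norm ((\<integral>x. f x \<partial>\<mu> (real k * t)) - f 0 - real k * t * quot t f) \<le> real k * t * ?R"
      using step by simp
    from norm_triangle_le[OF add_mono[OF this 3]] show ?case
      unfolding eq by (simp add: algebra_simps)
  qed
  have mt: "0 < real m * t" using m t by simp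
  have "quot (real m * t) f - quot t f = ((\<integral>x. f x \<partial>\<mu> (real m * t)) - f 0 - real m * t * quot t f) / of_real (real m * t)"
    using mt t m by (simp add: quot_def diff_divide_distrib)
  then have "norm (quot (real m * t) f - quot t f) = norm ((\<integral>x. f x \<partial>\<mu> (real m * t)) - f 0 - real m * t * quot t f) / (real m * t)"
    using mt by (simp only: norm_divide norm_of_real abs_of_pos)
  also have "\<dots> \<le> real m * t * ?R / (real m * t)" using main[of m] m mt by (intro divide_right_mono) auto
  also have "\<dots> = ?R" using t m by simp
  finally show ?thesis .
qed

end

lemma (in semigroup_of_measures) measure_conv_ge:
  assumes rq: "0 < r" "0 < q" and sets: "B \<in> sets borel" "C \<in> sets borel" "D \<in> sets borel"
    and BCD: "\<And>x y. x \<in> B \<Longrightarrow> y \<in> C \<Longrightarrow> x + y \<in> D"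
  shows "measure (\<mu> r) B * measure (\<mu> q) C \<le> measure (\<mu> (r + q)) D"
proof -
  have "ennreal (measure (\<mu> r) B * measure (\<mu> q) C) = emeasure (\<mu> q) C * emeasure (\<mu> r) B"
    using rq by (simp add: emeasure_eq ennreal_mult mult.commute)
  also have "\<dots> = (\<integral>\<^sup>+x. emeasure (\<mu> q) C * indicator B x \<partial>\<mu> r)"
    using sets sets_\<mu>[OF rq(1)] by (simp add: nn_integral_cmult_indicator)
  also have "\<dots> = (\<integral>\<^sup>+x. \<integral>\<^sup>+y. indicator B x * indicator C y \<partial>\<mu> q \<partial>\<mu> r)"
    using sets sets_\<mu>[OF rq(2)] by (intro nn_integral_cong) (simp add: nn_integral_cmult_indicator mult.commute)
  also have "\<dots> \<le> (\<integral>\<^sup>+x. \<integral>\<^sup>+y. indicator D (x + y) \<partial>\<mu> q \<partial>\<mu> r)"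
    using BCD by (intro nn_integral_mono) (auto simp: indicator_def)
  also have "\<dots> = (\<integral>\<^sup>+x. indicator D x \<partial>\<mu> (r + q))"
    by (rule nn_integral_conv[OF rq, symmetric]) (use sets in measurable)
  also have "\<dots> = ennreal (measure (\<mu> (r + q)) D)"
    using sets sets_\<mu>[of "r + q"] rq by (simp add: emeasure_eq)
  finally show ?thesis by simp
qed

section \<open>Uniform estimates for a convergent sequence of semigroups\<close>

locale semigroup_sequence = framed_lie_group A d X U0 \<phi>0 b l
  for A :: "('g::{topological_group_add, t2_space, second_countable_topology}, 'e::real_inner) chart set"
    and d X U0 \<phi>0 b l +
  fixes \<mu> :: "nat \<Rightarrow> real \<Rightarrow> 'g measure"
  assumes semigroups: "\<And>n. convolution_semigroup (\<mu> n)"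
    and converges: "\<And>(f :: 'g \<Rightarrow> complex) t. f \<in> bcontfun \<Longrightarrow> 0 < t \<Longrightarrow> (\<lambda>n. \<integral>x. f x \<partial>\<mu> n t) \<longlonglongrightarrow> (\<integral>x. f x \<partial>\<mu> 0 t)"
begin

sublocale S: semigroup_of_measures "\<mu> n" for n
  by unfold_locales (rule semigroups)

lemma converges_real:
  fixes f :: "'g \<Rightarrow> real"
  assumes "continuous_on UNIV f" "\<And>x. \<bar>f x\<bar> \<le> B" "0 < t"
  shows "(\<lambda>n. \<integral>x. f x \<partial>\<mu> n t) \<longlonglongrightarrow> (\<integral>x. f x \<partial>\<mu> 0 t)"
proof -
  have "(\<lambda>x. complex_of_real (f x)) \<in> bcontfun"
    using assms by (auto simp: bcontfun_def bounded_iff intro!: continuous_intros)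
  from tendsto_Re[OF converges[OF this assms(3)]] show ?thesis by simp
qed

lemma cutoff_cont: "cutoff u \<Longrightarrow> continuous_on UNIV u"
  using Ck_map_continuous[of 0 u] by (simp add: cutoff_def smooth_def)

lemma cutoff_meas: "cutoff u \<Longrightarrow> u \<in> borel_measurable borel"
  using cutoff_cont borel_measurable_continuous_onI by blast

lemma cutoff_abs: "cutoff u \<Longrightarrow> \<bar>u x\<bar> \<le> 1"
  by (simp add: cutoff_def)

lemma compact_borel: "compact (K :: 'g set) \<Longrightarrow> K \<in> sets borel"
  by (simp add: compact_imp_closed)

text \<open>Averaging \<open>translated_mass\<close> over \<open>s\<close> turns convergence for each \<open>t\<close> into a bound uniform in \<open>t\<close>.\<close>

lemma uniformly_concentrated:
  assumes V: "open V" "0 \<in> V" and e: "0 < e"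
  shows "\<forall>\<^sub>F t in at_right 0. \<forall>n. 1 - measure (\<mu> n t) V \<le> e"
proof -
  have "open ((\<lambda>p. fst p - snd p :: 'g) -` V)"
    by (rule open_vimage[OF V(1)]) (intro continuous_intros)
  moreover have "(0, 0) \<in> (\<lambda>p. fst p - snd p :: 'g) -` V" using V by simp
  ultimately obtain P Q where PQ: "open P" "open Q" "(0, 0) \<in> P \<times> Q" "P \<times> Q \<subseteq> (\<lambda>p. fst p - snd p :: 'g) -` V"
    by (rule open_prod_elim)
  \<comment> \<open>Differences of points of \<open>U\<close> lie in \<open>V\<close>, as
    \<open>translated_mass\<close> requires for a cutoff supported in \<open>U\<close>.\<close>
  define U where "U = P \<inter> Q"
  have U: "open U" "0 \<in> U" using PQ by (auto simp: U_def)
  have UV: "x \<in> V" if "x + y \<in> U" "y \<in> U" for x y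
  proof -
    have "(x + y, y) \<in> P \<times> Q" using that by (simp add: U_def)
    then have "(x + y) - y \<in> V" using PQ(4) by force
    then show ?thesis by (simp add: add_diff_eq[symmetric])
  qed
  obtain u N where u: "cutoff u" "{x. u x \<noteq> 0} \<subseteq> U" "open N" "{0} \<subseteq> N" "\<forall>x\<in>N. u x = 1"
    using ex_cutoff_function[of "{0}" U] U by auto
  have u0: "u 0 = 1" using u by auto
  have u01: "0 \<le> u x \<and> u x \<le> 1" for x using u(1) by (simp add: cutoff_def)
  note um = cutoff_meas[OF u(1)]
  have Vb: "V \<in> sets borel" using V by simp
  have u_V: "u (x + y) \<noteq> 0 \<Longrightarrow> u y \<noteq> 0 \<Longrightarrow> x \<in> V" for x y using u(2) UV by blast
  define m where "m n s = (if 0 < s then \<integral>x. u x \<partial>\<mu> n s else 0)" for n s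
  have m_meas: "m n \<in> borel_measurable borel" for n
    unfolding m_def by (rule S.integral_borel_measurable[OF cutoff_cont[OF u(1)] cutoff_abs[OF u(1)]])
  have m01: "0 \<le> m n s \<and> m n s \<le> 1" for n s
  proof -
    have "norm (\<integral>x. u x \<partial>\<mu> n s) \<le> 1" if "0 < s"
      by (rule S.norm_integral_le_const[OF that um]) (use cutoff_abs[OF u(1)] in simp)
    moreover have "0 \<le> (\<integral>x. u x \<partial>\<mu> n s)" using u01 by (intro Bochner_Integration.integral_nonneg) auto
    ultimately show ?thesis by (auto simp: m_def)
  qed
  have key: "(1 - measure (\<mu> n t) V) \<le> (1 - m n (t + s)) + (1 - m n s)" if "0 < s" "0 < t" for n s t
  proof -
    have "(\<integral>x. u x \<partial>\<mu> n (t + s)) + (\<integral>x. u x \<partial>\<mu> n s) \<le> measure (\<mu> n t) V + 1"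
      by (rule S.translated_mass[OF that um u01 Vb]) (rule u_V)
    then show ?thesis using that by (simp add: m_def)
  qed
  have m_V: "m n t \<le> measure (\<mu> n t) V" if "0 < t" for n t
  proof -
    have "(\<integral>x. u x \<partial>\<mu> n t) \<le> (\<integral>x. indicator V x \<partial>\<mu> n t)"
    proof (rule integral_mono)
      show "integrable (\<mu> n t) u" by (rule S.integrable_bounded[OF that um, of 1]) (use cutoff_abs[OF u(1)] in simp)
      show "integrable (\<mu> n t) (indicator V :: 'g \<Rightarrow> real)"
        by (rule S.integrable_bounded[OF that, of _ 1]) (use Vb in \<open>auto simp: indicator_def\<close>)
      show "u x \<le> indicator V x" for x
        using u_V[of x 0] u01[of x] u0 by (cases "u x = 0") (auto simp: indicator_def)
    qed
    then show ?thesis using that Vb S.sets_\<mu>[OF that] by (simp add: m_def)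
  qed
  have m_lim: "(m n \<longlongrightarrow> 1) (at_right 0)" for n
  proof (rule Lim_transform_eventually)
    show "((\<lambda>t. \<integral>x. u x \<partial>\<mu> n t) \<longlongrightarrow> 1) (at_right 0)"
      using S.lim_\<mu>_real[OF cutoff_cont[OF u(1)] cutoff_abs[OF u(1)]] u0 by simp
    show "\<forall>\<^sub>F t in at_right 0. (\<integral>x. u x \<partial>\<mu> n t) = m n t"
      unfolding eventually_at_filter by (simp add: m_def)
  qed
  have each: "\<forall>\<^sub>F t in at_right 0. 1 - measure (\<mu> n t) V \<le> e" for n
  proof -
    have "\<forall>\<^sub>F t in at_right 0. 1 - e < m n t" using order_tendstoD(1)[OF m_lim, of "1 - e"] e by simp
    moreover have "\<forall>\<^sub>F t :: real in at_right 0. 0 < t" by (simp add: eventually_at_filter)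
    ultimately show ?thesis
    proof eventually_elim
      case (elim t)
      then show ?case using m_V[of t n] by linarith
    qed
  qed
  have "\<forall>\<^sub>F t in at_right 0. 1 - e / 16 < m 0 t" using order_tendstoD(1)[OF m_lim, of "1 - e / 16"] e by simp
  then obtain h where h: "0 < h" "\<And>s. 0 < s \<Longrightarrow> s < h \<Longrightarrow> 1 - e / 16 < m 0 s"
    unfolding eventually_at_right_field by auto
  \<comment> \<open>The defect of the integral of \<open>u\<close> as a function of the time in (0,
    h). Dominated convergence of its time integral replaces uniformity in \<open>s\<close> of the
    convergence in \<open>n\<close>.\<close>
  define F where "F n s = indicator {0<..<h} s * (1 - m n s)" for n s
  have F_meas: "F n \<in> borel_measurable borel" for n
    unfolding F_def[abs_def] using m_meas by measurable
  have F0: "0 \<le> F n s" "F n s \<le> indicator {0<..<h} s" for n s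
    using m01[of n s] by (auto simp: F_def indicator_def)
  have ind: "integrable lborel (indicator {0<..<h} :: real \<Rightarrow> real)" using h by simp
  have F_int: "integrable lborel (F n)" for n
    by (rule Bochner_Integration.integrable_bound[OF ind]) (use F_meas F0 in auto)
  have F_lim: "(\<lambda>n. \<integral>s. F n s \<partial>lborel) \<longlonglongrightarrow> (\<integral>s. F 0 s \<partial>lborel)"
  proof (rule integral_dominated_convergence[OF _ _ ind])
    show "AE s in lborel. (\<lambda>n. F n s) \<longlonglongrightarrow> F 0 s"
    proof (rule AE_I2)
      fix s :: real
      have "(\<lambda>n. m n s) \<longlonglongrightarrow> m 0 s"
        using converges_real[OF cutoff_cont[OF u(1)] cutoff_abs[OF u(1)], of s] by (cases "0 < s") (auto simp: m_def)
      then show "(\<lambda>n. F n s) \<longlonglongrightarrow> F 0 s" unfolding F_def by (intro tendsto_intros)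
    qed
    show "AE s in lborel. norm (F n s) \<le> indicator {0<..<h} s" for n using F0 by (intro AE_I2) simp
  qed (use F_meas in simp_all)
  have "(\<integral>s. F 0 s \<partial>lborel) \<le> (\<integral>s. (e / 16) * indicator {0<..<h} s \<partial>lborel)"
  proof (rule integral_mono[OF F_int])
    show "F 0 s \<le> (e / 16) * indicator {0<..<h} s" for s
      using h(2)[of s] by (auto simp: F_def indicator_def)
  qed (use ind in simp)
  also have "\<dots> = e / 16 * h" using h by simp
  also have "\<dots> < e / 8 * h" using e h by simp
  finally have "\<forall>\<^sub>F n in sequentially. (\<integral>s. F n s \<partial>lborel) < e / 8 * h"
    using order_tendstoD(2)[OF F_lim] by blast
  then obtain N where N: "\<And>n. N \<le> n \<Longrightarrow> (\<integral>s. F n s \<partial>lborel) < e / 8 * h"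
    unfolding eventually_sequentially by blast
  \<comment> \<open>For \<open>s\<close> and \<open>t\<close> below h / 2 both \<open>s\<close> and
    \<open>t + s\<close> lie in (0, h). Averaging \<open>key\<close> over such \<open>s\<close>
    bounds h / 2 times the missing mass by twice the integral of \<open>F n\<close>, hence by e h /
    4. The finitely many smaller \<open>n\<close> are covered by \<open>each\<close>.\<close>
  have large: "1 - measure (\<mu> n t) V \<le> e" if n: "N \<le> n" and t: "0 < t" "t < h / 2" for n t
  proof -
    let ?c = "1 - measure (\<mu> n t) V"
    have c0: "0 \<le> ?c" using S.measure_le_1[OF t(1)] by simp
    have shift: "integrable lborel (\<lambda>s. F n (t + s))"
      using lborel_integrable_real_affine[OF F_int[of n], of 1 t] by simp
    have ind2: "integrable lborel (\<lambda>s. ?c * indicator {0<..<h / 2} s :: real)" using h by simp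
    have "(h / 2) * ?c = (\<integral>s. ?c * indicator {0<..<h / 2} s \<partial>lborel)" using h by simp
    also have "\<dots> \<le> (\<integral>s. F n (t + s) + F n s \<partial>lborel)"
    proof (rule integral_mono[OF ind2 Bochner_Integration.integrable_add[OF shift F_int]])
      fix s :: real
      show "?c * indicator {0<..<h / 2} s \<le> F n (t + s) + F n s"
      proof (cases "0 < s \<and> s < h / 2")
        case True
        then show ?thesis using key[of s t n] t h by (simp add: F_def)
      next
        case False
        then show ?thesis using F0(1)[of n s] F0(1)[of n "t + s"] by (auto simp: indicator_def)
      qed
    qed
    also have "\<dots> = (\<integral>s. F n (t + s) \<partial>lborel) + (\<integral>s. F n s \<partial>lborel)"
      by (rule Bochner_Integration.integral_add[OF shift F_int])
    also have "(\<integral>s. F n (t + s) \<partial>lborel) = (\<integral>s. F n s \<partial>lborel)"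
      using lborel_integral_real_affine[of 1 "F n" t] by simp
    finally have "(h / 2) * ?c \<le> 2 * (\<integral>s. F n s \<partial>lborel)" by simp
    also have "\<dots> \<le> 2 * (e / 8 * h)" using N[OF n] by simp
    finally have "(h / 2) * ?c \<le> 2 * (e / 8 * h)" .
    then have "h * ?c \<le> h * (e / 2)" by (simp add: field_simps)
    then have "?c \<le> e / 2" using h(1) by (rule mult_left_le_imp_le)
    then show ?thesis using e by simp
  qed
  have "\<forall>\<^sub>F t in at_right 0. \<forall>n\<in>{..<N}. 1 - measure (\<mu> n t) V \<le> e"
    using each by (intro eventually_ball_finite ballI) auto
  moreover have "\<forall>\<^sub>F t in at_right 0. 0 < t \<and> t < h / 2"
    unfolding eventually_at_right_field using h by (intro exI[of _ "h / 2"]) auto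
  ultimately show ?thesis
  proof eventually_elim
    case (elim t)
    then show ?case using large by (metis lessThan_iff not_le)
  qed
qed

text \<open>Each single measure is tight by exhaustion. For the tail of the sequence convergence is
  tested on \<open>1 - u i\<close>, which is bounded and continuous but need not vanish at infinity,
  so no mass can escape in the limit.\<close>

lemma tight_at:
  assumes s: "0 < s" and e: "0 < e"
  shows "\<exists>K. compact K \<and> (\<forall>n. measure (\<mu> n s) (- K) \<le> e)"
proof -
  obtain u where u: "\<And>i. cutoff (u i)" "\<And>K. compact K \<Longrightarrow> \<forall>\<^sub>F i :: nat in sequentially. \<forall>x\<in>K. u i x = 1"
    using ex_exhaustion by blast
  note um = cutoff_meas[OF u(1)]
  have u01: "0 \<le> u i x \<and> u i x \<le> 1" for i x using u(1) by (simp add: cutoff_def)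
  have u1: "norm (1 - u i x) \<le> 1" for i x using u01[of i x] by simp
  have lim: "(\<lambda>i. \<integral>x. 1 - u i x \<partial>\<mu> n s) \<longlonglongrightarrow> (\<integral>x. 0 \<partial>\<mu> n s)" for n
  proof (rule integral_dominated_convergence[where w="\<lambda>_. 1"])
    show "(\<lambda>x. 1 - u i x) \<in> borel_measurable (\<mu> n s)" for i
      by (rule S.meas_\<mu>[OF s]) (use um in measurable)
    show "integrable (\<mu> n s) (\<lambda>_. 1 :: real)" by (rule S.integrable_bounded[OF s, of _ 1]) auto
    show "AE x in \<mu> n s. (\<lambda>i. 1 - u i x) \<longlonglongrightarrow> 0"
    proof (rule AE_I2, rule tendsto_eventually)
      fix x
      show "\<forall>\<^sub>F i in sequentially. 1 - u i x = 0" using u(2)[of "{x}"] by (auto elim: eventually_mono)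
    qed
    show "AE x in \<mu> n s. norm (1 - u i x) \<le> 1" for i using u1 by (intro AE_I2)
  qed simp
  have le: "measure (\<mu> n s) (- L) \<le> (\<integral>x. 1 - u i x \<partial>\<mu> n s)" if L: "compact L" "{x. u i x \<noteq> 0} \<subseteq> L" for n i L
  proof -
    have Lb: "- L \<in> sets borel" using compact_borel[OF L(1)] by simp
    have "(\<integral>x. indicator (- L) x \<partial>\<mu> n s) \<le> (\<integral>x. 1 - u i x \<partial>\<mu> n s)"
    proof (rule integral_mono)
      show "integrable (\<mu> n s) (indicator (- L) :: 'g \<Rightarrow> real)"
        by (rule S.integrable_bounded[OF s, of _ 1]) (use Lb in \<open>auto simp: indicator_def\<close>)
      show "integrable (\<mu> n s) (\<lambda>x. 1 - u i x)"
        by (rule S.integrable_bounded[OF s _ u1]) (use um in measurable)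
      show "indicator (- L) x \<le> 1 - u i x" for x using L(2) u01[of i x] by (auto simp: indicator_def)
    qed
    then show ?thesis using Lb S.sets_\<mu>[OF s] by simp
  qed
  have each: "\<exists>L. compact L \<and> measure (\<mu> n s) (- L) \<le> e" for n
  proof -
    have "\<forall>\<^sub>F i in sequentially. (\<integral>x. 1 - u i x \<partial>\<mu> n s) < e"
      using order_tendstoD(2)[OF lim[of n], of e] e by simp
    then obtain i where i: "(\<integral>x. 1 - u i x \<partial>\<mu> n s) < e" unfolding eventually_sequentially by blast
    obtain L where "compact L" "{x. u i x \<noteq> 0} \<subseteq> L" using u(1)[of i] by (auto simp: cutoff_def csupp_def)
    from this(1) le[OF this, of n] i show ?thesis by (intro exI[of _ L]) simp
  qed
  have "\<forall>\<^sub>F i in sequentially. (\<integral>x. 1 - u i x \<partial>\<mu> 0 s) < e"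
    using order_tendstoD(2)[OF lim[of 0], of e] e by simp
  then obtain i where i: "(\<integral>x. 1 - u i x \<partial>\<mu> 0 s) < e" unfolding eventually_sequentially by blast
  have "continuous_on UNIV (\<lambda>x. 1 - u i x)" using cutoff_cont[OF u(1)] by (intro continuous_intros)
  from converges_real[OF this _ s, of 1] u1
  have "(\<lambda>n. \<integral>x. 1 - u i x \<partial>\<mu> n s) \<longlonglongrightarrow> (\<integral>x. 1 - u i x \<partial>\<mu> 0 s)" by simp
  from order_tendstoD(2)[OF this i] obtain N where N: "\<And>n. N \<le> n \<Longrightarrow> (\<integral>x. 1 - u i x \<partial>\<mu> n s) < e"
    unfolding eventually_sequentially by blast
  obtain L where L: "compact L" "{x. u i x \<noteq> 0} \<subseteq> L" using u(1)[of i] by (auto simp: cutoff_def csupp_def)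
  have "\<forall>n. \<exists>M. compact M \<and> measure (\<mu> n s) (- M) \<le> e" using each by blast
  from choice[OF this] obtain M where M: "\<forall>n. compact (M n) \<and> measure (\<mu> n s) (- M n) \<le> e" ..
  let ?K = "L \<union> (\<Union>n<N. M n)"
  have K: "compact ?K" using L M by auto
  have "measure (\<mu> n s) (- ?K) \<le> e" for n
  proof -
    have mono: "measure (\<mu> n s) (- ?K) \<le> measure (\<mu> n s) (- Q)" if "compact Q" "Q \<subseteq> ?K" for Q
    proof (rule finite_measure.finite_measure_mono[OF S.finite_\<mu>[OF s]])
      show "- ?K \<subseteq> - Q" using that(2) by blast
      show "- Q \<in> sets (\<mu> n s)" using compact_borel[OF that(1)] S.sets_\<mu>[OF s] by simp
    qed
    show ?thesis
    proof (cases "n < N")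
      case True
      then show ?thesis using mono[of "M n"] M by (meson UN_upper lessThan_iff order_trans sup.coboundedI2)
    next
      case False
      then have "measure (\<mu> n s) (- L) \<le> e" using le[OF L, of n] N[of n] by simp
      then show ?thesis using mono[OF L(1)] by auto
    qed
  qed
  then show ?thesis using K by blast
qed

section \<open>Tightness and large jumps, uniformly in the sequence\<close>

lemma compact_differences: "compact K \<Longrightarrow> compact L \<Longrightarrow> compact {k - y | k y. k \<in> K \<and> y \<in> (L :: 'g set)}"
proof -
  assume "compact K" "compact L"
  then have "compact ((\<lambda>p. fst p - snd p) ` (K \<times> L))"
    by (intro compact_continuous_image compact_Times continuous_intros)
  also have "(\<lambda>p. fst p - snd p) ` (K \<times> L) = {k - y | k y. k \<in> K \<and> y \<in> L}" by force
  finally show ?thesis .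
qed

text \<open>Tightness at the single time \<open>s0\<close> passes to all earlier times: a position
  outside the differences of \<open>K1\<close> and \<open>L0\<close> at time \<open>r\<close>,
  followed by an increment in \<open>L0\<close>, ends outside \<open>K1\<close> at time
  \<open>s0\<close>, and such increments have probability at least 3/4. That \<open>L0\<close>
  exists is due to \<open>uniformly_concentrated\<close>.\<close>

lemma uniformly_tight:
  "\<exists>s0>0. \<exists>L0. compact L0 \<and> 0 \<in> L0 \<and> (\<forall>n r. 0 < r \<longrightarrow> r \<le> s0 \<longrightarrow> 3 / 4 \<le> measure (\<mu> n r) L0) \<and>
    (\<forall>e>0. \<exists>K. compact K \<and> L0 \<subseteq> K \<and> (\<forall>n r. 0 < r \<longrightarrow> r < s0 \<longrightarrow> measure (\<mu> n r) (- K) \<le> e))"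
proof -
  obtain u N where u: "cutoff u" "open N" "{0} \<subseteq> N" "\<forall>x\<in>N. u x = 1"
    using ex_cutoff_function[of "{0}" UNIV] by auto
  obtain L0 where L0: "compact L0" "{x. u x \<noteq> 0} \<subseteq> L0" using u(1) by (auto simp: cutoff_def csupp_def)
  have NL: "N \<subseteq> L0" using u L0 by fastforce
  have "\<forall>\<^sub>F t in at_right 0. \<forall>n. 1 - measure (\<mu> n t) N \<le> 1 / 4"
    using uniformly_concentrated[OF u(2), of "1 / 4"] u(3) by simp
  then obtain h where h: "0 < h" "\<And>t n. 0 < t \<Longrightarrow> t < h \<Longrightarrow> 1 - measure (\<mu> n t) N \<le> 1 / 4"
    unfolding eventually_at_right_field by auto
  define s0 where "s0 = h / 2"
  have s0: "0 < s0" using h by (simp add: s0_def)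
  have stay: "3 / 4 \<le> measure (\<mu> n r) L0" if r: "0 < r" "r \<le> s0" for n r
  proof -
    have "measure (\<mu> n r) N \<le> measure (\<mu> n r) L0"
      using finite_measure.finite_measure_mono[OF S.finite_\<mu>[OF r(1)] NL] compact_borel[OF L0(1)] S.sets_\<mu>[OF r(1)] by simp
    then show ?thesis using h(2)[of r n] r h(1) by (simp add: s0_def)
  qed
  have tight: "\<exists>K. compact K \<and> L0 \<subseteq> K \<and> (\<forall>n r. 0 < r \<longrightarrow> r < s0 \<longrightarrow> measure (\<mu> n r) (- K) \<le> e)" if e: "0 < e" for e
  proof -
    obtain K1 where K1: "compact K1" "\<And>n. measure (\<mu> n s0) (- K1) \<le> 3 / 4 * e"
      using tight_at[OF s0, of "3 / 4 * e"] e by auto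
    let ?D = "{k - y | k y. k \<in> K1 \<and> y \<in> L0}"
    let ?K = "L0 \<union> ?D"
    have D: "compact ?D" by (rule compact_differences[OF K1(1) L0(1)])
    have "measure (\<mu> n r) (- ?K) \<le> e" if r: "0 < r" "r < s0" for n r
    proof -
      have "measure (\<mu> n r) (- ?D) * measure (\<mu> n (s0 - r)) L0 \<le> measure (\<mu> n (r + (s0 - r))) (- K1)"
      proof (rule S.measure_conv_ge)
        show "x + y \<in> - K1" if "x \<in> - ?D" "y \<in> L0" for x y
        proof
          assume "x + y \<in> K1"
          then have "(x + y) - y \<in> ?D" using that(2) by blast
          then show False using that(1) by (simp add: add_diff_eq[symmetric])
        qed
      qed (use r D L0 K1 compact_borel in auto)
      moreover have "measure (\<mu> n r) (- ?D) * (3 / 4) \<le> measure (\<mu> n r) (- ?D) * measure (\<mu> n (s0 - r)) L0"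
        using stay[of "s0 - r" n] r by (intro mult_left_mono) auto
      ultimately have "measure (\<mu> n r) (- ?D) * (3 / 4) \<le> e * (3 / 4)" using K1(2)[of n] by simp
      then have "measure (\<mu> n r) (- ?D) \<le> e" by simp
      moreover have "measure (\<mu> n r) (- ?K) \<le> measure (\<mu> n r) (- ?D)"
        using finite_measure.finite_measure_mono[OF S.finite_\<mu>[OF r(1)], of "- ?K" "- ?D" n] compact_borel[OF D] S.sets_\<mu>[OF r(1)] by auto
      ultimately show ?thesis by simp
    qed
    moreover have "compact ?K" using D L0 by auto
    ultimately show ?thesis by blast
  qed
  have zero: "0 \<in> L0" using NL u(3) by blast
  show ?thesis
    by (rule exI[of _ s0], intro conjI[OF s0], rule exI[of _ L0]) (intro conjI allI impI L0(1) zero stay tight)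
qed

text \<open>With \<open>\<beta>\<close> the mass off \<open>L\<close> and m \<beta> \<le> 1/4,
  \<open>big_jump_bound\<close> turns tightness into a bound for m \<beta>. If the condition holds
  for the largest \<open>m\<close> with mt < s0, the bound for \<open>\<beta>\<close> is of order
  \<open>t\<close>. If it fails, a smaller \<open>m\<close> with m \<beta> close to 1/4 violates the
  bound.\<close>

lemma uniform_tail_bound:
  "\<exists>s0>0. \<forall>e>0. \<exists>L. compact L \<and> (\<forall>n t. 0 < t \<longrightarrow> t < s0 \<longrightarrow> measure (\<mu> n t) (- L) \<le> e * t)"
proof -
  obtain s0 L0 where s0: "0 < s0" and L0: "compact L0" "0 \<in> L0"
    and stay: "\<And>n r. 0 < r \<Longrightarrow> r \<le> s0 \<Longrightarrow> 3 / 4 \<le> measure (\<mu> n r) L0"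
    and tight: "\<And>e. 0 < e \<Longrightarrow> \<exists>K. compact K \<and> L0 \<subseteq> K \<and> (\<forall>n r. 0 < r \<longrightarrow> r < s0 \<longrightarrow> measure (\<mu> n r) (- K) \<le> e)"
    using uniformly_tight by blast
  have "\<exists>L. compact L \<and> (\<forall>n t. 0 < t \<longrightarrow> t < s0 \<longrightarrow> measure (\<mu> n t) (- L) \<le> e * t)" if e: "0 < e" for e
  proof -
    \<comment> \<open>The value 1/32 makes the second case contradictory, since 8/3 of it is less
      than 1/4 - 1/32. In the first case s0 \<le> 2 M t turns the other value into the bound
      \<open>e * t\<close>.\<close>
    define \<eta> where "\<eta> = min (1 / 32) (e * s0 * (3 / 16))"
    have \<eta>: "0 < \<eta>" using e s0 by (simp add: \<eta>_def)
    obtain K where K: "compact K" "L0 \<subseteq> K" "\<And>n r. 0 < r \<Longrightarrow> r < s0 \<Longrightarrow> measure (\<mu> n r) (- K) \<le> \<eta>"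
      using tight[OF \<eta>] by blast
    let ?L1 = "{k - y | k y. k \<in> K \<and> y \<in> L0}"
    \<comment> \<open>If x + y + w lies in \<open>K\<close> with \<open>x\<close> in
      \<open>K\<close> and \<open>w\<close> in \<open>L0\<close>, solving for \<open>y\<close> puts
      it into this compact set.\<close>
    define L where "L = {- k + z | k z. k \<in> K \<and> z \<in> ?L1}"
    have "compact ((\<lambda>p. - fst p + snd p) ` (K \<times> ?L1))"
      by (intro compact_continuous_image compact_Times continuous_intros K compact_differences L0)
    also have "(\<lambda>p. - fst p + snd p) ` (K \<times> ?L1) = L" by (force simp: L_def)
    finally have L: "compact L" .
    have escape: "x + y + w \<notin> K" if "x \<in> K" "y \<notin> L" "w \<in> L0" for x y w
    proof
      assume "x + y + w \<in> K"
      then have "- x + ((x + y + w) - w) \<in> L" unfolding L_def using that by blast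
      then show False using that(2) by (simp add: add_diff_eq[symmetric] add.assoc)
    qed
    have "0 \<in> K" using K(2) L0(2) by blast
    have KL: "K \<subseteq> L"
    proof
      fix k assume "k \<in> K"
      then have "- 0 + (k - 0) \<in> L" unfolding L_def using \<open>0 \<in> K\<close> L0(2) by blast
      then show "k \<in> L" by simp
    qed
    have "measure (\<mu> n t) (- L) \<le> e * t" if t: "0 < t" "t < s0" for n t
    proof -
      define \<beta> where "\<beta> = measure (\<mu> n t) (- L)"
      have \<beta>0: "0 \<le> \<beta>" by (simp add: \<beta>_def)
      have "\<beta> \<le> measure (\<mu> n t) (- K)" unfolding \<beta>_def
        using finite_measure.finite_measure_mono[OF S.finite_\<mu>[OF t(1)], of "- L" "- K" n] KL compact_borel[OF K(1)] S.sets_\<mu>[OF t(1)] by auto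
      then have \<beta>\<eta>: "\<beta> \<le> \<eta>" using K(3)[OF t, of n] by simp
      have big: "real m * (3 / 8) * \<beta> \<le> \<eta>" if m: "1 \<le> m" "real m * t < s0" "real m * \<beta> \<le> 1 / 4" for m
      proof -
        have "real m * (3 / 8) * measure (\<mu> n t) (- L) \<le> measure (\<mu> n (real m * t)) (- K)"
        proof (rule S.big_jump_bound[OF t(1)])
          show "3 / 4 \<le> measure (\<mu> n (real k * t)) L0" if "1 \<le> k" "k \<le> m" for k
          proof (rule stay)
            have "real k * t \<le> real m * t" using that t by (intro mult_right_mono) auto
            then show "real k * t \<le> s0" using m by simp
          qed (use that t in simp)
        qed (use K L L0 compact_borel escape m \<beta>_def in auto)
        also have "\<dots> \<le> \<eta>" using m t by (intro K(3)) auto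
        finally show ?thesis by (simp add: \<beta>_def)
      qed
      \<comment> \<open>The largest integer with M t < s0; the ceiling minus 1 keeps the inequality
        strict when s0 / t is an integer.\<close>
      define M where "M = nat (\<lceil>s0 / t\<rceil> - 1)"
      have ratio: "1 < s0 / t" using t by (simp add: less_divide_eq)
      then have "1 \<le> \<lceil>s0 / t\<rceil> - 1" by linarith
      then have M1: "1 \<le> M" unfolding M_def by linarith
      have MM: "real M = of_int \<lceil>s0 / t\<rceil> - 1" using \<open>1 \<le> \<lceil>s0 / t\<rceil> - 1\<close> by (simp add: M_def)
      have "real M < s0 / t" unfolding MM by linarith
      then have Mt: "real M * t < s0" using t by (simp add: less_divide_eq)
      have "s0 / t \<le> 2 * real M" using MM M1 by linarith
      then have s0M: "s0 \<le> 2 * real M * t" using t by (simp add: divide_le_eq)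
      show ?thesis
      proof (cases "real M * \<beta> \<le> 1 / 4")
        case True
        have "s0 * (3 / 16) * \<beta> \<le> (2 * real M * t) * (3 / 16) * \<beta>"
          using s0M \<beta>0 by (intro mult_right_mono) auto
        also have "\<dots> = (real M * (3 / 8) * \<beta>) * t" by simp
        also have "\<dots> \<le> \<eta> * t" using big[OF M1 Mt True] t by (intro mult_right_mono) auto
        also have "\<dots> \<le> (e * s0 * (3 / 16)) * t" using t by (intro mult_right_mono) (auto simp: \<eta>_def)
        finally have "(s0 * (3 / 16)) * \<beta> \<le> (s0 * (3 / 16)) * (e * t)" by (simp add: mult_ac)
        then have "\<beta> \<le> e * t" using s0 by (subst (asm) mult_le_cancel_left_pos) auto
        then show ?thesis by (simp add: \<beta>_def)
      next
        case False
        then have "\<beta> \<noteq> 0" by auto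
        then have \<beta>pos: "0 < \<beta>" using \<beta>0 by simp
        \<comment> \<open>The largest \<open>m\<close> with m \<beta> \<le> 1/4; it is at most
          \<open>M\<close>, because M \<beta> exceeds 1/4 in this case, and m \<beta> falls short of
          1/4 by at most \<beta>.\<close>
        define m where "m = nat \<lfloor>1 / (4 * \<beta>)\<rfloor>"
        have "\<beta> \<le> 1 / 32" using \<beta>\<eta> by (simp add: \<eta>_def)
        then have "8 \<le> 1 / (4 * \<beta>)" using \<beta>pos by (simp add: le_divide_eq)
        then have fl: "8 \<le> \<lfloor>1 / (4 * \<beta>)\<rfloor>" by linarith
        have mm: "real m = of_int \<lfloor>1 / (4 * \<beta>)\<rfloor>" using fl unfolding m_def by (intro of_nat_nat) linarith
        have "real m \<le> 1 / (4 * \<beta>)" unfolding mm by linarith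
        then have m4: "real m * \<beta> \<le> 1 / 4" using \<beta>pos by (simp add: le_divide_eq)
        have "1 / (4 * \<beta>) - 1 \<le> real m" unfolding mm by linarith
        then have "(1 / (4 * \<beta>) - 1) * \<beta> \<le> real m * \<beta>" using \<beta>0 by (rule mult_right_mono)
        then have m8: "1 / 4 - \<beta> \<le> real m * \<beta>" using \<beta>pos by (simp add: left_diff_distrib)
        have "real m * \<beta> \<le> real M * \<beta>" using m4 False by simp
        then have "real m \<le> real M" using \<beta>pos by simp
        then have "real m * t \<le> real M * t" using t by (intro mult_right_mono) auto
        then have "real m * t < s0" using Mt by simp
        moreover have "1 \<le> m" using fl unfolding m_def by linarith
        ultimately have "real m * (3 / 8) * \<beta> \<le> \<eta>" using big m4 by blast
        then have "real m * \<beta> \<le> 8 / 3 * \<eta>" by simp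
        moreover have "\<eta> \<le> 1 / 32" by (simp add: \<eta>_def)
        ultimately have False using m8 \<open>\<beta> \<le> 1 / 32\<close> by linarith
        then show ?thesis ..
      qed
    qed
    then show ?thesis using L by blast
  qed
  then show ?thesis using s0 by blast
qed

end

lemma norm_add_diff_le: "norm (a + (b - c)) \<le> norm a + (norm b + norm c)"
  for a b c :: "'a::real_normed_vector"
  using norm_triangle_ineq[of a "b - c"] norm_triangle_ineq4[of b c] by linarith

locale semigroup_sequence_test = semigroup_sequence A d X U0 \<phi>0 b l \<mu>
  for A :: "('g::{topological_group_add, t2_space, second_countable_topology}, 'e::real_inner) chart set"
    and d X U0 \<phi>0 b l and \<mu> :: "nat \<Rightarrow> real \<Rightarrow> 'g measure" +
  fixes \<xi> :: "nat \<Rightarrow> 'g \<Rightarrow> real" and \<psi> :: "'g \<Rightarrow> real" and C :: real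
  assumes tf: "test_functions \<xi> \<psi> C"
begin

lemma tf_props:
  shows \<xi>_smooth: "j < d \<Longrightarrow> smooth (\<xi> j)" and \<xi>_csupp: "j < d \<Longrightarrow> csupp (\<xi> j)" and \<xi>_0: "j < d \<Longrightarrow> \<xi> j 0 = 0"
    and \<psi>_smooth: "smooth \<psi>" and \<psi>_csupp: "csupp (\<lambda>x. 1 - \<psi> x)" and \<psi>_0: "\<psi> 0 = 0"
    and \<psi>_ge: "0 \<le> \<psi> x" and \<psi>_le: "\<psi> x \<le> 1" and C_ge: "0 \<le> C"
    and \<psi>_lower: "open N \<Longrightarrow> 0 \<in> N \<Longrightarrow> \<exists>c>0. \<forall>x. x \<notin> N \<longrightarrow> c \<le> \<psi> x"
    and taylor: "Ck_map 2 f \<Longrightarrow> C2_bound f M \<Longrightarrow> norm (f x - f 0 - (\<Sum>j<d. \<xi> j x *\<^sub>R X j f 0)) \<le> C * M * \<psi> x"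
    and peano: "Ck_map 2 h \<Longrightarrow> h 0 = (0::complex) \<Longrightarrow> (\<And>i. i < d \<Longrightarrow> dird (b i) (loc h) (\<phi>0 0) = 0) \<Longrightarrow>
        (\<And>i j. i < d \<Longrightarrow> j < d \<Longrightarrow> dird (b i) (dird (b j) (loc h)) (\<phi>0 0) = 0) \<Longrightarrow> 0 < e \<Longrightarrow>
        \<exists>N. open N \<and> 0 \<in> N \<and> (\<forall>x\<in>N. norm (h x) \<le> e * \<psi> x)"
  using tf unfolding test_functions_def by simp_all

section \<open>Bounds for difference quotients by test functions\<close>

abbreviation quotient :: "nat \<Rightarrow> real \<Rightarrow> ('g \<Rightarrow> complex) \<Rightarrow> complex" where
  "quotient n \<equiv> semigroup_of_measures.quot (\<mu> n)"

text \<open>The function \<open>\<psi>\<close> enters as the constant 1 minus the compactly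
  supported 1 - \<psi>. In this way all test functions except a constant have compact support, which
  makes translation continuous at each of them.\<close>

definition testf :: "nat \<Rightarrow> 'g \<Rightarrow> complex" where
  "testf j = (if j < d then (\<lambda>x. of_real (\<xi> j x)) else if j = d then (\<lambda>x. of_real (1 - \<psi> x)) else (\<lambda>x. 1))"

definition qnorm :: "nat \<Rightarrow> real \<Rightarrow> real" where
  "qnorm n t = (\<Sum>j<d + 2. norm (quotient n t (testf j)))"

lemma qnorm_nonneg: "0 \<le> qnorm n t"
  unfolding qnorm_def by (intro sum_nonneg) auto

lemma testf_smooth: "smooth (testf j)"
  using \<xi>_smooth \<psi>_smooth
  by (auto simp: testf_def smooth_def intro!: Ck_map_of_real Ck_map_diff Ck_map_const)

lemma testf_csupp: "j \<le> d \<Longrightarrow> csupp (testf j)"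
  using \<xi>_csupp csupp_of_real csupp_of_real[OF \<psi>_csupp] by (auto simp: testf_def)

lemma testf_bound: "\<exists>M. C2_bound (testf j) M"
proof (cases "j \<le> d")
  case True
  then show ?thesis using csupp_C2_bound[OF smooth_Ck_map[OF testf_smooth] testf_csupp] by blast
next
  case False
  then show ?thesis using C2_bound_const[of 1] by (auto simp: testf_def)
qed

lemma C2_bound_norm: "C2_bound f M \<Longrightarrow> norm (f x) \<le> M"
  by (simp add: C2_bound_def)

lemma Ck_map_meas: "Ck_map k f \<Longrightarrow> f \<in> borel_measurable borel"
  using Ck_map_continuous borel_measurable_continuous_onI by blast

lemma quotient_linear:
  assumes "0 < t" "Ck_map k f" "Ck_map k g" "\<And>x. norm (f x) \<le> B" "\<And>x. norm (g x) \<le> B'"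
  shows "quotient n t (\<lambda>x. a * f x + c * g x) = a * quotient n t f + c * quotient n t g"
  by (rule S.quot_linear[OF assms(1) Ck_map_meas[OF assms(2)] Ck_map_meas[OF assms(3)] assms(4,5)])

lemma integral_\<psi>:
  assumes t: "0 < t"
  shows "(\<integral>x. \<psi> x \<partial>\<mu> n t) / t \<le> norm (quotient n t (testf (Suc d))) + norm (quotient n t (testf d))"
proof -
  have \<psi>m: "\<psi> \<in> borel_measurable borel" using Ck_map_meas smooth_Ck_map[OF \<psi>_smooth] by blast
  have \<psi>i: "integrable (\<mu> n t) \<psi>" by (rule S.integrable_bounded[OF t \<psi>m, of 1]) (use \<psi>_ge \<psi>_le in simp)
  have oi: "integrable (\<mu> n t) (\<lambda>x. 1 :: real)" by (rule S.integrable_bounded[OF t, of _ 1]) auto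
  have oc: "integrable (\<mu> n t) (\<lambda>x. 1 :: complex)" by (rule S.integrable_bounded[OF t, of _ 1]) auto
  have "of_real ((\<integral>x. \<psi> x \<partial>\<mu> n t) / t) = quotient n t (testf (Suc d)) - quotient n t (testf d)"
  proof -
    have 1: "(\<integral>x. complex_of_real (1 - \<psi> x) \<partial>\<mu> n t) = of_real (\<integral>x. 1 - \<psi> x \<partial>\<mu> n t)"
      by (rule integral_complex_of_real)
    have 2: "(\<integral>x. 1 - \<psi> x \<partial>\<mu> n t) = (\<integral>x. 1 \<partial>\<mu> n t) - (\<integral>x. \<psi> x \<partial>\<mu> n t)"
      by (rule Bochner_Integration.integral_diff[OF oi \<psi>i])
    have 3: "(\<integral>x. (1 :: complex) \<partial>\<mu> n t) = of_real (\<integral>x. 1 \<partial>\<mu> n t)" by (simp add: scaleR_conv_of_real)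
    have "quotient n t (testf (Suc d)) = (of_real (\<integral>x. 1 \<partial>\<mu> n t) - 1) / of_real t"
      unfolding S.quot_def testf_def by (simp add: scaleR_conv_of_real)
    moreover have "quotient n t (testf d) = (of_real (\<integral>x. 1 - \<psi> x \<partial>\<mu> n t) - 1) / of_real t"
      unfolding S.quot_def testf_def using 1 by (simp add: \<psi>_0)
    ultimately show ?thesis unfolding 2 by (simp add: diff_divide_distrib)
  qed
  then have "norm (complex_of_real ((\<integral>x. \<psi> x \<partial>\<mu> n t) / t)) \<le> norm (quotient n t (testf (Suc d))) + norm (quotient n t (testf d))"
    using norm_triangle_ineq4 by metis
  then show ?thesis unfolding norm_of_real by (rule order_trans[OF abs_ge_self])
qed

lemma integral_\<psi>_qnorm: "0 < t \<Longrightarrow> (\<integral>x. \<psi> x \<partial>\<mu> n t) / t \<le> qnorm n t"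
proof -
  assume t: "0 < t"
  have "qnorm n t = (\<Sum>j<d. norm (quotient n t (testf j))) + (norm (quotient n t (testf d)) + norm (quotient n t (testf (Suc d))))"
    by (simp add: qnorm_def)
  moreover have "0 \<le> (\<Sum>j<d. norm (quotient n t (testf j)))" by (intro sum_nonneg) auto
  ultimately show ?thesis using integral_\<psi>[OF t, of n] by linarith
qed

text \<open>The Taylor expansion of \<open>f\<close> at the identity is integrated. The constant
  term contributes the quotient of 1, since mass may be lost, and the linear terms those of the
  coordinates. The remainder is controlled by the integral of \<open>\<psi>\<close>, which
  \<open>integral_\<psi>\<close> expresses through the last two test functions.\<close>

lemma quotient_bound:
  assumes t: "0 < t" and f: "Ck_map 2 f" "C2_bound f M"
  shows "norm (quotient n t f) \<le> (1 + C) * M * qnorm n t"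
proof -
  have M0: "0 \<le> M" using C2_bound_nonneg[OF f(2)] .
  let ?R = "\<lambda>x. f x - f 0 - (\<Sum>j<d. \<xi> j x *\<^sub>R X j f 0)"
  have \<psi>m: "\<psi> \<in> borel_measurable borel" using Ck_map_meas smooth_Ck_map[OF \<psi>_smooth] by blast
  have fm: "f \<in> borel_measurable borel" using Ck_map_meas[OF f(1)] .
  have \<xi>m: "\<xi> j \<in> borel_measurable borel" if "j < d" for j using Ck_map_meas smooth_Ck_map[OF \<xi>_smooth[OF that]] by blast
  have fi: "integrable (\<mu> n t) f" by (rule S.integrable_bounded[OF t fm C2_bound_norm[OF f(2)]])
  have ci: "integrable (\<mu> n t) (\<lambda>x. f 0)" by (rule S.integrable_bounded[OF t, of _ "norm (f 0)"]) auto
  have \<xi>i0: "integrable (\<mu> n t) (\<xi> j)" if j: "j < d" for j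
  proof -
    obtain B where "\<forall>x. norm (\<xi> j x) \<le> B"
      using csupp_bounded[OF \<xi>_csupp[OF j] Ck_map_continuous[OF smooth_Ck_map[OF \<xi>_smooth[OF j]]]] by blast
    then show ?thesis by (intro S.integrable_bounded[OF t \<xi>m[OF j]]) blast
  qed
  then have \<xi>i: "integrable (\<mu> n t) (\<lambda>x. \<xi> j x *\<^sub>R X j f 0)" if "j < d" for j using that by simp
  have \<xi>s: "integrable (\<mu> n t) (\<lambda>x. \<Sum>j<d. \<xi> j x *\<^sub>R X j f 0)" using \<xi>i by (intro Bochner_Integration.integrable_sum) auto
  have R_le: "norm (?R x) \<le> C * M * \<psi> x" for x by (rule taylor[OF f])
  have "norm (\<integral>x. ?R x \<partial>\<mu> n t) \<le> (\<integral>x. C * M * \<psi> x \<partial>\<mu> n t)"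
  proof (rule S.norm_integral_le[OF t _ _ R_le])
    show "?R \<in> borel_measurable borel" using fm \<xi>m by (intro borel_measurable_diff borel_measurable_sum borel_measurable_scaleR) auto
    show "(\<lambda>x. C * M * \<psi> x) \<in> borel_measurable borel" using \<psi>m by measurable
    show "C * M * \<psi> x \<le> C * M * 1" for x using \<psi>_le C_ge M0 by (intro mult_left_mono) auto
  qed
  also have "\<dots> = C * M * (\<integral>x. \<psi> x \<partial>\<mu> n t)" by simp
  finally have R1: "norm ((\<integral>x. ?R x \<partial>\<mu> n t) / of_real t) \<le> C * M * ((\<integral>x. \<psi> x \<partial>\<mu> n t) / t)"
    using t by (simp add: norm_divide divide_right_mono)
  have "(\<integral>x. ?R x \<partial>\<mu> n t) = (\<integral>x. f x \<partial>\<mu> n t) - (\<integral>x. f 0 \<partial>\<mu> n t) - (\<Sum>j<d. \<integral>x. \<xi> j x *\<^sub>R X j f 0 \<partial>\<mu> n t)"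
    using fi ci \<xi>s \<xi>i by (simp add: Bochner_Integration.integral_sum)
  moreover have "(\<integral>x. f 0 \<partial>\<mu> n t) = f 0 * (of_real t * quotient n t (testf (Suc d)) + 1)"
    using t by (simp add: S.quot_def testf_def scaleR_conv_of_real)
  moreover have "(\<integral>x. \<xi> j x *\<^sub>R X j f 0 \<partial>\<mu> n t) = X j f 0 * (of_real t * quotient n t (testf j))" if j: "j < d" for j
  proof -
    have "quotient n t (testf j) = of_real (\<integral>x. \<xi> j x \<partial>\<mu> n t) / of_real t"
      using j \<xi>_0[OF j] by (simp add: S.quot_def testf_def)
    moreover have "(\<integral>x. \<xi> j x *\<^sub>R X j f 0 \<partial>\<mu> n t) = (\<integral>x. \<xi> j x \<partial>\<mu> n t) *\<^sub>R X j f 0"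
      by (rule integral_scaleR_left) (rule \<xi>i0[OF j])
    ultimately show ?thesis using t by (simp add: scaleR_conv_of_real)
  qed
  ultimately have "(\<integral>x. ?R x \<partial>\<mu> n t) = (\<integral>x. f x \<partial>\<mu> n t) - f 0 -
     of_real t * (f 0 * quotient n t (testf (Suc d)) + (\<Sum>j<d. X j f 0 * quotient n t (testf j)))"
    by (simp add: algebra_simps sum_distrib_left)
  then have "(\<integral>x. ?R x \<partial>\<mu> n t) / of_real t = quotient n t f -
      (f 0 * quotient n t (testf (Suc d)) + (\<Sum>j<d. X j f 0 * quotient n t (testf j)))"
    using t by (simp add: S.quot_def diff_divide_distrib)
  then have eq: "quotient n t f = (\<integral>x. ?R x \<partial>\<mu> n t) / of_real t +
      (f 0 * quotient n t (testf (Suc d)) + (\<Sum>j<d. X j f 0 * quotient n t (testf j)))" by simp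
  let ?q = "\<lambda>j. norm (quotient n t (testf j))"
  have "norm (quotient n t f) \<le> norm ((\<integral>x. ?R x \<partial>\<mu> n t) / of_real t) +
      (norm (f 0 * quotient n t (testf (Suc d))) + norm (\<Sum>j<d. X j f 0 * quotient n t (testf j)))"
    unfolding eq by (intro norm_triangle_mono order_refl)
  also have "\<dots> \<le> C * M * (?q (Suc d) + ?q d) + (M * ?q (Suc d) + (\<Sum>j<d. M * ?q j))"
  proof (intro add_mono sum_norm_le)
    show "norm ((\<integral>x. ?R x \<partial>\<mu> n t) / of_real t) \<le> C * M * (?q (Suc d) + ?q d)"
      using R1 mult_left_mono[OF integral_\<psi>[OF t, of n], of "C * M"] C_ge M0 by simp
    show "norm (f 0 * quotient n t (testf (Suc d))) \<le> M * ?q (Suc d)"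
      using f(2) by (auto simp: C2_bound_def norm_mult intro!: mult_right_mono)
    show "norm (X j f 0 * quotient n t (testf j)) \<le> M * ?q j" if "j \<in> {..<d}" for j
      using f(2) that by (auto simp: C2_bound_def norm_mult intro!: mult_right_mono)
  qed
  also have "\<dots> \<le> (1 + C) * M * qnorm n t"
  proof -
    have sz: "qnorm n t = (\<Sum>j<d. ?q j) + (?q d + ?q (Suc d))" by (simp add: qnorm_def)
    have s0: "0 \<le> (\<Sum>j<d. ?q j)" by (intro sum_nonneg) auto
    have "C * M * (?q (Suc d) + ?q d) \<le> C * M * qnorm n t"
      using s0 C_ge M0 unfolding sz by (intro mult_left_mono) auto
    moreover have "M * ?q (Suc d) + (\<Sum>j<d. M * ?q j) \<le> M * qnorm n t"
      using M0 unfolding sz sum_distrib_left[symmetric] distrib_left[symmetric] by (intro mult_left_mono) auto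
    ultimately show ?thesis by (simp add: algebra_simps)
  qed
  finally show ?thesis .
qed

text \<open>The class contains the C^2 functions of compact support as well as the constant 1, hence
  all test functions.\<close>

definition translation_continuous :: "('g \<Rightarrow> complex) \<Rightarrow> bool" where
  "translation_continuous f \<longleftrightarrow> Ck_map 2 f \<and> (\<exists>M. C2_bound f M) \<and>
     (\<forall>e>0. \<exists>N. open N \<and> 0 \<in> N \<and> (\<forall>x\<in>N. C2_bound (\<lambda>y. f (x + y) - f y) e))"

lemma translation_continuous_csupp: "Ck_map 2 f \<Longrightarrow> csupp f \<Longrightarrow> translation_continuous f"
  using csupp_C2_bound translate_diff_small by (simp add: translation_continuous_def)

lemma translation_continuous_testf: "translation_continuous (testf j)"
proof (cases "j \<le> d")
  case True
  then show ?thesis using translation_continuous_csupp[OF smooth_Ck_map[OF testf_smooth] testf_csupp] by blast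
next
  case False
  have "C2_bound (\<lambda>y. 0) e" if "0 < e" for e :: real using that by (auto simp: C2_bound_def X_const)
  then show ?thesis using False C2_bound_const[of 1] Ck_map_const
    by (auto simp: translation_continuous_def testf_def intro!: exI[of _ UNIV])
qed

lemma quotient_almost_constant:
  assumes f: "translation_continuous f" and e: "0 < e"
  shows "\<exists>s>0. \<forall>n t m. 0 < t \<longrightarrow> 1 \<le> m \<longrightarrow> real m * t \<le> s \<longrightarrow>
     norm (quotient n (real m * t) f - quotient n t f) \<le> e * qnorm n t"
proof -
  obtain M where f2: "Ck_map 2 f" and M: "C2_bound f M" using f by (auto simp: translation_continuous_def)
  have M0: "0 \<le> M" using C2_bound_nonneg[OF M] .
  let ?K = "1 + C"
  have K0: "0 < ?K" using C_ge by simp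
  have "0 < e / (2 * ?K)" using e K0 by simp
  then obtain V where V: "open V" "0 \<in> V" "\<And>x. x \<in> V \<Longrightarrow> C2_bound (\<lambda>y. f (x + y) - f y) (e / (2 * ?K))"
    using f unfolding translation_continuous_def by blast
  \<comment> \<open>The allowed error is halved. Translations by elements of \<open>V\<close>
    account for e / 2; off \<open>V\<close> the two crude bounds add up to 3 (1 + C) M times
    \<open>qnorm\<close>, and \<open>\<delta>\<close> makes their share at most e / 2. The 1 keeps
    the divisor positive.\<close>
  define \<delta> where "\<delta> = (e / 2) / (3 * ?K * M + 1)"
  have pos: "0 < 3 * ?K * M + 1" using K0 M0 by (simp add: add_nonneg_pos)
  have \<delta>: "0 < \<delta>" using e pos by (simp add: \<delta>_def)
  have "\<forall>\<^sub>F t in at_right 0. \<forall>n. 1 - measure (\<mu> n t) V \<le> \<delta>" by (rule uniformly_concentrated[OF V(1,2) \<delta>])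
  then obtain s where s: "0 < s" "\<And>t n. 0 < t \<Longrightarrow> t < s \<Longrightarrow> 1 - measure (\<mu> n t) V \<le> \<delta>"
    unfolding eventually_at_right_field by auto
  have "norm (quotient n (real m * t) f - quotient n t f) \<le> e * qnorm n t"
    if t: "0 < t" and m: "1 \<le> m" "real m * t \<le> s" for n t m
  proof -
    have trans: "Ck_map 2 (\<lambda>y. f (x + y) - f y)" for x
      by (rule Ck_map_diff[OF Ck_map_left_translate[OF f2] f2])
    have "norm (quotient n (real m * t) f - quotient n t f) \<le>
       ?K * (e / (2 * ?K)) * qnorm n t + (?K * (2 * M) * qnorm n t + ?K * M * qnorm n t) * \<delta>"
    proof (rule S.quot_telescope[OF t Ck_map_meas[OF f2] C2_bound_norm[OF M]])
      show "V \<in> sets borel" using V by simp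
      show "0 \<le> ?K * (e / (2 * ?K)) * qnorm n t" using e K0 qnorm_nonneg by simp
      show "norm (quotient n t (\<lambda>y. f (x + y) - f y)) \<le> ?K * (e / (2 * ?K)) * qnorm n t" if "x \<in> V" for x
        by (rule quotient_bound[OF t trans V(3)[OF that]])
      show "norm (quotient n t (\<lambda>y. f (x + y) - f y)) \<le> ?K * (2 * M) * qnorm n t" for x
        by (rule quotient_bound[OF t trans C2_bound_translate_diff[OF f2 M]])
      show "norm (quotient n t f) \<le> ?K * M * qnorm n t" by (rule quotient_bound[OF t f2 M])
      show "1 - measure (\<mu> n (real k * t)) V \<le> \<delta>" if "1 \<le> k" "k < m" for k
      proof (rule s(2))
        have "real k * t < real m * t" using that t by simp
        then show "real k * t < s" using m by simp
      qed (use that t in simp)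
    qed (use \<delta> m in auto)
    also have "?K * (e / (2 * ?K)) * qnorm n t = e / 2 * qnorm n t" using K0 by (simp add: field_simps)
    also have "(?K * (2 * M) * qnorm n t + ?K * M * qnorm n t) * \<delta> = (3 * ?K * M * \<delta>) * qnorm n t" by (simp add: algebra_simps)
    also have "(3 * ?K * M * \<delta>) * qnorm n t \<le> e / 2 * qnorm n t"
    proof (rule mult_right_mono[OF _ qnorm_nonneg])
      have "3 * ?K * M * \<delta> \<le> \<delta> * (3 * ?K * M + 1)" using \<delta> by (simp add: algebra_simps)
      also have "\<dots> = e / 2" using pos by (intro nonzero_eq_divide_eq[THEN iffD1, OF _ \<delta>_def]) simp
      finally show "3 * ?K * M * \<delta> \<le> e / 2" .
    qed
    finally show ?thesis by simp
  qed
  then show ?thesis using s(1) by blast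
qed

text \<open>The test functions themselves are translation continuous, hence \<open>qnorm n t \<le> 2 qnorm n (m t)\<close>; with \<open>m t\<close> of
  order one the right-hand side is trivially bounded.\<close>

lemma qnorm_bounded: "\<exists>s>0. \<exists>B\<ge>0. \<forall>n t. 0 < t \<longrightarrow> t \<le> s \<longrightarrow> qnorm n t \<le> B"
proof -
  \<comment> \<open>The errors of the d + 2 test functions then add up to half of
    \<open>qnorm n t\<close>, which is absorbed on the left.\<close>
  define e where "e = 1 / (2 * real (d + 2))"
  have e: "0 < e" by (simp add: e_def)
  have "\<forall>j. \<exists>s>0. \<forall>n t m. 0 < t \<longrightarrow> 1 \<le> m \<longrightarrow> real m * t \<le> s \<longrightarrow>
     norm (quotient n (real m * t) (testf j) - quotient n t (testf j)) \<le> e * qnorm n t"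
    using quotient_almost_constant[OF translation_continuous_testf e] by blast
  from choice[OF this] obtain sj where sj: "\<And>j. 0 < sj j"
    "\<And>j n t m. 0 < t \<Longrightarrow> 1 \<le> m \<Longrightarrow> real m * t \<le> sj j \<Longrightarrow>
     norm (quotient n (real m * t) (testf j) - quotient n t (testf j)) \<le> e * qnorm n t" by blast
  define s where "s = Min (sj ` {..<d + 2})"
  have ne: "{..<d + 2} \<noteq> {}" by (simp add: lessThan_empty_iff)
  have s: "0 < s" unfolding s_def using sj(1) ne by (subst Min_gr_iff) auto
  have sle: "s \<le> sj j" if "j < d + 2" for j unfolding s_def using that by (intro Min_le) auto
  have "\<forall>j. \<exists>M. C2_bound (testf j) M" using testf_bound by blast
  from choice[OF this] obtain M where M: "\<And>j. C2_bound (testf j) (M j)" by blast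
  have M0: "0 \<le> M j" for j using C2_bound_nonneg[OF M] .
  define B0 where "B0 = (\<Sum>j<d + 2. 2 * M j)"
  have qnorm_le: "qnorm n t \<le> B0 / t" if t: "0 < t" for n t
  proof -
    have "norm (quotient n t (testf j)) \<le> 2 * M j / t" for j
    proof -
      have "norm (\<integral>x. testf j x \<partial>\<mu> n t) \<le> M j"
        by (rule S.norm_integral_le_const[OF t Ck_map_meas[OF smooth_Ck_map[OF testf_smooth]] C2_bound_norm[OF M]])
      then have "norm ((\<integral>x. testf j x \<partial>\<mu> n t) - testf j 0) \<le> 2 * M j"
        using norm_triangle_ineq4[of "\<integral>x. testf j x \<partial>\<mu> n t" "testf j 0"] C2_bound_norm[OF M[of j], of 0] by linarith
      then show ?thesis using t by (simp add: S.quot_def norm_divide divide_right_mono)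
    qed
    then show ?thesis unfolding qnorm_def B0_def sum_divide_distrib by (intro sum_mono) auto
  qed
  have B0: "0 \<le> B0" unfolding B0_def using M0 by (intro sum_nonneg) auto
  have "qnorm n t \<le> 4 * B0 / s" if t: "0 < t" "t \<le> s" for n t
  proof -
    \<comment> \<open>With the integer part of s / t the time mt lies between s / 2 and s.\<close>
    define m where "m = nat \<lfloor>s / t\<rfloor>"
    have "1 \<le> s / t" using t by (simp add: le_divide_eq)
    then have fl: "1 \<le> \<lfloor>s / t\<rfloor>" by linarith
    have m1: "1 \<le> m" using fl unfolding m_def by linarith
    have mm: "real m = of_int \<lfloor>s / t\<rfloor>" using fl unfolding m_def by (intro of_nat_nat) linarith
    have "real m \<le> s / t" unfolding mm by linarith
    then have mt: "real m * t \<le> s" using t by (simp add: le_divide_eq)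
    have "s / t \<le> 2 * real m" using mm m1 by linarith
    then have half: "s / 2 \<le> real m * t" using t by (simp add: divide_le_eq)
    have mt0: "0 < real m * t" using half s by linarith
    have "qnorm n t \<le> (\<Sum>j<d + 2. norm (quotient n (real m * t) (testf j)) + e * qnorm n t)"
      unfolding qnorm_def[of n t]
    proof (rule sum_mono)
      fix j assume "j \<in> {..<d + 2}"
      then have "norm (quotient n (real m * t) (testf j) - quotient n t (testf j)) \<le> e * qnorm n t"
        using sj(2)[OF t(1) m1] mt sle[of j] by force
      then have "norm (quotient n t (testf j)) \<le> norm (quotient n (real m * t) (testf j)) + e * qnorm n t"
        using norm_triangle_ineq3[of "quotient n (real m * t) (testf j)" "quotient n t (testf j)"] by linarith
      then show "norm (quotient n t (testf j)) \<le> norm (quotient n (real m * t) (testf j)) + e * (\<Sum>j<d + 2. norm (quotient n t (testf j)))"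
        by (simp add: qnorm_def)
    qed
    also have "\<dots> = qnorm n (real m * t) + real (d + 2) * (e * qnorm n t)"
      unfolding sum.distrib qnorm_def[of n "real m * t"] by simp
    also have "real (d + 2) * (e * qnorm n t) = qnorm n t / 2" unfolding e_def by (simp add: field_simps)
    finally have "qnorm n t \<le> 2 * qnorm n (real m * t)" by simp
    also have "\<dots> \<le> 2 * (B0 / (real m * t))" using qnorm_le[OF mt0, of n] by simp
    also have "\<dots> \<le> 2 * (B0 / (s / 2))" using half B0 s by (intro mult_left_mono divide_left_mono) auto
    finally show ?thesis by simp
  qed
  then show ?thesis using s B0 by (intro exI[of _ s] conjI exI[of _ "4 * B0 / s"]) auto
qed

text \<open>At a small fixed time \<open>s\<close> the quotient differs from \<open>p n\<close> by
  at most r / 4 for every \<open>n\<close>, while for this \<open>s\<close> the quotients converge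
  in \<open>n\<close>.\<close>

lemma generator_limit_exchange:
  assumes f: "translation_continuous f"
    and p: "\<And>n. ((\<lambda>t. quotient n t f) \<longlongrightarrow> p n) (at_right 0)"
  shows "p \<longlonglongrightarrow> p 0"
proof (rule LIMSEQ_I)
  fix r :: real assume r: "0 < r"
  obtain s1 B where s1: "0 < s1" "0 \<le> B" "\<And>n t. 0 < t \<Longrightarrow> t \<le> s1 \<Longrightarrow> qnorm n t \<le> B"
    using qnorm_bounded by blast
  obtain M where f2: "Ck_map 2 f" and M: "C2_bound f M" using f by (auto simp: translation_continuous_def)
  define e where "e = (r / 4) / (B + 1)"
  have e: "0 < e" using r s1 by (simp add: e_def)
  have eB: "e * B \<le> r / 4"
  proof -
    have "e * B \<le> e * (B + 1)" using e by simp
    also have "\<dots> = r / 4" using s1(2) by (intro nonzero_eq_divide_eq[THEN iffD1, OF _ e_def]) simp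
    finally show ?thesis .
  qed
  obtain s2 where s2: "0 < s2" "\<And>n t m. 0 < t \<Longrightarrow> 1 \<le> m \<Longrightarrow> real m * t \<le> s2 \<Longrightarrow>
     norm (quotient n (real m * t) f - quotient n t f) \<le> e * qnorm n t"
    using quotient_almost_constant[OF f e] by blast
  define s where "s = min s1 s2"
  have s: "0 < s" "s \<le> s1" "s \<le> s2" using s1 s2 by (auto simp: s_def)
  have near: "norm (quotient n s f - p n) \<le> r / 4" for n
  proof -
    \<comment> \<open>Fractions of \<open>s\<close>, so that \<open>s\<close> is an integer multiple
      of each and \<open>quotient_almost_constant\<close> compares the two times directly.\<close>
    let ?t = "\<lambda>k. s / real (Suc k)"
    have "?t \<longlonglongrightarrow> 0"
      using tendsto_mult_right_zero[OF LIMSEQ_inverse_real_of_nat, of s] by (simp add: divide_inverse)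
    then have "filterlim ?t (at_right 0) sequentially"
      using s by (auto simp: filterlim_at intro!: always_eventually)
    from filterlim_compose[OF p this] have "(\<lambda>k. quotient n (?t k) f) \<longlonglongrightarrow> p n" .
    then have lim: "(\<lambda>k. norm (quotient n s f - quotient n (?t k) f)) \<longlonglongrightarrow> norm (quotient n s f - p n)"
      by (intro tendsto_intros)
    have "norm (quotient n s f - quotient n (?t k) f) \<le> r / 4" for k
    proof -
      have t0: "0 < ?t k" using s by simp
      have ts: "real (Suc k) * ?t k = s" by simp
      have "?t k \<le> s" using s by (simp add: divide_le_eq)
      then have "qnorm n (?t k) \<le> B" using s1(3)[OF t0] s by simp
      then have "e * qnorm n (?t k) \<le> r / 4" using eB e by (smt (verit) mult_left_mono)
      then show ?thesis using s2(2)[OF t0, of "Suc k" n] ts s by simp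
    qed
    then show ?thesis by (intro LIMSEQ_le_const2[OF lim]) auto
  qed
  have "f \<in> bcontfun"
    using Ck_map_continuous[OF f2] C2_bound_norm[OF M] by (auto simp: bcontfun_def bounded_iff)
  from converges[OF this s(1)] have "(\<lambda>n. quotient n s f) \<longlonglongrightarrow> quotient 0 s f"
    unfolding S.quot_def using s by (intro tendsto_intros) auto
  then obtain N where N: "\<And>n. N \<le> n \<Longrightarrow> norm (quotient n s f - quotient 0 s f) < r / 4"
    using LIMSEQ_D[of "\<lambda>n. quotient n s f" "quotient 0 s f" "r / 4"] r by auto
  have "norm (p n - p 0) < r" if "N \<le> n" for n
  proof -
    have "p n - p 0 = (quotient n s f - quotient 0 s f) + ((quotient 0 s f - p 0) - (quotient n s f - p n))" by simp
    then have "norm (p n - p 0) \<le> norm (quotient n s f - quotient 0 s f) + (norm (quotient 0 s f - p 0) + norm (quotient n s f - p n))"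
      using norm_triangle_ineq norm_triangle_ineq4 by (metis (no_types, lifting) add_left_mono order_trans)
    then show ?thesis using N[OF that] near[of n] near[of 0] r by linarith
  qed
  then show "\<exists>N. \<forall>n\<ge>N. norm (p n - p 0) < r" by blast
qed

section \<open>The generating functional on twice differentiable bounded functions\<close>

lemma quotient_tail:
  "\<exists>s0>0. \<forall>e>0. \<exists>L. compact L \<and> (\<forall>n t. 0 < t \<longrightarrow> t < s0 \<longrightarrow>
     (\<forall>h M. h \<in> borel_measurable borel \<longrightarrow> (\<forall>x. norm (h x) \<le> M) \<longrightarrow> (\<forall>x\<in>L. h x = 0) \<longrightarrow>
        norm (quotient n t h) \<le> M * e))"
proof -
  obtain s0 where s0: "0 < s0" "\<And>e. 0 < e \<Longrightarrow> \<exists>L. compact L \<and> (\<forall>n t. 0 < t \<longrightarrow> t < s0 \<longrightarrow> measure (\<mu> n t) (- L) \<le> e * t)"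
    using uniform_tail_bound by blast
  have "\<exists>L. compact L \<and> (\<forall>n t. 0 < t \<longrightarrow> t < s0 \<longrightarrow>
     (\<forall>h M. h \<in> borel_measurable borel \<longrightarrow> (\<forall>x. norm (h x) \<le> M) \<longrightarrow> (\<forall>x\<in>L. h x = 0) \<longrightarrow>
        norm (quotient n t h) \<le> M * e))" if e: "0 < e" for e
  proof -
    obtain L' where L': "compact L'" "\<And>n t. 0 < t \<Longrightarrow> t < s0 \<Longrightarrow> measure (\<mu> n t) (- L') \<le> e * t"
      using s0(2)[OF e] by blast
    \<comment> \<open>The identity is added so that \<open>h\<close> vanishes there and its quotient
      consists of the integral alone.\<close>
    define L where "L = insert 0 L'"
    have L: "compact L" using L'(1) by (simp add: L_def)
    note Lb = compact_borel[OF L]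
    have m: "measure (\<mu> n t) (- L) \<le> e * t" if t: "0 < t" "t < s0" for n t
    proof -
      have "measure (\<mu> n t) (- L) \<le> measure (\<mu> n t) (- L')"
      proof (rule finite_measure.finite_measure_mono[OF S.finite_\<mu>[OF t(1)]])
        show "- L' \<in> sets (\<mu> n t)" using compact_borel[OF L'(1)] S.sets_\<mu>[OF t(1)] by simp
      qed (auto simp: L_def)
      then show ?thesis using L'(2)[OF t, of n] by simp
    qed
    have "norm (quotient n t h) \<le> M * e"
      if t: "0 < t" "t < s0" and h: "h \<in> borel_measurable borel" "\<forall>x. norm (h x) \<le> M" "\<forall>x\<in>L. h x = 0" for n t h M
    proof -
      have M0: "0 \<le> M" using h(2) norm_ge_zero order_trans by blast
      have "norm (\<integral>x. h x \<partial>\<mu> n t) \<le> (\<integral>x. M * indicator (- L) x \<partial>\<mu> n t)"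
      proof (rule S.norm_integral_le[OF t(1) h(1)])
        show "(\<lambda>x. M * indicator (- L) x) \<in> borel_measurable borel" using Lb by measurable
        show "norm (h x) \<le> M * indicator (- L) x" for x using h by (auto simp: indicator_def)
        show "M * indicator (- L) x \<le> M" for x using M0 by (auto simp: indicator_def)
      qed
      also have "\<dots> = M * measure (\<mu> n t) (- L)"
        using Lb S.sets_\<mu>[OF t(1)] by simp
      also have "\<dots> \<le> M * (e * t)" using m[OF t] M0 by (intro mult_left_mono)
      finally have "norm (\<integral>x. h x \<partial>\<mu> n t) / t \<le> M * e" using t(1) by (simp add: divide_le_eq mult.assoc)
      moreover have "h 0 = 0" using h(3) by (simp add: L_def)
      ultimately show ?thesis using t(1) by (simp add: S.quot_def norm_divide)
    qed
    then show ?thesis using L by blast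
  qed
  then show ?thesis using s0(1) by blast
qed

lemma fsupport_off_zero:
  assumes "open N" "0 \<in> N" "\<And>x. x \<in> N \<Longrightarrow> f x = 0"
  shows "0 \<notin> fsupport f"
proof -
  have "fsupport f \<subseteq> - N" unfolding fsupport_def using assms by (intro closure_minimal) auto
  then show ?thesis using assms(2) by blast
qed

text \<open>\<open>h\<close> is only C^2 and may lack compact support, while convergence is given on
  \<open>Cc_smooth A\<close>. Near the identity |h| is at most \<open>e * \<psi>\<close>, and
  boundedness of \<open>qnorm\<close> makes that part small; far out
  \<open>uniform_tail_bound\<close> applies. In between \<open>h\<close> is approximated by a smooth
  function supported off the identity, whose value under \<open>P\<close> is its
  \<open>\<nu>\<close>-integral.\<close>

lemma quotient_flat:
  assumes rep: "represents_off_identity A P \<nu>"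
    and gen: "\<And>f. f \<in> Cc_smooth A \<Longrightarrow> ((\<lambda>t. quotient n t f) \<longlongrightarrow> P f) (at_right 0)"
    and h: "Ck_map 2 h" "C2_bound h M" "h 0 = 0"
    and D: "\<And>i. i < d \<Longrightarrow> dird (b i) (loc h) (\<phi>0 0) = 0"
    and D2: "\<And>i j. i < d \<Longrightarrow> j < d \<Longrightarrow> dird (b i) (dird (b j) (loc h)) (\<phi>0 0) = 0"
    and hi: "integrable \<nu> h"
  shows "((\<lambda>t. quotient n t h) \<longlongrightarrow> (\<integral>x. h x \<partial>\<nu>)) (at_right 0)"
proof (rule tendstoI)
  fix r :: real assume r: "0 < r"
  note r_def = rep[unfolded represents_off_identity_def]
  have sets_\<nu>: "sets \<nu> = sets borel" using r_def by (rule conjunct1)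
  have \<nu>_fin: "emeasure \<nu> (- U) < \<infinity>" if "open U" "0 \<in> U" for U
    using r_def[THEN conjunct2, THEN conjunct2, THEN conjunct1] that by simp
  have P_\<nu>: "P f = (\<integral>x. f x \<partial>\<nu>)" if "f \<in> Cc_smooth A" "0 \<notin> fsupport f" for f
    using r_def[THEN conjunct2, THEN conjunct2, THEN conjunct2] that by simp
  have meas_\<nu>: "f \<in> borel_measurable borel \<Longrightarrow> f \<in> borel_measurable \<nu>" for f :: "'g \<Rightarrow> 'b::topological_space"
    using measurable_cong_sets[OF sets_\<nu> refl] by blast
  have M0: "0 \<le> M" using C2_bound_nonneg[OF h(2)] .
  have hm: "h \<in> borel_measurable borel" using Ck_map_meas[OF h(1)] .
  note hM = C2_bound_norm[OF h(2)]
  obtain s1 B where s1: "0 < s1" "0 \<le> B" "\<And>n t. 0 < t \<Longrightarrow> t \<le> s1 \<Longrightarrow> qnorm n t \<le> B"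
    using qnorm_bounded by blast
  obtain s0 where s0: "0 < s0" "\<And>e. 0 < e \<Longrightarrow> \<exists>L. compact L \<and> (\<forall>n t. 0 < t \<longrightarrow> t < s0 \<longrightarrow> measure (\<mu> n t) (- L) \<le> e * t)"
    using uniform_tail_bound by blast
  \<comment> \<open>The errors at the end add up to e (M + B) + 4 e, which is at most
    \<open>r\<close>.\<close>
  define e where "e = r / (M + B + 5)"
  have e: "0 < e" using r M0 s1 by (simp add: e_def)
  have er: "e * (M + B + 5) = r" using M0 s1 by (intro nonzero_eq_divide_eq[THEN iffD1, OF _ e_def]) simp
  obtain L where L: "compact L" "\<And>n t. 0 < t \<Longrightarrow> t < s0 \<Longrightarrow> measure (\<mu> n t) (- L) \<le> e * t"
    using s0(2)[OF e] by blast
  obtain N1 where N1: "open N1" "0 \<in> N1" "\<And>x. x \<in> N1 \<Longrightarrow> norm (h x) \<le> e * \<psi> x"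
    using peano[OF h(1,3) D D2 e] by blast
  obtain u where u: "\<And>i. cutoff (u i)" "\<And>K. compact K \<Longrightarrow> \<forall>\<^sub>F i :: nat in sequentially. \<forall>x\<in>K. u i x = 1"
    using ex_exhaustion by blast
  obtain v where v: "\<And>i. cutoff (v i)" "\<And>i. \<exists>N. open N \<and> 0 \<in> N \<and> (\<forall>x\<in>N. v i x = 1)"
    "\<And>N. open N \<Longrightarrow> 0 \<in> N \<Longrightarrow> \<forall>\<^sub>F i :: nat in sequentially. {x. v i x \<noteq> 0} \<subseteq> N"
    using ex_shrinking_cutoffs by blast
  \<comment> \<open>A cutoff to an annulus: it removes a neighbourhood of the identity through
    \<open>v i\<close> and the far region through \<open>u i\<close>.\<close>
  define \<kappa> where "\<kappa> i x = (1 - v i x) * u i x" for i x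
  have uv: "0 \<le> u i x" "u i x \<le> 1" "0 \<le> v i x" "v i x \<le> 1" for i x using u(1) v(1) by (auto simp: cutoff_def)
  have \<kappa>01: "0 \<le> \<kappa> i x" "\<kappa> i x \<le> 1" for i x
    using uv[of i x] by (auto simp: \<kappa>_def intro: mult_le_one)
  have \<kappa>_smooth: "smooth (\<kappa> i)" for i
    using u(1)[of i] v(1)[of i] unfolding \<kappa>_def[abs_def] cutoff_def smooth_def
    by (auto intro!: Ck_map_mult Ck_map_diff Ck_map_const)
  have \<kappa>m: "\<kappa> i \<in> borel_measurable borel" for i using Ck_map_meas[OF smooth_Ck_map] \<kappa>_smooth
    by (metis borel_measurable_continuous_onI Ck_map_continuous smooth_Ck_map)
  \<comment> \<open>The cutoff loses little of the \<open>\<nu>\<close>-integral: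
    \<open>\<kappa> i\<close> tends to 1 off the identity, \<open>h\<close> vanishes at the
    identity, and |h| is integrable.\<close>
  have far: "(\<lambda>i. \<integral>x. h x * of_real (1 - \<kappa> i x) \<partial>\<nu>) \<longlonglongrightarrow> (\<integral>x. 0 \<partial>\<nu>)"
  proof (rule integral_dominated_convergence[where w="\<lambda>x. norm (h x)"])
    show "(\<lambda>x. h x * of_real (1 - \<kappa> i x)) \<in> borel_measurable \<nu>" for i
      by (rule meas_\<nu>) (use hm \<kappa>m in measurable)
    show "integrable \<nu> (\<lambda>x. norm (h x))" using hi by simp
    show "AE x in \<nu>. norm (h x * of_real (1 - \<kappa> i x)) \<le> norm (h x)" for i
    proof (rule AE_I2)
      fix x
      have "norm (of_real (1 - \<kappa> i x) :: complex) \<le> 1" unfolding norm_of_real using \<kappa>01[of i x] by simp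
      then show "norm (h x * of_real (1 - \<kappa> i x)) \<le> norm (h x)"
        unfolding norm_mult by (simp add: mult_left_le)
    qed
    show "AE x in \<nu>. (\<lambda>i. h x * of_real (1 - \<kappa> i x)) \<longlonglongrightarrow> 0"
    proof (rule AE_I2, rule tendsto_eventually)
      fix x
      show "\<forall>\<^sub>F i in sequentially. h x * of_real (1 - \<kappa> i x) = 0"
      proof (cases "x = 0")
        case False
        then obtain W where W: "open W" "0 \<in> W" "x \<notin> W" using t1_space[of 0 x] by blast
        have "\<forall>\<^sub>F i in sequentially. u i x = 1" using u(2)[of "{x}"] by simp
        then show ?thesis using v(3)[OF W(1,2)]
        proof eventually_elim
          case (elim i)
          then have "v i x = 0" using W(3) by blast
          then show ?case using elim by (simp add: \<kappa>_def)
        qed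
      qed (simp add: h(3))
    qed
  qed simp
  have "\<forall>\<^sub>F i in sequentially. norm (\<integral>x. h x * of_real (1 - \<kappa> i x) \<partial>\<nu>) < e"
    using order_tendstoD(2)[OF tendsto_norm[OF far], of e] e by simp
  then have "\<forall>\<^sub>F i in sequentially. norm (\<integral>x. h x * of_real (1 - \<kappa> i x) \<partial>\<nu>) < e \<and>
     {x. v i x \<noteq> 0} \<subseteq> N1 \<and> (\<forall>x\<in>L. u i x = 1)"
    using v(3)[OF N1(1,2)] u(2)[OF L(1)] by eventually_elim auto
  then obtain i where i: "norm (\<integral>x. h x * of_real (1 - \<kappa> i x) \<partial>\<nu>) < e" "{x. v i x \<noteq> 0} \<subseteq> N1" "\<forall>x\<in>L. u i x = 1"
    unfolding eventually_sequentially by blast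
  let ?\<kappa> = "\<kappa> i"
  obtain N where N: "open N" "0 \<in> N" "\<forall>x\<in>N. v i x = 1" using v(2) by blast
  obtain Lu where Lu: "compact Lu" "{x. u i x \<noteq> 0} \<subseteq> Lu" using u(1)[of i] by (auto simp: cutoff_def csupp_def)
  define K where "K = Lu - N"
  have K: "compact K" unfolding K_def using Lu(1) N(1) by (rule compact_diff)
  have Kb: "K \<in> sets borel" using compact_borel[OF K] .
  have \<kappa>K: "?\<kappa> x = 0" if "x \<notin> K" for x using that Lu(2) N(3) by (auto simp: K_def \<kappa>_def)
  obtain c where c: "0 < c" "\<And>x. x \<notin> N \<Longrightarrow> c \<le> \<psi> x" using \<psi>_lower[OF N(1,2)] by blast
  have \<psi>m: "\<psi> \<in> borel_measurable borel" using Ck_map_meas[OF smooth_Ck_map[OF smooth_of_real[OF \<psi>_smooth]]]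
    by (metis Ck_map_continuous \<psi>_smooth borel_measurable_continuous_onI smooth_Ck_map)
  have \<psi>int: "integrable (\<mu> n t) \<psi>" if "0 < t" for t
    by (rule S.integrable_bounded[OF that \<psi>m, of 1]) (use \<psi>_ge \<psi>_le in simp)
  have \<psi>B: "(\<integral>x. \<psi> x \<partial>\<mu> n t) \<le> B * t" if "0 < t" "t \<le> s1" for t
    using integral_\<psi>_qnorm[OF that(1), of n] s1(3)[OF that, of n] that(1) by (simp add: divide_le_eq) (smt (verit) mult_right_mono)
  define \<nu>K where "\<nu>K = measure \<nu> (- N)"
  have N\<nu>: "emeasure \<nu> (- N) < \<infinity>" by (rule \<nu>_fin[OF N(1,2)])
  \<comment> \<open>The accuracy of the smooth approximation on \<open>K\<close>. Times B / c it
    bounds the error in the quotient, because \<open>\<psi>\<close> is at least \<open>c\<close> on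
    \<open>K\<close>; times \<open>\<nu>K\<close> it bounds the error under
    \<open>\<nu>\<close>.\<close>
  define e' where "e' = e / (1 + B / c + \<nu>K)"
  have den: "0 < 1 + B / c + \<nu>K" using s1(2) c(1) by (simp add: \<nu>K_def add_pos_nonneg)
  have e': "0 < e'" using e den by (simp add: e'_def)
  have e'_eq: "e' * (1 + B / c + \<nu>K) = e" using den by (intro nonzero_eq_divide_eq[THEN iffD1, OF _ e'_def]) simp
  have e'B: "e' * (B / c) \<le> e" "e' * \<nu>K \<le> e"
  proof -
    have "B / c \<le> 1 + B / c + \<nu>K" "\<nu>K \<le> 1 + B / c + \<nu>K"
      using s1(2) c(1) by (simp_all add: \<nu>K_def)
    from this[THEN mult_left_mono, of e'] have "e' * (B / c) \<le> e' * (1 + B / c + \<nu>K)" "e' * \<nu>K \<le> e' * (1 + B / c + \<nu>K)"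
      using e' by simp_all
    then show "e' * (B / c) \<le> e" "e' * \<nu>K \<le> e" unfolding e'_eq .
  qed
  obtain w where w: "smooth w" "\<And>x. x \<in> K \<Longrightarrow> norm (h x - w x) \<le> e'"
    using smooth_approximation[OF K Ck_map_continuous[OF h(1)] e'] by blast
  have wm: "w \<in> borel_measurable borel" using Ck_map_meas[OF smooth_Ck_map[OF w(1)]] .
  let ?g = "\<lambda>x. of_real (?\<kappa> x) * w x"
  have g_smooth: "smooth ?g"
    using Ck_map_mult[OF Ck_map_of_real smooth_Ck_map[OF w(1)]] \<kappa>_smooth by (simp add: smooth_def)
  have g_csupp: "csupp ?g" by (rule csuppI[OF K]) (use \<kappa>K in auto)
  have g_Cc: "?g \<in> Cc_smooth A" using g_smooth g_csupp by (simp add: Cc_smooth_eq)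
  have "0 \<notin> fsupport ?g" by (rule fsupport_off_zero[OF N(1,2)]) (use N(3) in \<open>simp add: \<kappa>_def\<close>)
  then have Pg: "P ?g = (\<integral>x. ?g x \<partial>\<nu>)" by (rule P_\<nu>[OF g_Cc])
  obtain Bg where Bg: "\<And>x. norm (?g x) \<le> Bg"
    using csupp_bounded[OF g_csupp Ck_map_continuous[OF smooth_Ck_map[OF g_smooth]]] by blast
  have gm: "?g \<in> borel_measurable borel" using Ck_map_meas[OF smooth_Ck_map[OF g_smooth]] .
  have g0: "?g 0 = 0" using N by (simp add: \<kappa>_def)
  have diff_le: "norm (of_real (?\<kappa> x) * h x - ?g x) \<le> e' * indicator K x" for x
  proof (cases "x \<in> K")
    case True
    have "norm (of_real (?\<kappa> x) * h x - ?g x) = ?\<kappa> x * norm (h x - w x)"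
      using \<kappa>01[of i x] by (simp add: norm_mult right_diff_distrib[symmetric])
    also have "\<dots> \<le> 1 * e'" using \<kappa>01[of i x] w(2)[OF True] by (intro mult_mono) auto
    finally show ?thesis using True by simp
  qed (use \<kappa>K in simp)
  have dm: "(\<lambda>x. of_real (?\<kappa> x) * h x - ?g x) \<in> borel_measurable borel" using \<kappa>m hm gm by measurable
  have rm: "(\<lambda>x. h x * of_real (1 - ?\<kappa> x)) \<in> borel_measurable borel" using \<kappa>m hm by measurable
  have hsplit: "h x = h x * of_real (1 - ?\<kappa> x) + ((of_real (?\<kappa> x) * h x - ?g x) + ?g x)" for x
    by (simp add: algebra_simps)
  have \<nu>_part: "norm ((\<integral>x. h x \<partial>\<nu>) - (\<integral>x. ?g x \<partial>\<nu>)) \<le> 2 * e"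
  proof -
    have Ki: "integrable \<nu> (\<lambda>x. e' * indicator K x :: real)"
    proof -
      have "emeasure \<nu> K \<le> emeasure \<nu> (- N)"
        using N(1) by (intro emeasure_mono) (auto simp: K_def sets_\<nu>)
      then have "emeasure \<nu> K < \<infinity>" using N\<nu> by (rule order_le_less_trans)
      then show ?thesis using Kb sets_\<nu> by (intro integrable_mult_right integrable_real_indicator) auto
    qed
    have di: "integrable \<nu> (\<lambda>x. of_real (?\<kappa> x) * h x - ?g x)"
      by (rule Bochner_Integration.integrable_bound[OF Ki meas_\<nu>[OF dm]])
         (rule AE_I2, use diff_le e' in \<open>simp add: indicator_def\<close>)
    have ri: "integrable \<nu> (\<lambda>x. h x * of_real (1 - ?\<kappa> x))"
    proof (rule Bochner_Integration.integrable_bound[OF hi meas_\<nu>[OF rm]], rule AE_I2)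
      fix x
      have "norm (of_real (1 - ?\<kappa> x) :: complex) \<le> 1" unfolding norm_of_real using \<kappa>01[of i x] by simp
      then show "norm (h x * of_real (1 - ?\<kappa> x)) \<le> norm (h x)" unfolding norm_mult by (simp add: mult_left_le)
    qed
    have gi: "integrable \<nu> ?g"
    proof -
      have "integrable \<nu> (\<lambda>x. h x - h x * of_real (1 - ?\<kappa> x) - (of_real (?\<kappa> x) * h x - ?g x))"
        using hi ri di by simp
      then show ?thesis by (simp add: algebra_simps)
    qed
    have "(\<integral>x. h x \<partial>\<nu>) = (\<integral>x. h x * of_real (1 - ?\<kappa> x) + ((of_real (?\<kappa> x) * h x - ?g x) + ?g x) \<partial>\<nu>)"
      by (rule Bochner_Integration.integral_cong[OF refl hsplit])
    also have "\<dots> = (\<integral>x. h x * of_real (1 - ?\<kappa> x) \<partial>\<nu>) + ((\<integral>x. of_real (?\<kappa> x) * h x - ?g x \<partial>\<nu>) + (\<integral>x. ?g x \<partial>\<nu>))"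
      using ri di gi by (simp only: Bochner_Integration.integral_add Bochner_Integration.integrable_add)
    finally have "(\<integral>x. h x \<partial>\<nu>) - (\<integral>x. ?g x \<partial>\<nu>) = (\<integral>x. h x * of_real (1 - ?\<kappa> x) \<partial>\<nu>) + (\<integral>x. of_real (?\<kappa> x) * h x - ?g x \<partial>\<nu>)"
      by simp
    moreover have "norm (\<integral>x. of_real (?\<kappa> x) * h x - ?g x \<partial>\<nu>) \<le> e"
    proof -
      have "norm (\<integral>x. of_real (?\<kappa> x) * h x - ?g x \<partial>\<nu>) \<le> (\<integral>x. norm (of_real (?\<kappa> x) * h x - ?g x) \<partial>\<nu>)"
        by (rule integral_norm_bound)
      also have "\<dots> \<le> (\<integral>x. e' * indicator K x \<partial>\<nu>)" by (rule integral_mono[OF integrable_norm[OF di] Ki diff_le])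
      also have "\<dots> = e' * measure \<nu> K" using Kb sets_\<nu> by simp
      also have "\<dots> \<le> e' * \<nu>K" unfolding \<nu>K_def
        using e' N(1) N\<nu> by (intro mult_left_mono measure_mono_fmeasurable) (auto simp: K_def sets_\<nu> fmeasurable_def Kb[unfolded K_def])
      finally show ?thesis using e'B by simp
    qed
    ultimately show ?thesis using i(1) norm_triangle_ineq
      by (smt (verit))
  qed
  have quot_part: "norm (quotient n t h - quotient n t ?g) \<le> e * (M + B) + e" if t: "0 < t" "t < s0" "t \<le> s1" for t
  proof -
    have hint: "integrable (\<mu> n t) h" by (rule S.integrable_bounded[OF t(1) hm hM])
    have gint: "integrable (\<mu> n t) ?g" by (rule S.integrable_bounded[OF t(1) gm Bg])
    have dint: "integrable (\<mu> n t) (\<lambda>x. of_real (?\<kappa> x) * h x - ?g x)"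
      by (rule S.integrable_bounded[OF t(1) dm, of e'])
         (rule order_trans[OF diff_le], use e' in \<open>simp add: indicator_def\<close>)
    \<comment> \<open>On \<open>L\<close> the factor \<open>1 - ?\<kappa> x\<close> equals
      \<open>v i x\<close>, which vanishes outside \<open>N1\<close>; off \<open>L\<close> the crude
      bound \<open>M\<close> is later compensated by the small mass there.\<close>
    have rbound: "norm (h x * of_real (1 - ?\<kappa> x)) \<le> M * indicator (- L) x + e * \<psi> x" for x
    proof -
      have nm: "norm (h x * of_real (1 - ?\<kappa> x)) = norm (h x) * (1 - ?\<kappa> x)"
        using \<kappa>01[of i x] unfolding norm_mult norm_of_real by simp
      show ?thesis
      proof (cases "x \<in> L")
        case True
        then have \<kappa>v: "1 - ?\<kappa> x = v i x" using i(3) by (simp add: \<kappa>_def)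
        show ?thesis
        proof (cases "v i x = 0")
          case True
          then show ?thesis using \<kappa>v M0 e \<psi>_ge[of x] unfolding nm by (simp add: add_nonneg_nonneg)
        next
          case False
          then have "norm (h x) \<le> e * \<psi> x" using i(2) N1(3) by blast
          then have "norm (h x) * (1 - ?\<kappa> x) \<le> (e * \<psi> x) * 1"
            using \<kappa>01[of i x] e \<psi>_ge[of x] by (intro mult_mono) auto
          then show ?thesis using \<open>x \<in> L\<close> unfolding nm by simp
        qed
      next
        case False
        have "norm (h x) * (1 - ?\<kappa> x) \<le> M * 1" using \<kappa>01[of i x] hM[of x] M0 by (intro mult_mono) auto
        moreover have "0 \<le> e * \<psi> x" using e \<psi>_ge[of x] by simp
        ultimately show ?thesis using False unfolding nm by simp
      qed
    qed
    have rint: "integrable (\<mu> n t) (\<lambda>x. h x * of_real (1 - ?\<kappa> x))"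
    proof (rule S.integrable_bounded[OF t(1) rm, of M])
      fix x
      have "norm (h x) * norm (of_real (1 - ?\<kappa> x) :: complex) \<le> M * 1"
        using \<kappa>01[of i x] hM[of x] M0 unfolding norm_of_real by (intro mult_mono) auto
      then show "norm (h x * of_real (1 - ?\<kappa> x)) \<le> M" by (simp add: norm_mult)
    qed
    have Lb: "- L \<in> sets borel" using compact_borel[OF L(1)] by simp
    have "norm (\<integral>x. h x * of_real (1 - ?\<kappa> x) \<partial>\<mu> n t) \<le> (\<integral>x. M * indicator (- L) x + e * \<psi> x \<partial>\<mu> n t)"
    proof (rule S.norm_integral_le[OF t(1) rm _ rbound])
      show "(\<lambda>x. M * indicator (- L) x + e * \<psi> x) \<in> borel_measurable borel" using Lb \<psi>m by measurable
      show "M * indicator (- L) x + e * \<psi> x \<le> M * 1 + e * 1" for x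
        using M0 e \<psi>_le[of x] by (intro add_mono mult_left_mono) (auto simp: indicator_def)
    qed
    also have "\<dots> = M * measure (\<mu> n t) (- L) + e * (\<integral>x. \<psi> x \<partial>\<mu> n t)"
    proof -
      have "integrable (\<mu> n t) (\<lambda>x. M * indicator (- L) x :: real)"
      proof (rule S.integrable_bounded[OF t(1), of _ M])
        show "(\<lambda>x. M * indicator (- L) x) \<in> borel_measurable borel" using Lb by measurable
        show "norm (M * indicator (- L) x) \<le> M" for x using M0 by (simp add: indicator_def)
      qed
      then show ?thesis using \<psi>int[OF t(1)] Lb S.sets_\<mu>[OF t(1)] by simp
    qed
    also have "\<dots> \<le> M * (e * t) + e * (B * t)"
      using L(2)[OF t(1,2)] \<psi>B[OF t(1,3)] M0 e by (intro add_mono mult_left_mono) auto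
    finally have 1: "norm (\<integral>x. h x * of_real (1 - ?\<kappa> x) \<partial>\<mu> n t) \<le> e * (M + B) * t" by (simp add: algebra_simps)
    have "norm (\<integral>x. of_real (?\<kappa> x) * h x - ?g x \<partial>\<mu> n t) \<le> (\<integral>x. e' / c * \<psi> x \<partial>\<mu> n t)"
    proof (rule S.norm_integral_le[OF t(1) dm])
      show "(\<lambda>x. e' / c * \<psi> x) \<in> borel_measurable borel" using \<psi>m by measurable
      show "norm (of_real (?\<kappa> x) * h x - ?g x) \<le> e' / c * \<psi> x" for x
      proof (cases "x \<in> K")
        case True
        then have "c \<le> \<psi> x" using c(2) by (simp add: K_def)
        then have "e' / c * c \<le> e' / c * \<psi> x" using e' c(1) by (intro mult_left_mono) auto
        then show ?thesis using diff_le[of x] True c(1) by simp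
      next
        case False
        have "0 \<le> e' / c * \<psi> x" using e' c(1) \<psi>_ge[of x] by simp
        then show ?thesis using \<kappa>K[OF False] by simp
      qed
      show "e' / c * \<psi> x \<le> e' / c * 1" for x using e' c(1) \<psi>_le[of x] by (intro mult_left_mono) auto
    qed
    also have "\<dots> = e' / c * (\<integral>x. \<psi> x \<partial>\<mu> n t)" by simp
    also have "\<dots> \<le> e' / c * (B * t)" using \<psi>B[OF t(1,3)] e' c(1) by (intro mult_left_mono) auto
    also have "\<dots> = (e' * (B / c)) * t" by simp
    also have "\<dots> \<le> e * t" using e'B(1) t(1) by (intro mult_right_mono) auto
    finally have 2: "norm (\<integral>x. of_real (?\<kappa> x) * h x - ?g x \<partial>\<mu> n t) \<le> e * t" .
    have "(\<integral>x. h x \<partial>\<mu> n t) = (\<integral>x. h x * of_real (1 - ?\<kappa> x) + ((of_real (?\<kappa> x) * h x - ?g x) + ?g x) \<partial>\<mu> n t)"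
      by (rule Bochner_Integration.integral_cong[OF refl hsplit])
    also have "\<dots> = (\<integral>x. h x * of_real (1 - ?\<kappa> x) \<partial>\<mu> n t) + ((\<integral>x. of_real (?\<kappa> x) * h x - ?g x \<partial>\<mu> n t) + (\<integral>x. ?g x \<partial>\<mu> n t))"
      using rint dint gint by (simp only: Bochner_Integration.integral_add Bochner_Integration.integrable_add)
    finally have "(\<integral>x. h x \<partial>\<mu> n t) - (\<integral>x. ?g x \<partial>\<mu> n t) = (\<integral>x. h x * of_real (1 - ?\<kappa> x) \<partial>\<mu> n t) + (\<integral>x. of_real (?\<kappa> x) * h x - ?g x \<partial>\<mu> n t)"
      by simp
    then have "norm ((\<integral>x. h x \<partial>\<mu> n t) - (\<integral>x. ?g x \<partial>\<mu> n t)) \<le> (e * (M + B) + e) * t"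
      using norm_triangle_mono[OF 1 2] by (simp add: distrib_right)
    moreover have "quotient n t h - quotient n t ?g = ((\<integral>x. h x \<partial>\<mu> n t) - (\<integral>x. ?g x \<partial>\<mu> n t)) / of_real t"
      using h(3) g0 by (simp add: S.quot_def diff_divide_distrib)
    ultimately show ?thesis using t(1) by (simp add: norm_divide divide_le_eq)
  qed
  have "\<forall>\<^sub>F t in at_right 0. dist (quotient n t ?g) (\<integral>x. ?g x \<partial>\<nu>) < e"
    using tendstoD[OF gen[OF g_Cc] e] Pg by simp
  moreover have "\<forall>\<^sub>F t in at_right 0. 0 < t \<and> t < s0 \<and> t \<le> s1"
    unfolding eventually_at_right_field using s0(1) s1(1) by (intro exI[of _ "min s0 s1"]) auto
  ultimately show "\<forall>\<^sub>F t in at_right 0. dist (quotient n t h) (\<integral>x. h x \<partial>\<nu>) < r"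
  proof eventually_elim
    case (elim t)
    have eq: "quotient n t h - (\<integral>x. h x \<partial>\<nu>) = (quotient n t h - quotient n t ?g) +
       ((quotient n t ?g - (\<integral>x. ?g x \<partial>\<nu>)) - ((\<integral>x. h x \<partial>\<nu>) - (\<integral>x. ?g x \<partial>\<nu>)))" by simp
    have "norm (quotient n t h - (\<integral>x. h x \<partial>\<nu>)) \<le> norm (quotient n t h - quotient n t ?g) +
       (norm (quotient n t ?g - (\<integral>x. ?g x \<partial>\<nu>)) + norm ((\<integral>x. h x \<partial>\<nu>) - (\<integral>x. ?g x \<partial>\<nu>)))"
      by (subst eq) (rule norm_add_diff_le)
    then have "norm (quotient n t h - (\<integral>x. h x \<partial>\<nu>)) < (e * (M + B) + e) + (e + 2 * e)"
      using quot_part[of t] elim \<nu>_part by (simp add: dist_norm)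
    also have "\<dots> \<le> r" using er e by (simp add: algebra_simps)
    finally show ?case by (simp add: dist_norm)
  qed
qed

text \<open>The smooth compactly supported \<open>g\<close> with the same second-order jet is
  covered by the hypothesis, the flat difference by \<open>quotient_flat\<close>; linearity of the
  extension recombines the two.\<close>

lemma quotient_tendsto_Cb2:
  assumes gen: "generating_functional A P (\<mu> n)" and ext: "extended_to_Cb2 A d X P" and f: "f \<in> Cb2 A d X"
  shows "((\<lambda>t. quotient n t f) \<longlongrightarrow> P f) (at_right 0)"
proof -
  have gen': "((\<lambda>t. quotient n t f) \<longlongrightarrow> P f) (at_right 0)" if "f \<in> Cc_smooth A" for f
    using gen that unfolding generating_functional_def S.quot_def by blast
  have lin: "linear_functional_on (Cb2 A d X) P" using ext by (simp add: extended_to_Cb2_def)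
  obtain \<nu> where \<nu>: "represents_off_identity A P \<nu>"
    "\<And>f. f \<in> Cb2 A d X \<Longrightarrow> f 0 = 0 \<Longrightarrow> (\<forall>j<d. X j f 0 = 0) \<Longrightarrow> (\<forall>j<d. \<forall>k<d. X j (X k f) 0 = 0) \<Longrightarrow>
       integrable \<nu> f \<and> P f = (\<integral>x. f x \<partial>\<nu>)"
    using ext unfolding extended_to_Cb2_def by blast
  have f2: "Ck_map 2 f" using f by (simp add: Cb2_eq)
  obtain g :: "'g \<Rightarrow> complex" where g: "smooth g" "csupp g" "f 0 = g 0"
    "\<And>i. i < d \<Longrightarrow> dird (b i) (loc (\<lambda>x. f x - g x)) (\<phi>0 0) = 0"
    "\<And>i j. i < d \<Longrightarrow> j < d \<Longrightarrow> dird (b i) (dird (b j) (loc (\<lambda>x. f x - g x))) (\<phi>0 0) = 0"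
    using ex_same_jet[OF f2] by blast
  let ?h = "\<lambda>x. f x - g x"
  have gCc: "g \<in> Cc_smooth A" using g(1,2) by (simp add: Cc_smooth_eq)
  have gCb: "g \<in> Cb2 A d X" by (rule Cc_smooth_Cb2[OF gCc])
  have hCb: "?h \<in> Cb2 A d X" using Cb2_linear[OF f gCb, of 1 "- 1"] by simp
  then obtain M where h: "Ck_map 2 ?h" "C2_bound ?h M" by (auto simp: Cb2_eq)
  have jets: "\<forall>j<d. X j ?h 0 = 0" "\<forall>j<d. \<forall>k<d. X j (X k ?h) 0 = 0"
    using zero_jet_X[OF h(1) g(4,5)] by blast+
  have h0: "?h 0 = 0" using g(3) by simp
  from \<nu>(2)[OF hCb h0 jets] have hi: "integrable \<nu> ?h" and Ph: "P ?h = (\<integral>x. ?h x \<partial>\<nu>)" by auto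
  have "((\<lambda>t. quotient n t ?h) \<longlongrightarrow> P ?h) (at_right 0)"
    unfolding Ph by (rule quotient_flat[OF \<nu>(1) gen' h h0 g(4,5) hi])
  from tendsto_add[OF gen'[OF gCc] this]
  have lim: "((\<lambda>t. quotient n t g + quotient n t ?h) \<longlongrightarrow> P g + P ?h) (at_right 0)" .
  have Pf: "P f = P g + P ?h"
    using lin[unfolded linear_functional_on_def, rule_format, OF gCb hCb, of 1 1] by simp
  obtain Mg where Mg: "C2_bound g Mg" using gCb by (auto simp: Cb2_eq)
  have "\<forall>\<^sub>F t in at_right 0. quotient n t g + quotient n t ?h = quotient n t f"
  proof -
    have "quotient n t g + quotient n t ?h = quotient n t f" if "0 < t" for t
      using quotient_linear[OF that smooth_Ck_map[OF g(1)] h(1) C2_bound_norm[OF Mg] C2_bound_norm[OF h(2)], of n 1 1] by simp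
    then show ?thesis by (simp add: eventually_at_filter)
  qed
  from Lim_transform_eventually[OF lim this] show ?thesis unfolding Pf .
qed

section \<open>Convergence of the generating functionals\<close>

lemma generators_convergence:
  assumes gen: "\<And>n. generating_functional A (P n) (\<mu> n)" and ext: "\<And>n. extended_to_Cb2 A d X (P n)"
  shows "\<forall>f\<in>Cb2 A d X. (\<lambda>n. P n f) \<longlonglongrightarrow> P 0 f"
    and "\<forall>f\<in>Cc_smooth A. P 0 f = 0 \<Longrightarrow> (\<lambda>n. functional_norm A d X (P n)) \<longlonglongrightarrow> 0"
proof -
  note lim = quotient_tendsto_Cb2[OF gen ext]
  have lin: "P n (\<lambda>x. a * f x + c * g x) = a * P n f + c * P n g" if "f \<in> Cb2 A d X" "g \<in> Cb2 A d X" for n a c f g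
  proof -
    have "linear_functional_on (Cb2 A d X) (P n)" using ext[of n] by (simp add: extended_to_Cb2_def)
    from this[unfolded linear_functional_on_def, rule_format, OF that, of a c] show ?thesis .
  qed
  obtain s0 where s0: "0 < s0" and tail: "\<And>e. 0 < e \<Longrightarrow> \<exists>L. compact L \<and> (\<forall>n t. 0 < t \<longrightarrow> t < s0 \<longrightarrow>
      (\<forall>h M. h \<in> borel_measurable borel \<longrightarrow> (\<forall>x. norm (h x) \<le> M) \<longrightarrow> (\<forall>x\<in>L. h x = 0) \<longrightarrow> norm (quotient n t h) \<le> M * e))"
    using quotient_tail by blast
  have at0: "at_right (0::real) \<noteq> bot" by simp
  \<comment> \<open>One cutoff serves all \<open>n\<close> and all \<open>f\<close>: the function
    and its truncation agree on \<open>L\<close>, so the quotients of the difference are uniformly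
    small, and this passes to the limit of small times.\<close>
  have cut: "\<exists>u. cutoff u \<and> (\<forall>f M. f \<in> Cb2 A d X \<longrightarrow> C2_bound f M \<longrightarrow>
      (\<lambda>x. complex_of_real (u x) * f x) \<in> Cb2 A d X \<and> csupp (\<lambda>x. complex_of_real (u x) * f x) \<and>
      (\<forall>n. norm (P n f - P n (\<lambda>x. complex_of_real (u x) * f x)) \<le> M * e))" if e: "0 < e" for e
  proof -
    from tail[OF e] obtain L where Lall: "compact L \<and> (\<forall>n t. 0 < t \<longrightarrow> t < s0 \<longrightarrow>
      (\<forall>h M. h \<in> borel_measurable borel \<longrightarrow> (\<forall>x. norm (h x) \<le> M) \<longrightarrow> (\<forall>x\<in>L. h x = 0) \<longrightarrow> norm (quotient n t h) \<le> M * e))" ..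
    then have L: "compact L" by (rule conjunct1)
    note Lq = Lall[THEN conjunct2, rule_format]
    obtain u N where u: "cutoff u" "L \<subseteq> N" "\<forall>x\<in>N. u x = 1" using ex_cutoff_function[OF L open_UNIV] by auto
    have "(\<lambda>x. complex_of_real (u x) * f x) \<in> Cb2 A d X \<and> csupp (\<lambda>x. complex_of_real (u x) * f x) \<and>
      (\<forall>n. norm (P n f - P n (\<lambda>x. complex_of_real (u x) * f x)) \<le> M * e)" if f: "f \<in> Cb2 A d X" and M: "C2_bound f M" for f M
    proof -
      let ?g = "\<lambda>x. of_real (u x) * f x" and ?h = "\<lambda>x. 1 * f x + (- 1) * (complex_of_real (u x) * f x)"
      have f2: "Ck_map 2 f" using f by (simp add: Cb2_eq)
      have g2: "Ck_map 2 ?g"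
        using u(1) by (intro Ck_map_mult Ck_map_of_real f2) (simp add: cutoff_def smooth_def)
      have gs: "csupp ?g" using u(1) by (auto simp: cutoff_def intro: csupp_imp[of u])
      have g: "?g \<in> Cb2 A d X" by (rule csupp_Cb2[OF g2 gs])
      have h: "?h \<in> Cb2 A d X" by (rule Cb2_linear[OF f g])
      have hm: "?h \<in> borel_measurable borel" by (rule Ck_map_meas[OF Ck_map_lin[OF f2 g2]])
      have hb: "\<forall>x. norm (?h x) \<le> M"
      proof
        fix x
        have "?h x = of_real (1 - u x) * f x" by (simp add: algebra_simps)
        then have "norm (?h x) = \<bar>1 - u x\<bar> * norm (f x)" by (simp only: norm_mult norm_of_real)
        also have "\<dots> \<le> 1 * M"
          using u(1) C2_bound_norm[OF M, of x] by (intro mult_mono) (auto simp: cutoff_def abs_le_iff)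
        finally show "norm (?h x) \<le> M" by simp
      qed
      have hL: "\<forall>x\<in>L. ?h x = 0" using u(2,3) by auto
      have q: "norm (quotient n t ?h) \<le> M * e" if "0 < t" "t < s0" for n t
        by (rule Lq[OF that hm]) (rule hb[rule_format], rule hL[rule_format])
      have "norm (P n ?h) \<le> M * e" for n
      proof (rule tendsto_upperbound[OF tendsto_norm[OF lim[OF h, of n]] _ at0])
        show "\<forall>\<^sub>F t in at_right 0. norm (quotient n t ?h) \<le> M * e"
          unfolding eventually_at_right_field by (rule exI[of _ s0]) (intro conjI s0 allI impI q)
      qed
      moreover have "P n ?h = P n f - P n ?g" for n using lin[OF f g, of n 1 "- 1"] by simp
      ultimately show ?thesis using g gs by simp
    qed
    then show ?thesis using u(1) by blast
  qed
  show conv: "\<forall>f\<in>Cb2 A d X. (\<lambda>n. P n f) \<longlonglongrightarrow> P 0 f"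
  proof
    fix f assume f: "f \<in> Cb2 A d X"
    then obtain M where M: "C2_bound f M" by (auto simp: Cb2_eq)
    have M0: "0 \<le> M" using C2_bound_nonneg[OF M] .
    show "(\<lambda>n. P n f) \<longlonglongrightarrow> P 0 f"
    proof (rule LIMSEQ_I)
      fix r :: real assume r: "0 < r"
      define e where "e = (r / 3) / (M + 1)"
      have e: "0 < e" using r M0 by (simp add: e_def)
      have Me: "M * e \<le> r / 3"
      proof -
        have "M * e \<le> e * (M + 1)" using e by (simp add: algebra_simps)
        also have "\<dots> = r / 3" using M0 by (intro nonzero_eq_divide_eq[THEN iffD1, OF _ e_def]) simp
        finally show ?thesis .
      qed
      obtain u where u: "(\<lambda>x. complex_of_real (u x) * f x) \<in> Cb2 A d X" "csupp (\<lambda>x. complex_of_real (u x) * f x)"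
        "\<And>n. norm (P n f - P n (\<lambda>x. complex_of_real (u x) * f x)) \<le> M * e"
        using cut[OF e] f M by blast
      let ?g = "\<lambda>x. of_real (u x) * f x"
      have "translation_continuous ?g"
        using u(1,2) by (intro translation_continuous_csupp) (simp add: Cb2_eq)
      from generator_limit_exchange[OF this lim[OF u(1)]] have "(\<lambda>n. P n ?g) \<longlonglongrightarrow> P 0 ?g" .
      then obtain N where N: "\<And>n. N \<le> n \<Longrightarrow> norm (P n ?g - P 0 ?g) < r / 3"
        using LIMSEQ_D[of "\<lambda>n. P n ?g" "P 0 ?g" "r / 3"] r by auto
      have "norm (P n f - P 0 f) < r" if "N \<le> n" for n
      proof -
        have eq: "P n f - P 0 f = (P n ?g - P 0 ?g) + ((P n f - P n ?g) - (P 0 f - P 0 ?g))" by simp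
        have "norm (P n f - P 0 f) \<le> norm (P n ?g - P 0 ?g) + (norm (P n f - P n ?g) + norm (P 0 f - P 0 ?g))"
          by (subst eq) (rule norm_add_diff_le)
        then show ?thesis using N[OF that] u(3)[of n] u(3)[of 0] Me by linarith
      qed
      then show "\<exists>N. \<forall>n\<ge>N. norm (P n f - P 0 f) < r" by blast
    qed
  qed
  assume P0: "\<forall>f\<in>Cc_smooth A. P 0 f = 0"
  have testf_Cb2: "testf j \<in> Cb2 A d X" for j
    using testf_bound smooth_Ck_map[OF testf_smooth] by (simp add: Cb2_eq)
  \<comment> \<open>The hypothesis covers compactly supported functions only. The value at the
    constant 1 differs by at most \<open>e\<close> from the value at a cutoff, which is 0.\<close>
  have P0_testf: "P 0 (testf j) = 0" for j
  proof (cases "j \<le> d")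
    case True
    then show ?thesis using P0 testf_smooth testf_csupp by (simp add: Cc_smooth_eq)
  next
    case False
    then have one: "testf j = (\<lambda>x. 1)" by (simp add: testf_def)
    have "norm (P 0 (testf j)) \<le> 0 + e" if e: "0 < e" for e
    proof -
      have "C2_bound (testf j) 1" unfolding one using C2_bound_const[of 1] by simp
      with cut[OF e] testf_Cb2[of j] obtain u
        where u: "cutoff u" "norm (P 0 (testf j) - P 0 (\<lambda>x. complex_of_real (u x) * testf j x)) \<le> 1 * e"
        by blast
      have "(\<lambda>x. complex_of_real (u x) * testf j x) \<in> Cc_smooth A"
        using u(1) smooth_of_real csupp_of_real by (simp add: one Cc_smooth_eq cutoff_def)
      then show ?thesis using u(2) P0 by simp
    qed
    then show ?thesis using field_le_epsilon[of "norm (P 0 (testf j))" 0] by simp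
  qed
  \<comment> \<open>\<open>quotient_bound\<close> with M = 1 survives the limit of small times and
    bounds \<open>functional_norm\<close> by this finite sum, whose terms tend to 0 by the
    convergence just proved.\<close>
  define R where "R n = (1 + C) * (\<Sum>j<d + 2. norm (P n (testf j)))" for n
  have "R \<longlonglongrightarrow> (1 + C) * (\<Sum>j<d + 2. norm (P 0 (testf j)))"
    unfolding R_def[abs_def] using conv testf_Cb2 by (intro tendsto_intros) blast
  then have R_lim: "R \<longlonglongrightarrow> 0" using P0_testf by simp
  have le: "functional_norm A d X (P n) \<le> ennreal (R n)" for n
    unfolding functional_norm_def
  proof (rule SUP_least)
    fix f assume "f \<in> {f \<in> Cb2 A d X. Cnorm d X 2 f \<le> 1}"
    then have f: "f \<in> Cb2 A d X" "C2_bound f 1" using Cnorm_le_iff[of 1 f] by simp_all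
    have qlim: "((\<lambda>t. (1 + C) * 1 * qnorm n t) \<longlongrightarrow> (1 + C) * 1 * (\<Sum>j<d + 2. norm (P n (testf j)))) (at_right 0)"
      unfolding qnorm_def by (intro tendsto_intros lim testf_Cb2)
    have "norm (P n f) \<le> (1 + C) * 1 * (\<Sum>j<d + 2. norm (P n (testf j)))"
    proof (rule tendsto_le[OF at0 qlim tendsto_norm[OF lim[OF f(1)]]])
      show "\<forall>\<^sub>F t in at_right 0. norm (quotient n t f) \<le> (1 + C) * 1 * qnorm n t"
        using quotient_bound[OF _ _ f(2), of _ n] f(1) by (simp add: eventually_at_filter Cb2_eq)
    qed
    then show "ennreal (norm (P n f)) \<le> ennreal (R n)" by (intro ennreal_leI) (simp add: R_def)
  qed
  show "(\<lambda>n. functional_norm A d X (P n)) \<longlonglongrightarrow> 0"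
  proof (rule tendsto_sandwich)
    show "\<forall>\<^sub>F n in sequentially. 0 \<le> functional_norm A d X (P n)" by simp
    show "\<forall>\<^sub>F n in sequentially. functional_norm A d X (P n) \<le> ennreal (R n)" using le by simp
    show "(\<lambda>n. ennreal (R n)) \<longlonglongrightarrow> 0" using tendsto_ennrealI[OF R_lim] by simp
  qed simp
qed

end

theorem theorem3p5:
  fixes A :: "('g::{topological_group_add, t2_space, second_countable_topology}, 'e::real_inner) chart set"
    and d :: nat
    and X :: "nat \<Rightarrow> ('g \<Rightarrow> complex) \<Rightarrow> 'g \<Rightarrow> complex"
    and P :: "nat \<Rightarrow> ('g \<Rightarrow> complex) \<Rightarrow> complex"
    and \<mu> :: "nat \<Rightarrow> real \<Rightarrow> 'g measure"
  assumes "lie_group A"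
    and "left_inv_basis A d X"
    and "\<And>n. dissipative_distribution A d X (P n)"
    and "\<And>n. extended_to_Cb2 A d X (P n)"
    and "\<And>n. convolution_semigroup (\<mu> n)"
    and "\<And>n. generating_functional A (P n) (\<mu> n)"
    and "\<And>(f :: 'g \<Rightarrow> complex) t. f \<in> bcontfun \<Longrightarrow> 0 < t \<Longrightarrow>
           (\<lambda>n. \<integral>x. f x \<partial>\<mu> n t) \<longlonglongrightarrow> (\<integral>x. f x \<partial>\<mu> 0 t)"
  shows "(\<forall>f\<in>Cb2 A d X. (\<lambda>n. P n f) \<longlonglongrightarrow> P 0 f) \<and>
         ((\<forall>f\<in>Cc_smooth A. P 0 f = 0) \<longrightarrow> (\<lambda>n. functional_norm A d X (P n)) \<longlonglongrightarrow> 0)"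
proof -
  obtain U0 \<phi>0 b l where "framed_lie_group A d X U0 \<phi>0 b l"
    using left_inv_basis_frame[OF assms(1,2)] by blast
  then interpret framed_lie_group A d X U0 \<phi>0 b l .
  obtain \<xi> \<psi> C where tf: "test_functions \<xi> \<psi> C" using ex_test_functions by blast
  interpret semigroup_sequence_test A d X U0 \<phi>0 b l \<mu> \<xi> \<psi> C
    by unfold_locales (fact assms(5,7) tf)+
  show ?thesis using generators_convergence[OF assms(6,4)] by blast
qed

end
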